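(* Let $\Gamma\subset \mathrm{SL}_2(\mathbb{Z})$ be a subgroup of finite index, $\rho:\Gamma\to \mathrm{GL}(V(\rho))$ a representation on a finite dimensional complex vector space, $k\in\mathbb{Z}$, $d\in\mathbb{Z}_{\ge 0}$, and let $f$ be a nonzero polyharmonic weak Maaß form for $\rho$ of weight $k$ and exact depth $d$. Let $M(\varphi_f)$ be the associated Harish-Chandra module and $V_f$ the associated quiver representation. Then exactly one of the following cases associated with the weight $k$ holds, and in each case $V_f$ is a cyclic representation of the indicated type and dimension vector. For $k<1$ ($V_f$ is a cyclic representation of the Gelfand quiver of type $\ast$; the dimension vector is $(\dim V_-,\dim V_\ast,\dim V_+)$): (Ia) $\mathrm{L}_k\Delta_k^d f=0$ and $\mathrm{R}_k^{1-k}\Delta_k^d f=0$; dimension vector $(d,d+1,d)$. (Ib) $\mathrm{L}_k\Delta_k^d f=0$ and $\mathrm{R}_k^{1-k}\Delta_k^d f\neq 0$; dimension vector $(d,d+1,d+1)$. (Ic) $\mathrm{L}_k\Delta_k^d f\ne 0$ and $\mathrm{R}_k^{1-k}\Delta_k^d f=0$; dimension vector $(d+1,d+1,d)$. (Id) $\mathrm{L}_k\Delta_k^d f\neq 0$ and $\mathrm{R}_k^{1-k}\Delta_k^d f\neq 0$; dimension vector $(d+1,d+1,d+1)$. For $k=1$ ($V_f$ is a cyclic representation of the two-cyclic quiver of type $+$; the dimension vector is $(\dim V_-,\dim V_+)$): (IIa) $\mathrm{L}_k\Delta_k^d f=0$; dimension vector $(d,d+1)$. (IIb) $\mathrm{L}_k\Delta_k^d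 f\neq0$; dimension vector $(d+1,d+1)$. For $k>1$ ($V_f$ is a cyclic representation of the Gelfand quiver of type $+$; the dimension vector is $(\dim V_-,\dim V_\ast,\dim V_+)$): (IIIa) $\mathrm{L}_k\Delta_k^d f=0$ and, if $d\ge 1$, $\mathrm{L}_k^k\Delta_k^{d-1} f\neq 0$; dimension vector $(d,d,d+1)$. (IIIb) $\mathrm{L}_k\Delta_k^d f\neq0$ and $\mathrm{L}_k^k\Delta_k^{d} f=0$; dimension vector $(d,d+1,d+1)$. (IIIc) $\mathrm{L}_k^k\Delta_k^{d} f\neq 0$; dimension vector $(d+1,d+1,d+1)$. (IIId) $d\ge1$ and $\mathrm{L}_k^k\Delta_k^{d-1} f=0$; dimension vector $(d-1,d,d+1)$. Consequently the isomorphism class of $M(\varphi_f)$ is determined by $k$, $d$ and the case that applies to $f$.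
   Context: **Maaß forms.** $\mathbb{H}=\{\tau=x+iy: y>0\}$, $(f|_k g)(\tau)=(c\tau+d)^{-k}f(g\tau)$ for $g=\begin{pmatrix}a&b\\c&d\end{pmatrix}\in\mathrm{SL}_2(\mathbb{R})$. The operators are $\mathrm{L}_k=-2iy^2\partial_{\bar\tau}$, $\mathrm{R}_k=2i\partial_\tau+ky^{-1}$, $\Delta_k=-\mathrm{R}_{k-2}\mathrm{L}_k$, $\mathrm{L}_k^j=\mathrm{L}_{k-2(j-1)}\circ\cdots\circ\mathrm{L}_{k-2}\circ\mathrm{L}_k$, $\mathrm{R}_k^j=\mathrm{R}_{k+2(j-1)}\circ\cdots\circ\mathrm{R}_{k+2}\circ\mathrm{R}_k$. A smooth $f:\mathbb{H}\to V(\rho)$ is a polyharmonic weak Maaß form for $\rho$ of weight $k$ and depth $d$ if (i) $f|_k\gamma=\rho(\gamma)f$ for all $\gamma\in\Gamma$, (ii) $\Delta_k^{d+1}f=0$, (iii) $\|(f|_k\gamma)(\tau)\|\ll\exp(ay)$ as $y\to\infty$ for some $a\in\mathbb{R}$, some norm on $V(\rho)$ and all $\gamma\in\mathrm{SL}_2(\mathbb{Z})$. A nonzero such $f$ has exact depth $d$ if $d=0$ or $\Delta_k^d f\ne0$. **Harish-Chandra modules.** $G=\mathrm{SL}_2(\mathbb{R})$, $K=\mathrm{SO}_2(\mathbb{R})$, $\mathfrak{g}=\mathrm{Lie}(G)\otimes_{\mathbb R}\mathbb{C}=\mathfrak{sl}_2(\mathbb{C})$ with basis $H=\begin{pmatrix}0&-i\\i&0\end{pmatrix}$,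 $X=\frac12\begin{pmatrix}1&i\\i&-1\end{pmatrix}$, $Y=\frac12\begin{pmatrix}1&-i\\-i&-1\end{pmatrix}$, so $[H,X]=2X$, $[H,Y]=-2Y$, $[X,Y]=H$. For a $(\mathfrak{g},K)$-module $M$ put $M_n=\{v\in M: Hv=nv\}$. To $f$ attach $\varphi_f:G\to V(\rho)$, $\varphi_f(g)=(f|_kg)(i)$. The group $K$ and the Lie algebra $\mathfrak{g}$ act by right translation on smooth functions $\varphi: G\to V(\rho)$ with $\varphi(hg)=\rho(h)\varphi(g)$ ($h\in\Gamma$) which are $K$-finite and finite under the center of $U(\mathfrak{g})$; $M(\varphi_f)$ is the $(\mathfrak{g},K)$-submodule generated by $\varphi_f$. Put $l=|k-1|$. Then $M=M(\varphi_f)$ is a Harish-Chandra module (finitely generated over $U(\mathfrak{g})$, direct sum of finite dimensional $M_n$, $n\in\mathbb{Z}$) with $M=\bigoplus_{i\in\mathbb{Z}}M_{-l-1+2i}$ on which $C-(l^2-1)$ is nilpotent, where $C=H^2-2H+4XY$ is the Casimir element. **Quiver representations.** The two-cyclic quiver has vertices $-,+$ and arrows $a:-\to+$, $b:+\to-$. The Gelfand quiver has vertices $-,\ast,+$, arrows $a_\pm:\pm\to\ast$, $b_\pm:\ast\to\pm$ and the relation $a_-b_-=a_+b_+$. Representations are finite dimensional and nilpotent (all sufficiently long paths act as zero). If $k=1$ (so $l=0$), $V_f$ is the representation of the two-cyclic quiver with $V_-=M_{-1}$, $V_+=M_1$, $a=X|_{M_{-1}}$, $b=Y|_{M_1}$.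 If $k\neq1$, $V_f$ is the representation of the Gelfand quiver with $V_-=M_{-l-1}$, $V_\ast=M_{-l+1}$, $V_+=M_{l+1}$, $a_-=X|_{M_{-l-1}}$, $b_-=Y|_{M_{-l+1}}$, $b_+=X^{l}|_{M_{-l+1}}$, $a_+=X_\ast^{-1}\circ Y|_{M_{l+1}}$, where $X_\ast=X^{l-1}:M_{-l+1}\to M_{l-1}$, which is an isomorphism. A nonzero representation $V$ is cyclic of type $i$ ($i$ a vertex) if it is generated, as a representation, by a single vector in $V_i$ (equivalently, it is a quotient of the indecomposable projective module attached to the vertex $i$). *)

theory Defs
  imports
    "HOL-Analysis.Analysis"
    "HOL-Algebra.Coset"
    "HOL-Library.Function_Algebras"
    "HOL-Library.Landau_Symbols"
begin

section \<open>Groups and representations\<close>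

definition SL2R :: "(real^2^2) monoid" where
  "SL2R = \<lparr>carrier = {g. det g = 1}, mult = (**), one = mat 1\<rparr>"

definition SL2Z :: "(real^2^2) monoid" where
  "SL2Z = SL2R\<lparr>carrier := {g. det g = 1 \<and> (\<forall>i j. g $ i $ j \<in> \<int>)}\<rparr>"

definition GLC :: "(complex^'n^'n) monoid" where
  "GLC = \<lparr>carrier = {A. invertible A}, mult = (**), one = mat 1\<rparr>"

text \<open>A finite dimensional complex representation is realised, after choosing a basis, on
  \<open>complex^'n\<close>. Only the values of \<open>\<rho>\<close> on \<open>\<Gamma>\<close> matter.\<close>

definition finite_index_rep :: "(real^2^2) set \<Rightarrow> (real^2^2 \<Rightarrow> complex^'n^'n) \<Rightarrow> bool" where
  "finite_index_rep \<Gamma> \<rho> \<longleftrightarrow>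
     subgroup \<Gamma> SL2Z \<and> finite (rcosets\<^bsub>SL2Z\<^esub> \<Gamma>) \<and> \<rho> \<in> hom (SL2Z\<lparr>carrier := \<Gamma>\<rparr>) GLC"


section \<open>Functions on the upper half plane\<close>

text \<open>A function on the upper half plane is represented by a function on \<open>complex\<close> whose values
  off the upper half plane are never used; equalities are therefore always restricted
  to \<open>\<tau> \<in> UHP\<close>.\<close>

definition UHP :: "complex set" where
  "UHP = {\<tau>. Im \<tau> > 0}"

definition zero_on_UHP :: "(complex \<Rightarrow> complex^'n) \<Rightarrow> bool" where
  "zero_on_UHP f \<longleftrightarrow> (\<forall>\<tau>\<in>UHP. f \<tau> = 0)"

text \<open>The following is meaningful for open \<open>S\<close>.\<close>

primrec differentiable_times_on ::
    "nat \<Rightarrow> ('a::real_normed_vector \<Rightarrow> 'b::real_normed_vector) \<Rightarrow> 'a set \<Rightarrow> bool" where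
  "differentiable_times_on 0 f S \<longleftrightarrow> continuous_on S f"
| "differentiable_times_on (Suc n) f S \<longleftrightarrow>
     f differentiable_on S \<and>
     (\<forall>v. differentiable_times_on n (\<lambda>x. frechet_derivative f (at x) v) S)"

definition smooth_on ::
    "('a::real_normed_vector \<Rightarrow> 'b::real_normed_vector) \<Rightarrow> 'a set \<Rightarrow> bool" where
  "smooth_on f S \<longleftrightarrow> (\<forall>n. differentiable_times_on n f S)"

definition automorphy :: "real^2^2 \<Rightarrow> complex \<Rightarrow> complex" where
  "automorphy g \<tau> = of_real (g$2$1) * \<tau> + of_real (g$2$2)"

definition moebius :: "real^2^2 \<Rightarrow> complex \<Rightarrow> complex" where
  "moebius g \<tau> = (of_real (g$1$1) * \<tau> + of_real (g$1$2)) / automorphy g \<tau>"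

definition slash :: "int \<Rightarrow> (complex \<Rightarrow> complex^'n) \<Rightarrow> real^2^2 \<Rightarrow> complex \<Rightarrow> complex^'n" where
  "slash k f g \<tau> = (automorphy g \<tau> powi (- k)) *s f (moebius g \<tau>)"

definition d_tau :: "(complex \<Rightarrow> complex^'n) \<Rightarrow> complex \<Rightarrow> complex^'n" where
  "d_tau f \<tau> = (1/2) *s (frechet_derivative f (at \<tau>) 1 - \<i> *s frechet_derivative f (at \<tau>) \<i>)"

definition d_tau_bar :: "(complex \<Rightarrow> complex^'n) \<Rightarrow> complex \<Rightarrow> complex^'n" where
  "d_tau_bar f \<tau> = (1/2) *s (frechet_derivative f (at \<tau>) 1 + \<i> *s frechet_derivative f (at \<tau>) \<i>)"

definition lower_op :: "int \<Rightarrow> (complex \<Rightarrow> complex^'n) \<Rightarrow> complex \<Rightarrow> complex^'n" where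
  "lower_op k f \<tau> = (- 2 * \<i> * of_real ((Im \<tau>)\<^sup>2)) *s d_tau_bar f \<tau>"

definition raise_op :: "int \<Rightarrow> (complex \<Rightarrow> complex^'n) \<Rightarrow> complex \<Rightarrow> complex^'n" where
  "raise_op k f \<tau> = (2 * \<i>) *s d_tau f \<tau> + (of_int k / of_real (Im \<tau>)) *s f \<tau>"

definition laplace_op :: "int \<Rightarrow> (complex \<Rightarrow> complex^'n) \<Rightarrow> complex \<Rightarrow> complex^'n" where
  "laplace_op k f = (\<lambda>\<tau>. - raise_op (k - 2) (lower_op k f) \<tau>)"

primrec lower_iter :: "int \<Rightarrow> nat \<Rightarrow> (complex \<Rightarrow> complex^'n) \<Rightarrow> complex \<Rightarrow> complex^'n" where
  "lower_iter k 0 f = f"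
| "lower_iter k (Suc j) f = lower_op (k - 2 * int j) (lower_iter k j f)"

primrec raise_iter :: "int \<Rightarrow> nat \<Rightarrow> (complex \<Rightarrow> complex^'n) \<Rightarrow> complex \<Rightarrow> complex^'n" where
  "raise_iter k 0 f = f"
| "raise_iter k (Suc j) f = raise_op (k + 2 * int j) (raise_iter k j f)"

abbreviation laplace_iter :: "int \<Rightarrow> nat \<Rightarrow> (complex \<Rightarrow> complex^'n) \<Rightarrow> complex \<Rightarrow> complex^'n" where
  "laplace_iter k j f \<equiv> (laplace_op k ^^ j) f"

text \<open>The filter \<open>filtercomap Im at_top\<close> expresses \<open>y \<rightarrow> \<infinity>\<close>, uniformly in \<open>x\<close>; the implied constant
  may depend on \<open>\<gamma>\<close>.\<close>

definition polyharmonic_weak_maass_form ::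
    "(real^2^2) set \<Rightarrow> (real^2^2 \<Rightarrow> complex^'n^'n) \<Rightarrow> int \<Rightarrow> nat \<Rightarrow> (complex \<Rightarrow> complex^'n) \<Rightarrow> bool" where
  "polyharmonic_weak_maass_form \<Gamma> \<rho> k d f \<longleftrightarrow>
     smooth_on f UHP \<and>
     (\<forall>\<gamma>\<in>\<Gamma>. \<forall>\<tau>\<in>UHP. slash k f \<gamma> \<tau> = \<rho> \<gamma> *v f \<tau>) \<and>
     zero_on_UHP (laplace_iter k (d + 1) f) \<and>
     (\<exists>a::real. \<forall>\<gamma>\<in>carrier SL2Z.
        (\<lambda>\<tau>. norm (slash k f \<gamma> \<tau>)) \<in> O[filtercomap Im at_top](\<lambda>\<tau>. exp (a * Im \<tau>)))"

definition exact_depth_maass_form ::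
    "(real^2^2) set \<Rightarrow> (real^2^2 \<Rightarrow> complex^'n^'n) \<Rightarrow> int \<Rightarrow> nat \<Rightarrow> (complex \<Rightarrow> complex^'n) \<Rightarrow> bool" where
  "exact_depth_maass_form \<Gamma> \<rho> k d f \<longleftrightarrow>
     polyharmonic_weak_maass_form \<Gamma> \<rho> k d f \<and> \<not> zero_on_UHP f \<and>
     (d = 0 \<or> \<not> zero_on_UHP (laplace_iter k d f))"


section \<open>Quiver representations\<close>

text \<open>A representation of a quiver with source and target maps \<open>src\<close>, \<open>tgt\<close> on subspaces of an
  ambient vector space: \<open>V\<close> assigns a subspace to every vertex, \<open>F\<close> a map to every arrow (only
  its restriction to the subspace at the source matters). A path is the list of its arrows in
  the order in which they are applied.\<close>

locale complex_space = vector_space scale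
  for scale :: "complex \<Rightarrow> 'b::ab_group_add \<Rightarrow> 'b"
begin

definition linear_between :: "'b set \<Rightarrow> 'b set \<Rightarrow> ('b \<Rightarrow> 'b) \<Rightarrow> bool" where
  "linear_between U W T \<longleftrightarrow>
     (\<forall>u\<in>U. T u \<in> W) \<and> (\<forall>u\<in>U. \<forall>v\<in>U. T (u + v) = T u + T v) \<and> (\<forall>c. \<forall>u\<in>U. T (scale c u) = scale c (T u))"

definition nilpotent_quiver_maps ::
    "('e \<Rightarrow> 'i) \<Rightarrow> ('e \<Rightarrow> 'i) \<Rightarrow> ('i \<Rightarrow> 'b set) \<Rightarrow> ('e \<Rightarrow> 'b \<Rightarrow> 'b) \<Rightarrow> bool" where
  "nilpotent_quiver_maps src tgt V F \<longleftrightarrow>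
     (\<exists>N. \<forall>p. p \<noteq> [] \<and> length p \<ge> N \<and> successively (\<lambda>a b. tgt a = src b) p \<longrightarrow>
        (\<forall>v\<in>V (src (hd p)). fold F p v = 0))"

definition quiver_rep ::
    "('e \<Rightarrow> 'i) \<Rightarrow> ('e \<Rightarrow> 'i) \<Rightarrow> ('i \<Rightarrow> 'b set) \<Rightarrow> ('e \<Rightarrow> 'b \<Rightarrow> 'b) \<Rightarrow> bool" where
  "quiver_rep src tgt V F \<longleftrightarrow>
     (\<forall>i. subspace (V i) \<and> (\<exists>B. finite B \<and> span B = V i)) \<and>
     (\<forall>e. linear_between (V (src e)) (V (tgt e)) (F e)) \<and>
     nilpotent_quiver_maps src tgt V F"

definition quiver_subrep ::
    "('e \<Rightarrow> 'i) \<Rightarrow> ('e \<Rightarrow> 'i) \<Rightarrow> ('i \<Rightarrow> 'b set) \<Rightarrow> ('e \<Rightarrow> 'b \<Rightarrow> 'b) \<Rightarrow> ('i \<Rightarrow> 'b set) \<Rightarrow> bool" where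
  "quiver_subrep src tgt V F W \<longleftrightarrow>
     (\<forall>i. subspace (W i) \<and> W i \<subseteq> V i) \<and> (\<forall>e. F e ` W (src e) \<subseteq> W (tgt e))"

definition cyclic_of_type ::
    "('e \<Rightarrow> 'i) \<Rightarrow> ('e \<Rightarrow> 'i) \<Rightarrow> ('i \<Rightarrow> 'b set) \<Rightarrow> ('e \<Rightarrow> 'b \<Rightarrow> 'b) \<Rightarrow> 'i \<Rightarrow> bool" where
  "cyclic_of_type src tgt V F i \<longleftrightarrow>
     (\<exists>j. V j \<noteq> {0}) \<and>
     (\<exists>v\<in>V i. \<forall>W. quiver_subrep src tgt V F W \<and> v \<in> W i \<longrightarrow> W = V)"

end

datatype two_cyclic_vertex = Cyc_minus | Cyc_plus
datatype two_cyclic_arrow = Cyc_a | Cyc_b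

primrec cyc_src :: "two_cyclic_arrow \<Rightarrow> two_cyclic_vertex" where
  "cyc_src Cyc_a = Cyc_minus"
| "cyc_src Cyc_b = Cyc_plus"

primrec cyc_tgt :: "two_cyclic_arrow \<Rightarrow> two_cyclic_vertex" where
  "cyc_tgt Cyc_a = Cyc_plus"
| "cyc_tgt Cyc_b = Cyc_minus"

datatype gelfand_vertex = Gel_minus | Gel_star | Gel_plus
datatype gelfand_arrow = Gel_a_minus | Gel_a_plus | Gel_b_minus | Gel_b_plus

primrec gel_src :: "gelfand_arrow \<Rightarrow> gelfand_vertex" where
  "gel_src Gel_a_minus = Gel_minus"
| "gel_src Gel_a_plus = Gel_plus"
| "gel_src Gel_b_minus = Gel_star"
| "gel_src Gel_b_plus = Gel_star"

primrec gel_tgt :: "gelfand_arrow \<Rightarrow> gelfand_vertex" where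
  "gel_tgt Gel_a_minus = Gel_star"
| "gel_tgt Gel_a_plus = Gel_star"
| "gel_tgt Gel_b_minus = Gel_minus"
| "gel_tgt Gel_b_plus = Gel_plus"

definition (in complex_space) gelfand_rep ::
    "(gelfand_vertex \<Rightarrow> 'b set) \<Rightarrow> (gelfand_arrow \<Rightarrow> 'b \<Rightarrow> 'b) \<Rightarrow> bool" where
  "gelfand_rep V F \<longleftrightarrow>
     quiver_rep gel_src gel_tgt V F \<and>
     (\<forall>v\<in>V Gel_star. F Gel_a_minus (F Gel_b_minus v) = F Gel_a_plus (F Gel_b_plus v))"

definition (in complex_space) two_cyclic_rep ::
    "(two_cyclic_vertex \<Rightarrow> 'b set) \<Rightarrow> (two_cyclic_arrow \<Rightarrow> 'b \<Rightarrow> 'b) \<Rightarrow> bool" where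
  "two_cyclic_rep V F \<longleftrightarrow> quiver_rep cyc_src cyc_tgt V F"


section \<open>The module attached to a form\<close>

text \<open>A function on \<open>SL\<^sub>2(\<real>)\<close> is represented by a function on all matrices that vanishes off
  \<open>SL\<^sub>2(\<real>)\<close>, so that equality of functions is equality on the group.\<close>

definition fun_scale :: "complex \<Rightarrow> (real^2^2 \<Rightarrow> complex^'n) \<Rightarrow> real^2^2 \<Rightarrow> complex^'n" where
  "fun_scale c \<phi> = (\<lambda>g. c *s \<phi> g)"

global_interpretation fun_vs: complex_space
  "fun_scale :: complex \<Rightarrow> (real^2^2 \<Rightarrow> complex^'n) \<Rightarrow> real^2^2 \<Rightarrow> complex^'n"
  by unfold_locales
    (auto simp: fun_scale_def fun_eq_iff vec_eq_iff algebra_simps)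

definition maass_lift :: "int \<Rightarrow> (complex \<Rightarrow> complex^'n) \<Rightarrow> real^2^2 \<Rightarrow> complex^'n" where
  "maass_lift k f = (\<lambda>g. if g \<in> carrier SL2R then slash k f g \<i> else 0)"

text \<open>The library's \<open>exp\<close> is not available on \<open>real^2^2\<close>, whose type class multiplication is
  componentwise.\<close>

definition matrix_exp :: "real^2^2 \<Rightarrow> real^2^2" where
  "matrix_exp A = (\<Sum>n. (1 / fact n) *\<^sub>R (((**) A ^^ n) (mat 1)))"

definition right_translate :: "real^2^2 \<Rightarrow> (real^2^2 \<Rightarrow> complex^'n) \<Rightarrow> real^2^2 \<Rightarrow> complex^'n" where
  "right_translate h \<phi> = (\<lambda>g. \<phi> (g ** h))"

definition SO2 :: "(real^2^2) set" where
  "SO2 = {h. rotation_matrix h}"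

definition right_derivative :: "real^2^2 \<Rightarrow> (real^2^2 \<Rightarrow> complex^'n) \<Rightarrow> real^2^2 \<Rightarrow> complex^'n" where
  "right_derivative A \<phi> = (\<lambda>g. vector_derivative (\<lambda>t. \<phi> (g ** matrix_exp (t *\<^sub>R A))) (at 0))"

text \<open>Complex linear extension of the action of \<open>sl\<^sub>2(\<real>)\<close> to \<open>sl\<^sub>2(\<complex>)\<close>.\<close>

definition sl2C :: "(complex^2^2) set" where
  "sl2C = {Z. trace Z = 0}"

definition lie_act :: "complex^2^2 \<Rightarrow> (real^2^2 \<Rightarrow> complex^'n) \<Rightarrow> real^2^2 \<Rightarrow> complex^'n" where
  "lie_act Z \<phi> =
     right_derivative (map_matrix Re Z) \<phi> + fun_scale \<i> (right_derivative (map_matrix Im Z) \<phi>)"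

definition sl2_H :: "complex^2^2" where
  "sl2_H = vector [vector [0, - \<i>], vector [\<i>, 0]]"

definition sl2_X :: "complex^2^2" where
  "sl2_X = map_matrix (\<lambda>z. z / 2) (vector [vector [1, \<i>], vector [\<i>, - 1]])"

definition sl2_Y :: "complex^2^2" where
  "sl2_Y = map_matrix (\<lambda>z. z / 2) (vector [vector [1, - \<i>], vector [- \<i>, - 1]])"

text \<open>The submodule generated by a smooth \<open>\<phi>\<close> is its closure under the linear operations and the
  actions of \<open>K\<close> and \<open>sl\<^sub>2(\<complex>)\<close>. The ambient module plays no role: any space of smooth functions
  stable under these operations and containing \<open>\<phi>\<close> contains the closure.\<close>

definition gK_stable :: "(real^2^2 \<Rightarrow> complex^'n) set \<Rightarrow> bool" where
  "gK_stable N \<longleftrightarrow>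
     fun_vs.subspace N \<and>
     (\<forall>h\<in>SO2. \<forall>\<phi>\<in>N. right_translate h \<phi> \<in> N) \<and>
     (\<forall>Z\<in>sl2C. \<forall>\<phi>\<in>N. lie_act Z \<phi> \<in> N)"

definition gK_generated :: "(real^2^2 \<Rightarrow> complex^'n) \<Rightarrow> (real^2^2 \<Rightarrow> complex^'n) set" where
  "gK_generated \<phi> = gK_stable hull {\<phi>}"

definition maass_module :: "int \<Rightarrow> (complex \<Rightarrow> complex^'n) \<Rightarrow> (real^2^2 \<Rightarrow> complex^'n) set" where
  "maass_module k f = gK_generated (maass_lift k f)"

definition gK_isomorphic ::
    "(real^2^2 \<Rightarrow> complex^'n) set \<Rightarrow> (real^2^2 \<Rightarrow> complex^'m) set \<Rightarrow> bool" where
  "gK_isomorphic M N \<longleftrightarrow>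
     (\<exists>T. bij_betw T M N \<and>
        (\<forall>\<phi>\<in>M. \<forall>\<psi>\<in>M. T (\<phi> + \<psi>) = T \<phi> + T \<psi>) \<and>
        (\<forall>c. \<forall>\<phi>\<in>M. T (fun_scale c \<phi>) = fun_scale c (T \<phi>)) \<and>
        (\<forall>h\<in>SO2. \<forall>\<phi>\<in>M. T (right_translate h \<phi>) = right_translate h (T \<phi>)) \<and>
        (\<forall>Z\<in>sl2C. \<forall>\<phi>\<in>M. T (lie_act Z \<phi>) = lie_act Z (T \<phi>)))"

definition weight_space ::
    "(real^2^2 \<Rightarrow> complex^'n) set \<Rightarrow> int \<Rightarrow> (real^2^2 \<Rightarrow> complex^'n) set" where
  "weight_space M n = {\<phi> \<in> M. lie_act sl2_H \<phi> = fun_scale (of_int n) \<phi>}"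


section \<open>The quiver representation attached to a form\<close>

definition maass_l :: "int \<Rightarrow> nat" where
  "maass_l k = nat \<bar>k - 1\<bar>"

definition two_cyclic_space ::
    "(real^2^2 \<Rightarrow> complex^'n) set \<Rightarrow> two_cyclic_vertex \<Rightarrow> (real^2^2 \<Rightarrow> complex^'n) set" where
  "two_cyclic_space M i =
     (case i of Cyc_minus \<Rightarrow> weight_space M (- 1) | Cyc_plus \<Rightarrow> weight_space M 1)"

definition two_cyclic_map ::
    "two_cyclic_arrow \<Rightarrow> (real^2^2 \<Rightarrow> complex^'n) \<Rightarrow> real^2^2 \<Rightarrow> complex^'n" where
  "two_cyclic_map e = (case e of Cyc_a \<Rightarrow> lie_act sl2_X | Cyc_b \<Rightarrow> lie_act sl2_Y)"

definition gelfand_space ::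
    "nat \<Rightarrow> (real^2^2 \<Rightarrow> complex^'n) set \<Rightarrow> gelfand_vertex \<Rightarrow> (real^2^2 \<Rightarrow> complex^'n) set" where
  "gelfand_space l M i =
     (case i of
        Gel_minus \<Rightarrow> weight_space M (- int l - 1)
      | Gel_star \<Rightarrow> weight_space M (- int l + 1)
      | Gel_plus \<Rightarrow> weight_space M (int l + 1))"

definition gelfand_map ::
    "nat \<Rightarrow> (real^2^2 \<Rightarrow> complex^'n) set \<Rightarrow> gelfand_arrow \<Rightarrow>
     (real^2^2 \<Rightarrow> complex^'n) \<Rightarrow> real^2^2 \<Rightarrow> complex^'n" where
  "gelfand_map l M e =
     (case e of
        Gel_a_minus \<Rightarrow> lie_act sl2_X
      | Gel_b_minus \<Rightarrow> lie_act sl2_Y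
      | Gel_b_plus \<Rightarrow> lie_act sl2_X ^^ l
      | Gel_a_plus \<Rightarrow>
          inv_into (weight_space M (- int l + 1)) (lie_act sl2_X ^^ (l - 1)) \<circ> lie_act sl2_Y)"

definition gelfand_cyclic_with_dims ::
    "int \<Rightarrow> (complex \<Rightarrow> complex^'n) \<Rightarrow> gelfand_vertex \<Rightarrow> nat \<times> nat \<times> nat \<Rightarrow> bool" where
  "gelfand_cyclic_with_dims k f i dims \<longleftrightarrow>
     (let M = maass_module k f; V = gelfand_space (maass_l k) M; F = gelfand_map (maass_l k) M in
        fun_vs.gelfand_rep V F \<and>
        fun_vs.cyclic_of_type gel_src gel_tgt V F i \<and>
        (fun_vs.dim (V Gel_minus), fun_vs.dim (V Gel_star), fun_vs.dim (V Gel_plus)) = dims)"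

definition two_cyclic_cyclic_with_dims ::
    "int \<Rightarrow> (complex \<Rightarrow> complex^'n) \<Rightarrow> two_cyclic_vertex \<Rightarrow> nat \<times> nat \<Rightarrow> bool" where
  "two_cyclic_cyclic_with_dims k f i dims \<longleftrightarrow>
     (let M = maass_module k f; V = two_cyclic_space M; F = two_cyclic_map in
        fun_vs.two_cyclic_rep V F \<and>
        fun_vs.cyclic_of_type cyc_src cyc_tgt V F i \<and>
        (fun_vs.dim (V Cyc_minus), fun_vs.dim (V Cyc_plus)) = dims)"


section \<open>The cases\<close>

datatype maass_case = Case_Ia | Case_Ib | Case_Ic | Case_Id | Case_IIa | Case_IIb | Case_IIIa | Case_IIIb | Case_IIIc | Case_IIId

primrec in_case :: "maass_case \<Rightarrow> int \<Rightarrow> nat \<Rightarrow> (complex \<Rightarrow> complex^'n) \<Rightarrow> bool" where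
  "in_case Case_Ia k d f \<longleftrightarrow> k < 1 \<and>
     zero_on_UHP (lower_op k (laplace_iter k d f)) \<and>
     zero_on_UHP (raise_iter k (nat (1 - k)) (laplace_iter k d f))"
| "in_case Case_Ib k d f \<longleftrightarrow> k < 1 \<and>
     zero_on_UHP (lower_op k (laplace_iter k d f)) \<and>
     \<not> zero_on_UHP (raise_iter k (nat (1 - k)) (laplace_iter k d f))"
| "in_case Case_Ic k d f \<longleftrightarrow> k < 1 \<and>
     \<not> zero_on_UHP (lower_op k (laplace_iter k d f)) \<and>
     zero_on_UHP (raise_iter k (nat (1 - k)) (laplace_iter k d f))"
| "in_case Case_Id k d f \<longleftrightarrow> k < 1 \<and>
     \<not> zero_on_UHP (lower_op k (laplace_iter k d f)) \<and>
     \<not> zero_on_UHP (raise_iter k (nat (1 - k)) (laplace_iter k d f))"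
| "in_case Case_IIa k d f \<longleftrightarrow> k = 1 \<and> zero_on_UHP (lower_op k (laplace_iter k d f))"
| "in_case Case_IIb k d f \<longleftrightarrow> k = 1 \<and> \<not> zero_on_UHP (lower_op k (laplace_iter k d f))"
| "in_case Case_IIIa k d f \<longleftrightarrow> k > 1 \<and>
     zero_on_UHP (lower_op k (laplace_iter k d f)) \<and>
     (d \<ge> 1 \<longrightarrow> \<not> zero_on_UHP (lower_iter k (nat k) (laplace_iter k (d - 1) f)))"
| "in_case Case_IIIb k d f \<longleftrightarrow> k > 1 \<and>
     \<not> zero_on_UHP (lower_op k (laplace_iter k d f)) \<and>
     zero_on_UHP (lower_iter k (nat k) (laplace_iter k d f))"
| "in_case Case_IIIc k d f \<longleftrightarrow> k > 1 \<and>
     \<not> zero_on_UHP (lower_iter k (nat k) (laplace_iter k d f))"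
| "in_case Case_IIId k d f \<longleftrightarrow> k > 1 \<and> d \<ge> 1 \<and>
     zero_on_UHP (lower_iter k (nat k) (laplace_iter k (d - 1) f))"

end

theory Submission
  imports Defs
begin

text \<open>The vector v sits at the star vertex for k < 1 and at the plus vertex for k > 1, hence
  the two types. Each root of the scalar part of X Y marks an edge of the weight ladder where the
  round trip is - D. A step outward from v across such an edge kills at most the kernel of D, which
  is one line in a single Jordan block; across all other edges the round trip is a nonzero scalar
  minus a nilpotent map, so nothing is lost. For k < 1 the two special edges lie on opposite sides
  of v and the two possible losses are independent of each other; for k > 1 both lie below v and the
  losses can accumulate, which produces the entry d - 1 of case IIId; for k = 1 the two edges
  coincide. The analysis enters in two places: the bracket [X, Y] = H on lifts rests on the symmetry
  of second partial derivatives, and the Lie algebra action, being defined by a derivative that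
  takes arbitrary values where none exists, has to be confined to functions for which it is
  linear.\<close>

text \<open>Lifting to \<open>SL\<^sub>2(\<real>)\<close> turns the raising and lowering operators into the actions of \<open>X\<close> and \<open>Y\<close>, and
  the Laplacian into a shifted multiple \<open>D\<close> of the Casimir element, which commutes with everything.
  So the module of \<open>f\<close> is spanned by the vectors \<open>X\<^sup>j D\<^sup>i v\<close> and \<open>Y\<^sup>j D\<^sup>i v\<close>, where \<open>v\<close> is the lift of \<open>f\<close>,
  and each weight space is a single Jordan block of \<open>D\<close>. On weight \<open>k + 2j\<close> the product \<open>X Y\<close> is
  \<open>- j (k - 1 + j) - D\<close> with \<open>D\<close> nilpotent, so \<open>X\<close> and \<open>Y\<close> preserve the block size
  except when crossing \<open>j = 0\<close> or \<open>j = 1 - k\<close>, where it changes by at most one. The cases of the theorem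
  record these changes. They fix all block sizes, and with them the structure constants of the basis,
  hence the dimension vectors and the isomorphism class.\<close>

subsection \<open>Smooth functions on open sets\<close>

lemma differentiable_on_open:
  "open S \<Longrightarrow> f differentiable_on S \<longleftrightarrow> (\<forall>x\<in>S. f differentiable at x)"
  by (simp add: differentiable_on_eq_differentiable_at)

text \<open>Needed because the functions live on the whole space while only their values on S
  matter: in an open set the germs agree, hence so do all derivatives.\<close>

lemma differentiable_times_on_cong:
  assumes "open S" "\<And>x. x \<in> S \<Longrightarrow> f x = g x" "differentiable_times_on n f S"
  shows "differentiable_times_on n g S"
  using assms(2,3)
proof (induction n arbitrary: f g)
  case 0
  then show ?case by (metis continuous_on_cong differentiable_times_on.simps(1))
next
  case (Suc n)
  have df: "f differentiable at x" if "x \<in> S" for x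
    using Suc.prems(2) that assms(1) by (simp add: differentiable_on_open)
  have "g differentiable at x" if "x \<in> S" for x
  proof -
    have "(g has_derivative frechet_derivative f (at x)) (at x)"
      using has_derivative_transform_within_open[OF df[OF that, unfolded frechet_derivative_works] assms(1) that]
        Suc.prems(1) by blast
    then show ?thesis by (auto simp: differentiable_def)
  qed
  moreover have "frechet_derivative f (at x) = frechet_derivative g (at x)" if "x \<in> S" for x
    using frechet_derivative_transform_within_open[OF df[OF that] assms(1) that] Suc.prems(1) by metis
  then have "differentiable_times_on n (\<lambda>x. frechet_derivative g (at x) v) S" for v
    using Suc.prems(2) Suc.IH[of "\<lambda>x. frechet_derivative f (at x) v" "\<lambda>x. frechet_derivative g (at x) v"]
    by simp
  ultimately show ?case
    using assms(1) by (simp add: differentiable_on_open)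
qed

text \<open>The definition speaks of the selected function \<open>frechet_derivative\<close>; here
  any pointwise derivative may be supplied, as the calculus rules produce it.\<close>

lemma differentiable_times_on_SucI:
  assumes "open S" "\<And>x. x \<in> S \<Longrightarrow> (f has_derivative f' x) (at x)"
    "\<And>v. differentiable_times_on n (\<lambda>x. f' x v) S"
  shows "differentiable_times_on (Suc n) f S"
proof -
  have "f' x = frechet_derivative f (at x)" if "x \<in> S" for x
    using assms(2)[OF that] by (rule frechet_derivative_at)
  then have "differentiable_times_on n (\<lambda>x. frechet_derivative f (at x) v) S" for v
    by (intro differentiable_times_on_cong[OF assms(1) _ assms(3)]) simp
  moreover have "f differentiable_on S"
    using assms(1,2) by (auto simp: differentiable_on_open differentiable_def)
  ultimately show ?thesis by simp
qed

lemma differentiable_times_on_SucD: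
  assumes "open S" "differentiable_times_on (Suc n) f S"
  shows "x \<in> S \<Longrightarrow> (f has_derivative frechet_derivative f (at x)) (at x)"
    and "differentiable_times_on n (\<lambda>x. frechet_derivative f (at x) v) S"
  using assms by (auto simp: differentiable_on_open frechet_derivative_works[symmetric])

lemma differentiable_times_on_Suc_imp:
  assumes "open S" "differentiable_times_on (Suc n) f S"
  shows "differentiable_times_on n f S"
  using assms(2)
proof (induction n arbitrary: f)
  case 0
  then show ?case by (simp add: differentiable_imp_continuous_on)
next
  case (Suc n)
  then show ?case by (metis differentiable_times_on.simps(2))
qed

lemma differentiable_times_on_add:
  assumes "open S" "differentiable_times_on n f S" "differentiable_times_on n g S"
  shows "differentiable_times_on n (\<lambda>x. f x + g x) S"
  using assms(2,3)
proof (induction n arbitrary: f g)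
  case 0
  then show ?case by (simp add: continuous_on_add)
next
  case (Suc n)
  note d = differentiable_times_on_SucD[OF assms(1)]
  show ?case
    by (intro differentiable_times_on_SucI[OF assms(1)
        has_derivative_add[OF d(1)[OF Suc.prems(1)] d(1)[OF Suc.prems(2)]]]
        Suc.IH[OF d(2)[OF Suc.prems(1)] d(2)[OF Suc.prems(2)]])
qed

text \<open>The product rule leaves sums of products of f, g and their first derivatives, all n
  times differentiable, so the induction closes. It serves both products of scalars and scalars
  times vectors.\<close>

lemma differentiable_times_on_bilinear:
  assumes "open S" "bounded_bilinear h" "differentiable_times_on n f S" "differentiable_times_on n g S"
  shows "differentiable_times_on n (\<lambda>x. h (f x) (g x)) S"
  using assms(3,4)
proof (induction n arbitrary: f g)
  case 0
  then show ?case by (simp add: bounded_bilinear.continuous_on[OF assms(2)])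
next
  case (Suc n)
  note d = differentiable_times_on_SucD[OF assms(1)]
  show ?case
  proof (rule differentiable_times_on_SucI[OF assms(1)
        bounded_bilinear.FDERIV[OF assms(2) d(1)[OF Suc.prems(1)] d(1)[OF Suc.prems(2)]]])
    show "differentiable_times_on n
      (\<lambda>x. h (f x) (frechet_derivative g (at x) v) + h (frechet_derivative f (at x) v) (g x)) S" for v
      by (intro differentiable_times_on_add[OF assms(1)] Suc.IH d(2)[OF Suc.prems(1)] d(2)[OF Suc.prems(2)]
          differentiable_times_on_Suc_imp[OF assms(1) Suc.prems(1)]
          differentiable_times_on_Suc_imp[OF assms(1) Suc.prems(2)])
  qed
qed

lemma smooth_on_differentiable:
  assumes "open S" "smooth_on f S" "x \<in> S"
  shows "(f has_derivative frechet_derivative f (at x)) (at x)"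
proof -
  have "differentiable_times_on (Suc 0) f S" using assms by (simp only: smooth_on_def)
  then show ?thesis using assms by (simp add: differentiable_on_open frechet_derivative_works)
qed

lemma smooth_on_frechet_derivative:
  assumes "smooth_on f S" shows "smooth_on (\<lambda>x. frechet_derivative f (at x) v) S"
  using assms unfolding smooth_on_def by (metis differentiable_times_on.simps(2))

lemma smooth_on_add:
  "open S \<Longrightarrow> smooth_on f S \<Longrightarrow> smooth_on g S \<Longrightarrow> smooth_on (\<lambda>x. f x + g x) S"
  unfolding smooth_on_def using differentiable_times_on_add by blast

lemma smooth_on_bilinear:
  "open S \<Longrightarrow> bounded_bilinear h \<Longrightarrow> smooth_on f S \<Longrightarrow> smooth_on g S \<Longrightarrow>
    smooth_on (\<lambda>x. h (f x) (g x)) S"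
  unfolding smooth_on_def using differentiable_times_on_bilinear by blast

lemma smooth_on_const: "smooth_on (\<lambda>x. c) S"
proof -
  have "differentiable_times_on n (\<lambda>x. c) S" for n
    by (induction n arbitrary: c) (auto simp: differentiable_on_def)
  then show ?thesis by (simp add: smooth_on_def)
qed

lemma smooth_on_linear:
  assumes "bounded_linear L" shows "smooth_on L S"
proof -
  have "frechet_derivative L (at x) = L" for x
    using frechet_derivative_at[OF bounded_linear_imp_has_derivative[OF assms]] by metis
  then have "differentiable_times_on n L S" for n
    using assms smooth_on_const[of _ S]
    by (cases n) (auto simp: linear_continuous_on bounded_linear_imp_differentiable_on smooth_on_def)
  then show ?thesis by (simp add: smooth_on_def)
qed

lemma smooth_on_inverse:
  fixes f :: "'a::real_normed_vector \<Rightarrow> 'b::real_normed_field"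
  assumes "open S" "smooth_on f S" "\<And>x. x \<in> S \<Longrightarrow> f x \<noteq> 0"
  shows "smooth_on (\<lambda>x. inverse (f x)) S"
proof -
  have df: "(f has_derivative frechet_derivative f (at x)) (at x)" if "x \<in> S" for x
    using smooth_on_differentiable[OF assms(1,2) that] .
  have D: "((\<lambda>x. inverse (f x)) has_derivative
      (\<lambda>v. - (inverse (f x) * frechet_derivative f (at x) v * inverse (f x)))) (at x)" if "x \<in> S" for x
    using Deriv.has_derivative_inverse[OF assms(3)[OF that] df[OF that]] .
  then have diff: "(\<lambda>x. inverse (f x)) differentiable_on S"
    using assms(1) by (auto simp: differentiable_on_open differentiable_def)
  have "differentiable_times_on n (\<lambda>x. inverse (f x)) S" for n
  proof (induction n)
    case 0
    then show ?case using diff by (simp add: differentiable_imp_continuous_on)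
  next
    case (Suc n)
    \<comment> \<open>Bootstrapping: the derivative of 1/f is a product of 1/f, f' and 1/f, so
      n-fold differentiability of 1/f gives one order more. The sign is written as a factor to stay
      inside the product rule.\<close>
    have "differentiable_times_on n (\<lambda>x. (- 1) *
        (inverse (f x) * frechet_derivative f (at x) v * inverse (f x))) S" for v
      using Suc smooth_on_frechet_derivative[OF assms(2), of v] smooth_on_const[of "-1" S]
      by (intro differentiable_times_on_bilinear[OF assms(1) bounded_bilinear_mult])
        (auto simp: smooth_on_def)
    then show ?case
      by (intro differentiable_times_on_SucI[OF assms(1) D]) (simp_all del: differentiable_times_on.simps)
  qed
  then show ?thesis by (simp add: smooth_on_def)
qed

text \<open>Two applications of the mean value theorem. The difference quotient is symmetric in \<open>v\<close> and \<open>w\<close>,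
  so its limit is as well.\<close>

lemma second_difference_quotient_tendsto:
  fixes g :: "'a::real_normed_vector \<Rightarrow> real"
  assumes "open S" "x \<in> S"
    and g: "\<And>y. y \<in> S \<Longrightarrow> (g has_derivative g' y) (at y)"
    and h: "\<And>y. y \<in> S \<Longrightarrow> ((\<lambda>y. g' y v) has_derivative h y) (at y)"
    and cont: "continuous_on S (\<lambda>y. h y w)"
  shows "((\<lambda>s. (g (x + s *\<^sub>R v + s *\<^sub>R w) - g (x + s *\<^sub>R v) - g (x + s *\<^sub>R w) + g x) / s\<^sup>2) \<longlongrightarrow> h x w)
    (at_right 0)"
proof (rule tendstoI)
  fix e :: real assume "e > 0"
  have "isCont (\<lambda>y. h y w) x" using cont assms(1,2) by (simp add: continuous_on_eq_continuous_at)
  then obtain d1 where d1: "d1 > 0" "\<And>y. dist y x < d1 \<Longrightarrow> dist (h y w) (h x w) < e"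
    using \<open>e > 0\<close> unfolding continuous_at_eps_delta by blast
  obtain d2 where d2: "d2 > 0" "ball x d2 \<subseteq> S" using assms(1,2) open_contains_ball by blast
  define d where "d = min d1 d2"
  have d: "d > 0" "\<And>y. dist y x < d \<Longrightarrow> y \<in> S \<and> dist (h y w) (h x w) < e"
    using d1 d2 by (auto simp: d_def dist_commute subset_iff)
  \<comment> \<open>The summand 1 keeps K positive even for v = w = 0; for s < d / K the whole
    parallelogram with sides s v and s w stays in the ball of radius d.\<close>
  define K where "K = norm v + norm w + 1"
  have "K > 0" by (simp add: K_def add_nonneg_pos)
  have near: "dist (x + a *\<^sub>R v + b *\<^sub>R w) x < d"
    if "0 \<le> a" "a \<le> s" "0 \<le> b" "b \<le> s" "0 < s" "s < d / K" for a b s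
  proof -
    have "dist (x + a *\<^sub>R v + b *\<^sub>R w) x = norm (a *\<^sub>R v + b *\<^sub>R w)" by (simp add: dist_norm algebra_simps)
    also have "\<dots> \<le> a * norm v + b * norm w" using norm_triangle_ineq[of "a *\<^sub>R v" "b *\<^sub>R w"] that by simp
    also have "\<dots> \<le> s * norm v + s * norm w" using that by (intro add_mono mult_right_mono) auto
    also have "\<dots> < s * K" using that by (simp add: K_def algebra_simps)
    also have "\<dots> < d" using that \<open>K > 0\<close> by (simp add: pos_less_divide_eq)
    finally show ?thesis .
  qed
  have "dist ((g (x + s *\<^sub>R v + s *\<^sub>R w) - g (x + s *\<^sub>R v) - g (x + s *\<^sub>R w) + g x) / s\<^sup>2) (h x w) < e"
    if s: "0 < s" "s < d / K" for s
  proof -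
    \<comment> \<open>The second difference is the increment of u over [0, s]. The mean value
      theorem for u moves the increment along v into a derivative; a second use, for p, does the
      same along w.\<close>
    define u where "u t = g (x + t *\<^sub>R v + s *\<^sub>R w) - g (x + t *\<^sub>R v)" for t
    have u: "DERIV u t :> g' (x + t *\<^sub>R v + s *\<^sub>R w) v - g' (x + t *\<^sub>R v) v" if "0 \<le> t" "t \<le> s" for t
    proof -
      have S1: "x + t *\<^sub>R v + s *\<^sub>R w \<in> S" using d(2) near[of t s s] that s by auto
      have S2: "x + t *\<^sub>R v \<in> S" using d(2) near[of t s 0] that s by auto
      have l: "linear (g' y)" if "y \<in> S" for y using g[OF that] by (rule has_derivative_linear)
      have "((\<lambda>t. g (x + t *\<^sub>R v + s *\<^sub>R w)) has_derivative (\<lambda>r. g' (x + t *\<^sub>R v + s *\<^sub>R w) (r *\<^sub>R v))) (at t)"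
        by (rule has_derivative_compose[where g = g and f = "\<lambda>t. x + t *\<^sub>R v + s *\<^sub>R w", OF _ g[OF S1]]) (auto intro!: derivative_eq_intros)
      moreover have "((\<lambda>t. g (x + t *\<^sub>R v)) has_derivative (\<lambda>r. g' (x + t *\<^sub>R v) (r *\<^sub>R v))) (at t)"
        by (rule has_derivative_compose[where g = g and f = "\<lambda>t. x + t *\<^sub>R v", OF _ g[OF S2]]) (auto intro!: derivative_eq_intros)
      ultimately have "(u has_derivative (\<lambda>r. g' (x + t *\<^sub>R v + s *\<^sub>R w) (r *\<^sub>R v) - g' (x + t *\<^sub>R v) (r *\<^sub>R v))) (at t)"
        unfolding u_def by (rule has_derivative_diff)
      then show ?thesis
        unfolding has_field_derivative_def
        by (rule has_derivative_eq_rhs)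
          (use l[OF S1] l[OF S2] in \<open>auto simp: fun_eq_iff linear_cmul algebra_simps\<close>)
    qed
    obtain \<theta> where \<theta>: "0 < \<theta>" "\<theta> < s"
      "u s - u 0 = (s - 0) * (g' (x + \<theta> *\<^sub>R v + s *\<^sub>R w) v - g' (x + \<theta> *\<^sub>R v) v)"
      using MVT2[of 0 s u, OF s(1) u] by auto
    define p where "p r = g' (x + \<theta> *\<^sub>R v + r *\<^sub>R w) v" for r
    have p: "DERIV p r :> h (x + \<theta> *\<^sub>R v + r *\<^sub>R w) w" if "0 \<le> r" "r \<le> s" for r
    proof -
      have S1: "x + \<theta> *\<^sub>R v + r *\<^sub>R w \<in> S" using d(2) near[of \<theta> s r] that s \<theta> by auto
      have l: "linear (h (x + \<theta> *\<^sub>R v + r *\<^sub>R w))" using h[OF S1] by (rule has_derivative_linear)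
      have "(p has_derivative (\<lambda>q. h (x + \<theta> *\<^sub>R v + r *\<^sub>R w) (q *\<^sub>R w))) (at r)"
        unfolding p_def
        by (rule has_derivative_compose[where g = "\<lambda>y. g' y v" and f = "\<lambda>r. x + \<theta> *\<^sub>R v + r *\<^sub>R w", OF _ h[OF S1]]) (auto intro!: derivative_eq_intros)
      then show ?thesis
        unfolding has_field_derivative_def
        by (rule has_derivative_eq_rhs) (use l in \<open>auto simp: fun_eq_iff linear_cmul algebra_simps\<close>)
    qed
    obtain \<eta> where \<eta>: "0 < \<eta>" "\<eta> < s" "p s - p 0 = (s - 0) * h (x + \<theta> *\<^sub>R v + \<eta> *\<^sub>R w) w"
      using MVT2[of 0 s p, OF s(1) p] by auto
    have "g (x + s *\<^sub>R v + s *\<^sub>R w) - g (x + s *\<^sub>R v) - g (x + s *\<^sub>R w) + g x = u s - u 0"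
      by (simp add: u_def)
    also have "\<dots> = s * (p s - p 0)" using \<theta>(3) by (simp add: p_def)
    also have "\<dots> = s\<^sup>2 * h (x + \<theta> *\<^sub>R v + \<eta> *\<^sub>R w) w" using \<eta>(3) by (simp add: power2_eq_square)
    finally show ?thesis using d(2) near[of \<theta> s \<eta>] s \<theta> \<eta> by simp
  qed
  then show "\<forall>\<^sub>F s in at_right 0. dist ((g (x + s *\<^sub>R v + s *\<^sub>R w) - g (x + s *\<^sub>R v) - g (x + s *\<^sub>R w) + g x) / s\<^sup>2) (h x w) < e"
    using d(1) \<open>K > 0\<close> unfolding eventually_at_right_field by (metis divide_pos_pos)
qed

text \<open>Pairing with an arbitrary b reduces to real values, where both mixed derivatives are
  limits of the same difference quotient. This becomes [X, Y] = H in
  \<open>lower_raise_commutator\<close>.\<close>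

lemma smooth_on_second_derivative_symmetric:
  fixes f :: "'a::real_normed_vector \<Rightarrow> 'b::real_inner"
  assumes "open S" "smooth_on f S" "x \<in> S"
  shows "frechet_derivative (\<lambda>y. frechet_derivative f (at y) v) (at x) w =
    frechet_derivative (\<lambda>y. frechet_derivative f (at y) w) (at x) v"
proof -
  define D where "D v y = frechet_derivative f (at y) v" for v y
  have smooth: "smooth_on (D v) S" for v
    unfolding D_def by (rule smooth_on_frechet_derivative[OF assms(2)])
  have smooth2: "smooth_on (\<lambda>y. frechet_derivative (D v) (at y) w) S" for v w
    by (rule smooth_on_frechet_derivative[OF smooth])
  have lim: "((\<lambda>s. (f (x + s *\<^sub>R v + s *\<^sub>R w) \<bullet> b - f (x + s *\<^sub>R v) \<bullet> b - f (x + s *\<^sub>R w) \<bullet> b + f x \<bullet> b) / s\<^sup>2)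
      \<longlongrightarrow> frechet_derivative (D v) (at x) w \<bullet> b) (at_right 0)" for v w b
  proof (rule second_difference_quotient_tendsto[OF assms(1,3)])
    fix y assume y: "y \<in> S"
    show "((\<lambda>y. f y \<bullet> b) has_derivative (\<lambda>v. D v y \<bullet> b)) (at y)"
      unfolding D_def by (rule has_derivative_inner_left[OF smooth_on_differentiable[OF assms(1,2) y]])
    show "((\<lambda>y. D v y \<bullet> b) has_derivative (\<lambda>w. frechet_derivative (D v) (at y) w \<bullet> b)) (at y)"
      by (rule has_derivative_inner_left[OF smooth_on_differentiable[OF assms(1) smooth y]])
  next
    have "differentiable_times_on 0 (\<lambda>y. frechet_derivative (D v) (at y) w) S"
      using smooth2 smooth_on_def by blast
    then show "continuous_on S (\<lambda>y. frechet_derivative (D v) (at y) w \<bullet> b)"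
      by (intro continuous_intros) simp
  qed
  have "frechet_derivative (D v) (at x) w \<bullet> b = frechet_derivative (D w) (at x) v \<bullet> b" for b
    by (rule tendsto_unique[OF _ lim[of v w b]])
      (use lim[of w v b] in \<open>simp_all add: algebra_simps trivial_limit_at_right_real\<close>)
  then show ?thesis unfolding D_def by (metis vector_eq_rdot)
qed

subsection \<open>The matrix exponential\<close>

lemma matrix_matrix_mult_2:
  fixes A B :: "'a::semiring_1^2^2"
  shows "(A ** B) $ i $ j = A $ i $ 1 * B $ 1 $ j + A $ i $ 2 * B $ 2 $ j"
  by (simp add: matrix_matrix_mult_def sum_2)

definition matrix_power :: "real^2^2 \<Rightarrow> nat \<Rightarrow> real^2^2" where
  "matrix_power A n = ((**) A ^^ n) (mat 1)"

lemma matrix_power_simps [simp]: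
  "matrix_power A 0 = mat 1" "matrix_power A (Suc n) = A ** matrix_power A n"
  by (simp_all add: matrix_power_def)

lemma matrix_power_scaleR: "matrix_power (t *\<^sub>R A) n = t ^ n *\<^sub>R matrix_power A n"
  by (induction n) (simp_all add: vec_eq_iff matrix_matrix_mult_2 algebra_simps)

lemma matrix_power_bound:
  "\<exists>K\<ge>0. \<forall>n i j. \<bar>matrix_power A n $ i $ j\<bar> \<le> K ^ n"
proof -
  \<comment> \<open>The sum of all absolute entries dominates each row sum, and a row sum is the
    factor by which one multiplication by A can enlarge the largest entry.\<close>
  define K where "K = (\<Sum>i\<in>UNIV. \<bar>A $ i $ 1\<bar> + \<bar>A $ i $ 2\<bar>)"
  have K: "K \<ge> 0" "\<bar>A $ i $ 1\<bar> + \<bar>A $ i $ 2\<bar> \<le> K" for i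
    using sum_nonneg[of UNIV "\<lambda>i. \<bar>A $ i $ 1\<bar> + \<bar>A $ i $ 2\<bar>"]
      member_le_sum[of i UNIV "\<lambda>i. \<bar>A $ i $ 1\<bar> + \<bar>A $ i $ 2\<bar>"] by (simp_all add: K_def)
  have "\<bar>matrix_power A n $ i $ j\<bar> \<le> K ^ n" for n i j
  proof (induction n arbitrary: i)
    case 0
    then show ?case by (simp add: mat_def)
  next
    case (Suc n)
    have "\<bar>matrix_power A (Suc n) $ i $ j\<bar>
        \<le> \<bar>A $ i $ 1\<bar> * \<bar>matrix_power A n $ 1 $ j\<bar> + \<bar>A $ i $ 2\<bar> * \<bar>matrix_power A n $ 2 $ j\<bar>"
      using abs_triangle_ineq by (simp add: matrix_matrix_mult_2 flip: abs_mult)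
    also have "\<dots> \<le> \<bar>A $ i $ 1\<bar> * K ^ n + \<bar>A $ i $ 2\<bar> * K ^ n"
      using Suc by (intro add_mono mult_left_mono) auto
    also have "\<dots> = (\<bar>A $ i $ 1\<bar> + \<bar>A $ i $ 2\<bar>) * K ^ n" by (simp add: algebra_simps)
    also have "\<dots> \<le> K ^ Suc n" using K by (auto intro: mult_right_mono)
    finally show ?case .
  qed
  then show ?thesis using K(1) by blast
qed

lemma summable_matrix_power:
  "summable (\<lambda>n. matrix_power A n $ i $ j / fact n * y ^ n)"
proof -
  obtain K where K: "K \<ge> 0" "\<And>n. \<bar>matrix_power A n $ i $ j\<bar> \<le> K ^ n"
    using matrix_power_bound by blast
  have "norm (matrix_power A n $ i $ j / fact n * y ^ n) \<le> inverse (fact n) * (K * \<bar>y\<bar>) ^ n" for n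
    using mult_right_mono[OF K(2)[of n], of "\<bar>y\<bar> ^ n"]
    by (simp add: abs_mult power_abs divide_inverse power_mult_distrib mult_ac)
  then show ?thesis
    by (intro summable_comparison_test[OF _ summable_exp[of "K * \<bar>y\<bar>"]]) blast
qed

text \<open>Entrywise the exponential is a power series in t, so that termwise differentiation of
  real power series applies.\<close>

lemma matrix_exp_scaleR_nth:
  "matrix_exp (t *\<^sub>R A) $ i $ j = (\<Sum>n. matrix_power A n $ i $ j / fact n * t ^ n)"
proof -
  define E :: "real^2^2" where "E = (\<chi> i j. \<Sum>n. matrix_power A n $ i $ j / fact n * t ^ n)"
  have sums: "(\<lambda>n. matrix_power A n $ i $ j / fact n * t ^ n) sums E $ i $ j" for i j
    using summable_matrix_power by (simp add: E_def summable_sums)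
  have "(\<lambda>n. (1 / fact n) *\<^sub>R matrix_power (t *\<^sub>R A) n) sums E"
    unfolding sums_def
  proof (intro vec_tendstoI)
    fix i j
    show "(\<lambda>n. (\<Sum>n<n. (1 / fact n) *\<^sub>R matrix_power (t *\<^sub>R A) n) $ i $ j) \<longlonglongrightarrow> E $ i $ j"
      using sums[of i j] by (simp add: sums_def matrix_power_scaleR mult_ac)
  qed
  then have "matrix_exp (t *\<^sub>R A) = E"
    unfolding matrix_exp_def matrix_power_def by (rule sums_unique[symmetric])
  then show ?thesis by (simp add: E_def)
qed

lemma matrix_exp_has_derivative:
  "((\<lambda>t. matrix_exp (t *\<^sub>R A) $ i $ j) has_real_derivative (A ** matrix_exp (t *\<^sub>R A)) $ i $ j) (at t)"
proof -
  define c where "c i n = matrix_power A n $ i $ j / fact n" for i n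
  have s: "summable (\<lambda>n. c i n * y ^ n)" for i y
    unfolding c_def by (rule summable_matrix_power)
  \<comment> \<open>The factor n + 1 produced by differentiation cancels in the factorial, and the
    power n + 1 of A splits as A times the power n.\<close>
  have "diffs (c i) n * t ^ n = A $ i $ 1 * (c 1 n * t ^ n) + A $ i $ 2 * (c 2 n * t ^ n)" for n
  proof -
    have "diffs (c i) n = (A ** matrix_power A n) $ i $ j / fact n"
      unfolding diffs_def c_def by (simp add: field_simps del: of_nat_Suc)
    then show ?thesis by (simp add: matrix_matrix_mult_2 c_def add_divide_distrib algebra_simps)
  qed
  then have "(\<Sum>n. diffs (c i) n * t ^ n) = (\<Sum>n. A $ i $ 1 * (c 1 n * t ^ n) + A $ i $ 2 * (c 2 n * t ^ n))"
    by simp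
  also have "\<dots> = A $ i $ 1 * (\<Sum>n. c 1 n * t ^ n) + A $ i $ 2 * (\<Sum>n. c 2 n * t ^ n)"
    using s by (subst suminf_add[symmetric]) (auto intro: summable_mult simp: suminf_mult)
  also have "\<dots> = (A ** matrix_exp (t *\<^sub>R A)) $ i $ j"
    by (simp add: matrix_matrix_mult_2 matrix_exp_scaleR_nth c_def)
  finally have "(\<Sum>n. diffs (c i) n * t ^ n) = (A ** matrix_exp (t *\<^sub>R A)) $ i $ j" .
  moreover have "matrix_exp (t *\<^sub>R A) $ i $ j = (\<Sum>n. c i n * t ^ n)" for t
    by (simp add: matrix_exp_scaleR_nth c_def)
  ultimately show ?thesis
    using termdiffs_strong_converges_everywhere[OF s[of i], of t] by (simp only:)
qed

lemma matrix_exp_0: "matrix_exp 0 = mat 1"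
proof -
  \<comment> \<open>Writing 0 as a multiple of some matrix makes the entrywise power series
    available; at t = 0 only its constant term survives.\<close>
  have "matrix_exp (0 *\<^sub>R mat 1) $ i $ j = mat 1 $ i $ j" for i j
    by (subst matrix_exp_scaleR_nth) (subst powser_zero, simp)
  then show ?thesis by (simp add: vec_eq_iff)
qed

text \<open>Along the one-parameter group the derivative of the determinant is the trace of A times
  the determinant, hence zero, and the value at t = 0 is 1.\<close>

lemma det_matrix_exp:
  assumes "trace A = 0"
  shows "det (matrix_exp (t *\<^sub>R A)) = 1"
proof -
  define D where "D t = det (matrix_exp (t *\<^sub>R A))" for t
  have tr: "A $ 2 $ 2 = - A $ 1 $ 1" using assms by (simp add: trace_def sum_2 add_eq_0_iff)
  note E = matrix_exp_has_derivative[of A]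
  have "(D has_real_derivative 0) (at t)" for t
    unfolding D_def det_2
    by (rule derivative_eq_intros E refl)+ (simp add: matrix_matrix_mult_2 tr algebra_simps)
  then have "D t = D 0" using DERIV_isconst_all by blast
  then show ?thesis by (simp add: D_def matrix_exp_0)
qed

subsection \<open>The Lie algebra action on lifts\<close>

lemma open_UHP: "open UHP"
  unfolding UHP_def by (rule open_halfspace_Im_gt)

lemma bounded_bilinear_vector_scalar_mult:
  "bounded_bilinear ((*s) :: complex \<Rightarrow> complex^'n \<Rightarrow> complex^'n)"
proof -
  have "bilinear ((*s) :: complex \<Rightarrow> complex^'n \<Rightarrow> complex^'n)"
    by (auto simp: bilinear_def linear_iff vec_eq_iff algebra_simps)
  then show ?thesis by (simp add: bilinear_conv_bounded_bilinear)
qed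

lemma SL2R_carrier: "g \<in> carrier SL2R \<longleftrightarrow> det g = 1"
  by (simp add: SL2R_def)

text \<open>Row i of g as a linear form evaluated at \<i>: the numerator (i = 1) and the denominator
  (i = 2) of the point g \<i>. Since rows depend linearly on g, the computations on the group reduce
  to two complex numbers.\<close>

definition row_eval :: "real^2^2 \<Rightarrow> 2 \<Rightarrow> complex" where
  "row_eval g i = Complex (g $ i $ 2) (g $ i $ 1)"

lemma automorphy_i: "automorphy g \<i> = row_eval g 2"
  by (simp add: automorphy_def row_eval_def complex_eq_iff)

lemma moebius_i: "moebius g \<i> = row_eval g 1 / row_eval g 2"
  by (simp add: moebius_def automorphy_i) (simp add: row_eval_def complex_eq_iff)

text \<open>The determinant is the area form on the two rows. The identity yields both that the
  automorphy factor is nonzero and that the imaginary part of g \<i> is the inverse square of its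
  modulus.\<close>

lemma row_eval_det:
  "row_eval g 1 * cnj (row_eval g 2) - cnj (row_eval g 1) * row_eval g 2 = 2 * \<i> * of_real (det g)"
  by (simp add: row_eval_def complex_eq_iff det_2 algebra_simps)

lemma row_eval_nonzero:
  assumes "det g = 1" shows "row_eval g 2 \<noteq> 0"
  using row_eval_det[of g] assms by auto

lemma Im_moebius_i:
  assumes "det g = 1"
  shows "of_real (Im (moebius g \<i>)) = inverse (row_eval g 2 * cnj (row_eval g 2))"
proof -
  define p q where "p = row_eval g 1" "q = row_eval g 2"
  have q: "q \<noteq> 0" using row_eval_nonzero[OF assms] by (simp add: p_q_def)
  have "2 * \<i> * of_real (Im (p / q)) = p / q - cnj (p / q)"
    using complex_diff_cnj[of "p / q"] by simp
  also have "\<dots> = 2 * \<i> / (q * cnj q)"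
    using row_eval_det[of g] assms q by (simp add: p_q_def[symmetric] field_simps)
  finally show ?thesis unfolding moebius_i p_q_def[symmetric] by (simp add: divide_inverse mult.assoc)
qed

lemma moebius_i_UHP:
  assumes "det g = 1" shows "moebius g \<i> \<in> UHP"
proof -
  have "Im (moebius g \<i>) = Re (inverse (row_eval g 2 * cnj (row_eval g 2)))"
    using arg_cong[OF Im_moebius_i[OF assms], of Re] by simp
  also have "\<dots> > 0"
    using row_eval_nonzero[OF assms]
    by (simp flip: complex_norm_square of_real_power of_real_inverse)
  finally show ?thesis by (simp add: UHP_def)
qed

lemma UHP_moebius_i:
  assumes "\<tau> \<in> UHP" obtains g where "det g = 1" "moebius g \<i> = \<tau>"
proof -
  define y where "y = Im \<tau>"
  have y: "y > 0" using assms by (simp add: y_def UHP_def)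
  \<comment> \<open>The upper triangular matrix of the Iwasawa decomposition: scale \<i> by y, then
    translate by the real part.\<close>
  define g :: "real^2^2" where "g = vector [vector [sqrt y, Re \<tau> / sqrt y], vector [0, 1 / sqrt y]]"
  have "det g = 1" using y by (simp add: g_def det_2)
  moreover have "moebius g \<i> = \<tau>"
    using y by (simp add: moebius_i row_eval_def g_def complex_eq_iff y_def[symmetric] Re_divide Im_divide power2_eq_square)
  ultimately show thesis using that by blast
qed

lemma maass_lift_apply:
  "det g = 1 \<Longrightarrow> maass_lift k f g = (row_eval g 2 powi (- k)) *s f (moebius g \<i>)"
  by (simp add: maass_lift_def SL2R_carrier slash_def automorphy_i)

lemma maass_lift_outside: "det g \<noteq> 1 \<Longrightarrow> maass_lift k f g = 0"
  by (simp add: maass_lift_def SL2R_carrier)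

text \<open>The orbit of \<i> is the whole upper half plane and automorphy factors do not vanish.
  All conditions in the cases are turned into statements about vectors through this
  equivalence.\<close>

lemma maass_lift_eq_0_iff: "maass_lift k f = 0 \<longleftrightarrow> zero_on_UHP f"
proof
  assume L: "maass_lift k f = 0"
  show "zero_on_UHP f"
    unfolding zero_on_UHP_def
  proof
    fix \<tau> assume "\<tau> \<in> UHP"
    then obtain g where g: "det g = 1" "moebius g \<i> = \<tau>" by (rule UHP_moebius_i)
    have "(row_eval g 2 powi (- k)) *s f \<tau> = 0"
      using maass_lift_apply[OF g(1), of k f] L g(2) by simp
    then show "f \<tau> = 0" using row_eval_nonzero[OF g(1)] by simp
  qed
next
  assume "zero_on_UHP f"
  then show "maass_lift k f = 0"
    by (auto simp: fun_eq_iff zero_on_UHP_def maass_lift_def SL2R_carrier slash_def moebius_i_UHP)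
qed

text \<open>The value predicted by the product and chain rules for q to the power - k times f (p /
  q), where p and q are the rows of g and move with the velocities given by the rows of
  \<open>g ** A\<close>.\<close>

definition lift_derivative ::
    "int \<Rightarrow> (complex \<Rightarrow> complex^'n) \<Rightarrow> real^2^2 \<Rightarrow> real^2^2 \<Rightarrow> complex^'n" where
  "lift_derivative k f A g =
     (of_int (- k) * row_eval g 2 powi (- k - 1) * row_eval (g ** A) 2) *s f (moebius g \<i>)
     + (row_eval g 2 powi (- k)) *s frechet_derivative f (at (moebius g \<i>))
       ((row_eval (g ** A) 1 * row_eval g 2 - row_eval g 1 * row_eval (g ** A) 2) / (row_eval g 2)\<^sup>2)"

lemma maass_lift_has_vector_derivative:
  assumes f: "smooth_on f UHP" and A: "trace A = 0" and g: "det g = 1"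
  shows "((\<lambda>t. maass_lift k f (g ** matrix_exp (t *\<^sub>R A))) has_vector_derivative lift_derivative k f A g) (at 0)"
proof -
  define M where "M t = g ** matrix_exp (t *\<^sub>R A)" for t
  \<comment> \<open>The curve stays inside the group, so the explicit formula for the lift holds
    along all of it and not just at t = 0.\<close>
  have detM: "det (M t) = 1" for t by (simp add: M_def det_mul g det_matrix_exp[OF A])
  have M0: "M 0 = g" by (simp add: M_def matrix_exp_0)
  have dM: "((\<lambda>t. M t $ i $ j) has_real_derivative (g ** A) $ i $ j) (at 0)" for i j
    unfolding M_def matrix_matrix_mult_2
    by (rule derivative_eq_intros matrix_exp_has_derivative refl)+
      (simp add: matrix_exp_0 matrix_matrix_mult_2)
  have drow: "((\<lambda>t. row_eval (M t) i) has_vector_derivative row_eval (g ** A) i) (at 0)" for i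
    using dM[of i 1] dM[of i 2]
    by (simp add: has_vector_derivative_complex_iff row_eval_def)
  define q q' p p' where "q = row_eval g 2" "q' = row_eval (g ** A) 2"
    "p = row_eval g 1" "p' = row_eval (g ** A) 1"
  note abb = q_q'_p_p'_def[symmetric]
  have q: "q \<noteq> 0" using row_eval_nonzero[OF g] by (simp add: abb)
  have dpow: "((\<lambda>t. row_eval (M t) 2 powi n) has_vector_derivative (q' * (of_int n * q powi (n - 1)))) (at 0)" for n
  proof -
    have "((\<lambda>z. z powi n) has_field_derivative (of_int n * q powi (n - 1))) (at q)"
      by (rule derivative_eq_intros refl | use q in simp)+
    from field_vector_diff_chain_at[OF drow[of 2], unfolded M0 abb, OF this]
    show ?thesis by (simp add: o_def)
  qed
  have "((\<lambda>t. row_eval (M t) 1 * row_eval (M t) 2 powi (- 1)) has_vector_derivative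
      (row_eval (M 0) 1 * (q' * (of_int (- 1) * q powi (- 1 - 1))) + p' * row_eval (M 0) 2 powi (- 1))) (at 0)"
    using has_vector_derivative_mult[OF drow[of 1] dpow[of "-1"]] by (simp add: abb)
  moreover have "row_eval (M 0) 1 * (q' * (of_int (- 1) * q powi (- 1 - 1))) + p' * row_eval (M 0) 2 powi (- 1)
      = (p' * q - p * q') / q\<^sup>2"
    using q by (simp add: M0 abb power_int_def field_simps power2_eq_square numeral_2_eq_2)
  ultimately have dz: "((\<lambda>t. moebius (M t) \<i>) has_vector_derivative (p' * q - p * q') / q\<^sup>2) (at 0)"
    by (simp add: moebius_i power_int_minus divide_inverse)
  have df: "(f has_derivative frechet_derivative f (at (moebius g \<i>))) (at (moebius (M 0) \<i>))"
    using smooth_on_differentiable[OF open_UHP f moebius_i_UHP[OF g]] by (simp add: M0)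
  have "((\<lambda>t. f (moebius (M t) \<i>)) has_derivative
      (\<lambda>t. frechet_derivative f (at (moebius g \<i>)) (t *\<^sub>R ((p' * q - p * q') / q\<^sup>2)))) (at 0)"
    by (rule has_derivative_compose[where g = f and f = "\<lambda>t. moebius (M t) \<i>",
        OF dz[unfolded has_vector_derivative_def] df])
  then have dfz: "((\<lambda>t. f (moebius (M t) \<i>)) has_vector_derivative
      frechet_derivative f (at (moebius g \<i>)) ((p' * q - p * q') / q\<^sup>2)) (at 0)"
    unfolding has_vector_derivative_def by (simp only: linear_cmul[OF has_derivative_linear[OF df]])
  have "((\<lambda>t. (row_eval (M t) 2 powi (- k)) *s f (moebius (M t) \<i>)) has_vector_derivative
      (row_eval (M 0) 2 powi (- k)) *s frechet_derivative f (at (moebius g \<i>)) ((p' * q - p * q') / q\<^sup>2)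
      + (q' * (of_int (- k) * q powi (- k - 1))) *s f (moebius (M 0) \<i>)) (at 0)"
    by (rule bounded_bilinear.has_vector_derivative[OF bounded_bilinear_vector_scalar_mult dpow dfz])
  moreover have "maass_lift k f (M t) = (row_eval (M t) 2 powi (- k)) *s f (moebius (M t) \<i>)" for t
    by (rule maass_lift_apply[OF detM])
  ultimately show ?thesis
    unfolding M_def[symmetric] lift_derivative_def by (simp add: M0 abb mult_ac add.commute)
qed

text \<open>The condition under which \<open>vector_derivative\<close> is a genuine derivative in
  every direction, and therefore \<open>right_derivative\<close> is linear.\<close>

definition lift_differentiable :: "(real^2^2 \<Rightarrow> complex^'n) \<Rightarrow> bool" where
  "lift_differentiable \<phi> \<longleftrightarrow>
     (\<forall>A g. trace A = 0 \<longrightarrow> (\<lambda>t. \<phi> (g ** matrix_exp (t *\<^sub>R A))) differentiable (at 0))"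

lemma right_derivative_maass_lift:
  assumes "smooth_on f UHP" "trace A = 0"
  shows "right_derivative A (maass_lift k f) g = (if det g = 1 then lift_derivative k f A g else 0)"
proof (cases "det g = 1")
  case True
  then show ?thesis
    unfolding right_derivative_def
    using vector_derivative_at[OF maass_lift_has_vector_derivative[OF assms]] by simp
next
  case False
  \<comment> \<open>A curve starting outside the group never enters it, as the exponential factor
    has determinant 1; both sides are zero there.\<close>
  then have "maass_lift k f (g ** matrix_exp (t *\<^sub>R A)) = 0" for t
    by (simp add: maass_lift_outside det_mul det_matrix_exp[OF assms(2)])
  then show ?thesis using False by (simp add: right_derivative_def)
qed

lemma lift_differentiable_maass_lift:
  assumes "smooth_on f UHP"
  shows "lift_differentiable (maass_lift k f)"
  unfolding lift_differentiable_def
proof (intro allI impI)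
  fix A g assume A: "trace (A :: real^2^2) = 0"
  show "(\<lambda>t. maass_lift k f (g ** matrix_exp (t *\<^sub>R A))) differentiable at 0"
  proof (cases "det g = 1")
    case True
    show ?thesis
      by (rule differentiableI_vector[OF maass_lift_has_vector_derivative[OF assms A True]])
  next
    case False
    then have "maass_lift k f (g ** matrix_exp (t *\<^sub>R A)) = 0" for t
      by (simp add: maass_lift_outside det_mul det_matrix_exp[OF A])
    then show ?thesis by simp
  qed
qed

text \<open>f need not be holomorphic, so its derivative is only real linear and must be expanded in
  the real basis 1, \<i>.\<close>

lemma frechet_derivative_complex:
  assumes "smooth_on f UHP" "z \<in> UHP"
  shows "frechet_derivative f (at z) w =
    of_real (Re w) *s frechet_derivative f (at z) 1 + of_real (Im w) *s frechet_derivative f (at z) \<i>"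
proof -
  have l: "linear (frechet_derivative f (at z))"
    using smooth_on_differentiable[OF open_UHP assms] by (rule has_derivative_linear)
  have "w = Re w *\<^sub>R 1 + Im w *\<^sub>R \<i>" by (simp add: complex_eq_iff)
  then have "frechet_derivative f (at z) w = frechet_derivative f (at z) (Re w *\<^sub>R 1 + Im w *\<^sub>R \<i>)"
    by simp
  also have "\<dots> = Re w *\<^sub>R frechet_derivative f (at z) 1 + Im w *\<^sub>R frechet_derivative f (at z) \<i>"
    by (simp add: linear_add[OF l] linear_cmul[OF l])
  finally show ?thesis by (simp add: vec_eq_iff) (simp add: scaleR_conv_of_real)
qed

lemma linear_lift_derivative:
  assumes "smooth_on f UHP" "det g = 1"
  shows "lift_derivative k f (a *\<^sub>R A + b *\<^sub>R B) g =
    of_real a *s lift_derivative k f A g + of_real b *s lift_derivative k f B g"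
proof -
  have l: "linear (frechet_derivative f (at (moebius g \<i>)))"
    using smooth_on_differentiable[OF open_UHP assms(1) moebius_i_UHP[OF assms(2)]]
    by (rule has_derivative_linear)
  define w where "w A = (row_eval (g ** A) 1 * row_eval g 2 - row_eval g 1 * row_eval (g ** A) 2) / (row_eval g 2)\<^sup>2" for A
  have gA: "row_eval (g ** (a *\<^sub>R A + b *\<^sub>R B)) i = a *\<^sub>R row_eval (g ** A) i + b *\<^sub>R row_eval (g ** B) i" for i
    by (simp add: row_eval_def complex_eq_iff matrix_matrix_mult_2 algebra_simps)
  have w: "w (a *\<^sub>R A + b *\<^sub>R B) = a *\<^sub>R w A + b *\<^sub>R w B"
    unfolding w_def gA by (simp add: scaleR_conv_of_real algebra_simps add_divide_distrib diff_divide_distrib)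
  show ?thesis
    unfolding lift_derivative_def w_def[symmetric]
    unfolding w linear_add[OF l] linear_cmul[OF l] gA
    by (simp add: vec_eq_iff) (simp add: scaleR_conv_of_real algebra_simps)
qed

lemma sl2_real_imaginary_parts:
  "map_matrix Re sl2_H = 0" "map_matrix Im sl2_H = vector [vector [0, - 1], vector [1, 0]]"
  "map_matrix Re sl2_X = vector [vector [1 / 2, 0], vector [0, - 1 / 2]]"
  "map_matrix Im sl2_X = vector [vector [0, 1 / 2], vector [1 / 2, 0]]"
  "map_matrix Re sl2_Y = vector [vector [1 / 2, 0], vector [0, - 1 / 2]]"
  "map_matrix Im sl2_Y = vector [vector [0, - 1 / 2], vector [- 1 / 2, 0]]"
  by (auto simp: vec_eq_iff forall_2 sl2_H_def sl2_X_def sl2_Y_def)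

lemma trace_real_imaginary_parts:
  "Z \<in> sl2C \<Longrightarrow> trace (map_matrix Re Z) = 0" "Z \<in> sl2C \<Longrightarrow> trace (map_matrix Im Z) = 0"
  by (auto simp: sl2C_def trace_def sum_2 complex_eq_iff)

lemma sl2_in_sl2C [simp]: "sl2_H \<in> sl2C" "sl2_X \<in> sl2C" "sl2_Y \<in> sl2C"
  by (auto simp: sl2C_def trace_def sum_2 sl2_H_def sl2_X_def sl2_Y_def)

lemma lie_act_maass_lift:
  assumes "smooth_on f UHP" "Z \<in> sl2C"
  shows "lie_act Z (maass_lift k f) g =
    (if det g = 1 then lift_derivative k f (map_matrix Re Z) g + \<i> *s lift_derivative k f (map_matrix Im Z) g else 0)"
  using assms by (simp add: lie_act_def right_derivative_maass_lift trace_real_imaginary_parts fun_scale_def)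

text \<open>The infinitesimal rotation multiplies both rows by \<i>. The point g \<i> therefore has
  velocity zero, and only the automorphy factor contributes.\<close>

lemma lift_derivative_rotation:
  fixes f :: "complex \<Rightarrow> complex^'n"
  assumes "smooth_on f UHP" "det g = 1"
  shows "lift_derivative k f (vector [vector [0, - 1], vector [1, 0]]) g = (- \<i> * of_int k) *s maass_lift k f g"
proof -
  define J :: "real^2^2" where "J = vector [vector [0, - 1], vector [1, 0]]"
  have r: "row_eval (g ** J) i = \<i> * row_eval g i" for i
    by (simp add: row_eval_def J_def matrix_matrix_mult_2 complex_eq_iff)
  have q: "row_eval g 2 \<noteq> 0" using row_eval_nonzero[OF assms(2)] .
  have p: "row_eval g 2 powi (- k) = row_eval g 2 powi (- k - 1) * row_eval g 2"
    using power_int_add[of "row_eval g 2" "- k - 1" 1] q by simp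
  have "frechet_derivative f (at (moebius g \<i>)) 0 = 0"
    using has_derivative_linear[OF smooth_on_differentiable[OF open_UHP assms(1) moebius_i_UHP[OF assms(2)]]]
    by (rule linear_0)
  then show ?thesis
    by (simp add: lift_derivative_def J_def[symmetric] r maass_lift_apply[OF assms(2)] p vec_eq_iff)
qed

text \<open>On rows the trace-free symmetric matrices act as complex conjugation up to a scalar. So
  the numerator of the velocity of g \<i> is the expression of \<open>row_eval_det\<close>, a
  constant, while the factor \<open>cnj q\<close> in the first term later becomes the 1 / y of the
  raising operator.\<close>

lemma lift_derivative_noncompact:
  fixes f :: "complex \<Rightarrow> complex^'n"
  assumes "smooth_on f UHP" "det g = 1"
  defines "q \<equiv> row_eval g 2" and "z \<equiv> moebius g \<i>"
  shows "lift_derivative k f (vector [vector [1 / 2, 0], vector [0, - 1 / 2]]) g =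
      (of_int k / 2 * (q powi (- k - 1) * cnj q)) *s f z + (q powi (- k)) *s frechet_derivative f (at z) (\<i> / q\<^sup>2)"
    and "lift_derivative k f (vector [vector [0, 1 / 2], vector [1 / 2, 0]]) g =
      (- \<i> * of_int k / 2 * (q powi (- k - 1) * cnj q)) *s f z + (q powi (- k)) *s frechet_derivative f (at z) (1 / q\<^sup>2)"
    and "lift_derivative k f (vector [vector [0, - 1 / 2], vector [- 1 / 2, 0]]) g =
      (\<i> * of_int k / 2 * (q powi (- k - 1) * cnj q)) *s f z - (q powi (- k)) *s frechet_derivative f (at z) (1 / q\<^sup>2)"
proof -
  define A B C :: "real^2^2" where "A = vector [vector [1 / 2, 0], vector [0, - 1 / 2]]"
    and "B = vector [vector [0, 1 / 2], vector [1 / 2, 0]]"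
    and "C = vector [vector [0, - 1 / 2], vector [- 1 / 2, 0]]"
  define p where "p = row_eval g 1"
  have A: "row_eval (g ** A) i = - cnj (row_eval g i) / 2" for i
    by (simp add: row_eval_def A_def matrix_matrix_mult_2 complex_eq_iff)
  have B: "row_eval (g ** B) i = \<i> * cnj (row_eval g i) / 2" for i
    by (simp add: row_eval_def B_def matrix_matrix_mult_2 complex_eq_iff)
  have C: "row_eval (g ** C) i = - (\<i> * cnj (row_eval g i) / 2)" for i
    by (simp add: row_eval_def C_def matrix_matrix_mult_2 complex_eq_iff)
  have d: "p * cnj q - cnj p * q = 2 * \<i>"
    using row_eval_det[of g] assms(2) by (simp add: p_def q_def)
  have wA: "- cnj p / 2 * q - p * (- cnj q / 2) = \<i>"
    using arg_cong[OF d, of "\<lambda>x. x / 2"] by (simp add: field_simps)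
  have wB: "\<i> * cnj p / 2 * q - p * (\<i> * cnj q / 2) = 1"
    using arg_cong[OF d, of "\<lambda>x. - \<i> * x / 2"] by (simp add: field_simps)
  have wC: "- (\<i> * cnj p / 2) * q - p * - (\<i> * cnj q / 2) = - 1"
    using arg_cong[OF wB, of uminus] by simp
  have l: "linear (frechet_derivative f (at z))"
    using smooth_on_differentiable[OF open_UHP assms(1) moebius_i_UHP[OF assms(2)]]
    unfolding z_def by (rule has_derivative_linear)
  have neg: "frechet_derivative f (at z) (- 1 / q\<^sup>2) = - frechet_derivative f (at z) (1 / q\<^sup>2)"
    using linear_neg[OF l, of "1 / q\<^sup>2"] by simp
  show "lift_derivative k f A g =
      (of_int k / 2 * (q powi (- k - 1) * cnj q)) *s f z + (q powi (- k)) *s frechet_derivative f (at z) (\<i> / q\<^sup>2)"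
    unfolding lift_derivative_def A q_def[symmetric] p_def[symmetric] z_def[symmetric] wA
    by (simp add: mult_ac)
  show "lift_derivative k f B g =
      (- \<i> * of_int k / 2 * (q powi (- k - 1) * cnj q)) *s f z + (q powi (- k)) *s frechet_derivative f (at z) (1 / q\<^sup>2)"
    unfolding lift_derivative_def B q_def[symmetric] p_def[symmetric] z_def[symmetric] wB
    by (simp add: mult_ac)
  show "lift_derivative k f C g =
      (\<i> * of_int k / 2 * (q powi (- k - 1) * cnj q)) *s f z - (q powi (- k)) *s frechet_derivative f (at z) (1 / q\<^sup>2)"
    unfolding lift_derivative_def C q_def[symmetric] p_def[symmetric] z_def[symmetric] wC neg
    by (simp add: mult_ac vec_eq_iff)
qed

lemma lie_act_H_maass_lift:
  assumes "smooth_on f UHP"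
  shows "lie_act sl2_H (maass_lift k f) = fun_scale (of_int k) (maass_lift k f)"
proof
  fix g
  have "lift_derivative k f 0 g = 0" if "det g = 1"
    using linear_lift_derivative[OF assms that, of k 0 0 0 0] by simp
  then show "lie_act sl2_H (maass_lift k f) g = fun_scale (of_int k) (maass_lift k f) g"
    using assms
    by (simp add: lie_act_maass_lift sl2_real_imaginary_parts lift_derivative_rotation fun_scale_def
        maass_lift_outside)
qed

lemma powi_minus_two:
  fixes q :: complex
  assumes "q \<noteq> 0"
  shows "q powi (- k) = q powi (- (k + 2)) * q\<^sup>2" "q powi (- k - 1) = q powi (- (k + 2)) * q"
  using power_int_add[of q "- (k + 2)" 2] power_int_add[of q "- (k + 2)" 1] assms
    minus_diff_commute[of 1 k] by simp_all

lemma lie_act_X_maass_lift: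
  fixes f :: "complex \<Rightarrow> complex^'n"
  assumes "smooth_on f UHP"
  shows "lie_act sl2_X (maass_lift k f) = maass_lift (k + 2) (raise_op k f)"
proof
  fix g
  show "lie_act sl2_X (maass_lift k f) g = maass_lift (k + 2) (raise_op k f) g"
  proof (cases "det g = 1")
    case True
    define q z where "q = row_eval g 2" and "z = moebius g \<i>"
    define D where "D = frechet_derivative f (at z)"
    have q: "q \<noteq> 0" using row_eval_nonzero[OF True] by (simp add: q_def)
    have D: "D w = of_real (Re w) *s D 1 + of_real (Im w) *s D \<i>" for w
      unfolding D_def z_def by (rule frechet_derivative_complex[OF assms moebius_i_UHP[OF True]])
    \<comment> \<open>This combination retains the complex linear part of the derivative and cancels
      the conjugate linear one, so the factor u can be pulled out.\<close>
    have D2: "D (\<i> / q\<^sup>2) + \<i> *s D (1 / q\<^sup>2) = (1 / q\<^sup>2) *s (\<i> *s D 1 + D \<i>)"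
    proof -
      define u where "u = 1 / q\<^sup>2"
      have "D (\<i> * u) + \<i> *s D u = u *s (\<i> *s D 1 + D \<i>)"
        unfolding D[of "\<i> * u"] D[of u] by (simp add: vec_eq_iff complex_eq_iff algebra_simps)
      then show ?thesis by (simp add: u_def)
    qed
    have y: "of_int k / of_real (Im z) = of_int k * (q * cnj q)"
      using Im_moebius_i[OF True] by (simp add: q_def z_def divide_inverse)
    note nc = lift_derivative_noncompact[OF assms True, of k, folded q_def z_def, folded D_def]
    have comb: "(K / 2 * m) *s a + r *s b + \<i> *s ((- \<i> * K / 2 * m) *s a + r *s c) = (K * m) *s a + r *s (b + \<i> *s c)" for K m r :: complex and a b c :: "complex^'n"
      by (simp add: vec_eq_iff algebra_simps)
    have comb2: "(K * (r * q * cnj q)) *s a + (r * q\<^sup>2) *s ((1 / q\<^sup>2) *s (\<i> *s b + c)) =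
        r *s ((2 * \<i>) *s ((1 / 2) *s (b - \<i> *s c)) + (K * (q * cnj q)) *s a)" for K r and a b c :: "complex^'n"
      using q by (simp add: vec_eq_iff algebra_simps)
    have "lie_act sl2_X (maass_lift k f) g =
      (of_int k * (q powi (- k - 1) * cnj q)) *s f z + (q powi (- k)) *s (D (\<i> / q\<^sup>2) + \<i> *s D (1 / q\<^sup>2))"
    proof -
      have "lie_act sl2_X (maass_lift k f) g =
          (of_int k / 2 * (q powi (- k - 1) * cnj q)) *s f z + (q powi (- k)) *s D (\<i> / q\<^sup>2)
          + \<i> *s ((- \<i> * of_int k / 2 * (q powi (- k - 1) * cnj q)) *s f z + (q powi (- k)) *s D (1 / q\<^sup>2))"
        unfolding lie_act_maass_lift[OF assms sl2_in_sl2C(2)] sl2_real_imaginary_parts nc using True by simp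
      also have "\<dots> = (of_int k * (q powi (- k - 1) * cnj q)) *s f z
          + (q powi (- k)) *s (D (\<i> / q\<^sup>2) + \<i> *s D (1 / q\<^sup>2))"
        by (rule comb)
      finally show ?thesis .
    qed
    also have "\<dots> = (q powi (- (k + 2))) *s
        ((2 * \<i>) *s ((1 / 2) *s (D 1 - \<i> *s D \<i>)) + (of_int k / of_real (Im z)) *s f z)"
      unfolding D2 y powi_minus_two[OF q, of k] by (rule comb2)
    also have "\<dots> = maass_lift (k + 2) (raise_op k f) g"
      by (simp add: maass_lift_apply[OF True] raise_op_def d_tau_def D_def q_def z_def)
    finally show ?thesis .
  qed (use assms in \<open>simp add: lie_act_maass_lift maass_lift_outside\<close>)
qed

text \<open>Opposite to X: the conjugate linear part of the derivative survives, and the two terms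
  containing f itself cancel, which is why the lowering operator has no term in k.\<close>

lemma lie_act_Y_maass_lift:
  fixes f :: "complex \<Rightarrow> complex^'n"
  assumes "smooth_on f UHP"
  shows "lie_act sl2_Y (maass_lift k f) = maass_lift (k - 2) (lower_op k f)"
proof
  fix g
  show "lie_act sl2_Y (maass_lift k f) g = maass_lift (k - 2) (lower_op k f) g"
  proof (cases "det g = 1")
    case True
    define q z where "q = row_eval g 2" and "z = moebius g \<i>"
    define D where "D = frechet_derivative f (at z)"
    have q: "q \<noteq> 0" using row_eval_nonzero[OF True] by (simp add: q_def)
    have D: "D w = of_real (Re w) *s D 1 + of_real (Im w) *s D \<i>" for w
      unfolding D_def z_def by (rule frechet_derivative_complex[OF assms moebius_i_UHP[OF True]])
    have D2: "D (\<i> / q\<^sup>2) - \<i> *s D (1 / q\<^sup>2) = (1 / (cnj q)\<^sup>2) *s (D \<i> - \<i> *s D 1)"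
    proof -
      define u where "u = 1 / q\<^sup>2"
      have "D (\<i> * u) - \<i> *s D u = cnj u *s (D \<i> - \<i> *s D 1)"
        unfolding D[of "\<i> * u"] D[of u] by (simp add: vec_eq_iff complex_eq_iff algebra_simps)
      then show ?thesis by (simp add: u_def)
    qed
    have y: "of_real ((Im z)\<^sup>2) = 1 / (q\<^sup>2 * (cnj q)\<^sup>2)"
      using Im_moebius_i[OF True] by (simp add: q_def z_def divide_inverse power_mult_distrib power_inverse)
    note nc = lift_derivative_noncompact[OF assms True, of k, folded q_def z_def, folded D_def]
    have comb: "(K / 2 * m) *s a + r *s b + \<i> *s ((\<i> * K / 2 * m) *s a - r *s c) = r *s (b - \<i> *s c)" for K m r :: complex and a b c :: "complex^'n"
      by (simp add: vec_eq_iff algebra_simps)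
    have comb2: "r *s ((1 / (cnj q)\<^sup>2) *s (c - \<i> *s b)) =
        (r * q\<^sup>2) *s ((- 2 * \<i> * (1 / (q\<^sup>2 * (cnj q)\<^sup>2))) *s ((1 / 2) *s (b + \<i> *s c)))" for r and b c :: "complex^'n"
      using q by (simp add: vec_eq_iff field_simps)
    have "lie_act sl2_Y (maass_lift k f) g = (q powi (- k)) *s (D (\<i> / q\<^sup>2) - \<i> *s D (1 / q\<^sup>2))"
    proof -
      have "lie_act sl2_Y (maass_lift k f) g =
          (of_int k / 2 * (q powi (- k - 1) * cnj q)) *s f z + (q powi (- k)) *s D (\<i> / q\<^sup>2)
          + \<i> *s ((\<i> * of_int k / 2 * (q powi (- k - 1) * cnj q)) *s f z - (q powi (- k)) *s D (1 / q\<^sup>2))"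
        unfolding lie_act_maass_lift[OF assms sl2_in_sl2C(3)] sl2_real_imaginary_parts nc using True by simp
      also have "\<dots> = (q powi (- k)) *s (D (\<i> / q\<^sup>2) - \<i> *s D (1 / q\<^sup>2))"
        by (rule comb)
      finally show ?thesis .
    qed
    also have "\<dots> = (q powi (- (k - 2))) *s
        ((- 2 * \<i> * of_real ((Im z)\<^sup>2)) *s ((1 / 2) *s (D 1 + \<i> *s D \<i>)))"
    proof -
      have "q powi (- (k - 2)) = q powi (- k) * q\<^sup>2" using powi_minus_two(1)[OF q, of "k - 2"] by simp
      then show ?thesis unfolding D2 y by (simp only: comb2)
    qed
    also have "\<dots> = maass_lift (k - 2) (lower_op k f) g"
      by (simp add: maass_lift_apply[OF True] lower_op_def d_tau_bar_def D_def q_def z_def)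
    finally show ?thesis .
  qed (use assms in \<open>simp add: lie_act_maass_lift maass_lift_outside\<close>)
qed

subsection \<open>Linear actions of \<open>sl\<^sub>2\<close>\<close>

lemma (in complex_space) finite_decomposition:
  assumes "x \<in> span (\<Union>j. S j)"
  shows "\<exists>J w. finite J \<and> (\<forall>j. w j \<in> span (S j)) \<and> x = (\<Sum>j\<in>J. w j)"
  using assms
proof (induction rule: span_induct_alt)
  case base
  have "finite {} \<and> (\<forall>j. (0::'b) \<in> span (S j)) \<and> 0 = (\<Sum>j\<in>{}. 0)" by (simp add: span_zero)
  then show ?case by (intro exI[of _ "{}"] exI[of _ "\<lambda>_. 0"]) simp
next
  case (step c x y)
  then obtain J w where J: "finite J" "\<And>j. w j \<in> span (S j)" "y = (\<Sum>j\<in>J. w j)" by blast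
  obtain j0 where j0: "x \<in> S j0" using step by blast
  \<comment> \<open>Outside J the old components need not vanish, so they are cut off before the new
    vector is added to component j0, which may or may not belong to J.\<close>
  define w' where "w' j = (if j \<in> J then w j else 0) + (if j = j0 then scale c x else 0)" for j
  have "(\<Sum>j\<in>insert j0 J. w' j) = (\<Sum>j\<in>insert j0 J. if j \<in> J then w j else 0)
      + (\<Sum>j\<in>insert j0 J. if j = j0 then scale c x else 0)"
    by (simp only: w'_def sum.distrib)
  also have "(\<Sum>j\<in>insert j0 J. if j \<in> J then w j else 0) = (\<Sum>j\<in>J. w j)"
    using J(1) by (intro sum.mono_neutral_cong_right) auto
  also have "(\<Sum>j\<in>insert j0 J. if j = j0 then scale c x else 0) = scale c x"
    using J(1) by (simp add: sum.delta)
  finally have "scale c x + y = (\<Sum>j\<in>insert j0 J. w' j)" using J(3) by (simp add: add.commute)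
  moreover have "w' j \<in> span (S j)" for j
    using J(2) j0 by (auto simp: w'_def intro: span_add span_zero span_scale span_base)
  ultimately show ?case using J(1) by (intro exI[of _ "insert j0 J"] exI[of _ w']) simp
qed

text \<open>Applying H minus the eigenvalue of j0 removes the j0 term and rescales the others by
  nonzero factors, which leaves a shorter relation.\<close>

lemma (in complex_space) sum_of_eigenvectors_eq_0:
  assumes "Vector_Spaces.linear scale scale H" "finite J" "inj_on r J"
    and "\<And>j. j \<in> J \<Longrightarrow> H (w j) = scale (r j) (w j)" "(\<Sum>j\<in>J. w j) = 0" "j \<in> J"
  shows "w j = 0"
  using assms(2-)
proof (induction J arbitrary: w j rule: finite_induct)
  case empty
  then show ?case by simp
next
  case (insert j0 J)
  interpret H: Vector_Spaces.linear scale scale H by fact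
  have "w i = 0" if i: "i \<in> J" for i
  proof -
    have "0 = H (\<Sum>j\<in>insert j0 J. w j) - scale (r j0) (\<Sum>j\<in>insert j0 J. w j)"
      using insert.prems(3) H.zero by simp
    also have "\<dots> = (\<Sum>j\<in>insert j0 J. scale (r j - r j0) (w j))"
      using insert.prems(2) by (simp add: H.sum scale_sum_right scale_left_diff_distrib sum_subtractf)
    also have "\<dots> = (\<Sum>j\<in>J. scale (r j - r j0) (w j))" using insert.hyps by simp
    finally have "(\<Sum>j\<in>J. scale (r j - r j0) (w j)) = 0" by simp
    moreover have "H (scale (r j - r j0) (w j)) = scale (r j) (scale (r j - r j0) (w j))" if "j \<in> J" for j
      using insert.prems(2)[of j] that by (simp add: H.scale mult_ac)
    ultimately have "scale (r i - r j0) (w i) = 0"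
      using insert.IH[of "\<lambda>j. scale (r j - r j0) (w j)" i] insert.prems(1) i by (auto simp: inj_on_def)
    moreover have "r i \<noteq> r j0" using insert.prems(1) insert.hyps i by (auto simp: inj_on_def)
    ultimately show ?thesis by simp
  qed
  moreover from this have "w j0 = 0" using insert.prems(3) insert.hyps by simp
  ultimately show ?case using insert.prems(4) by auto
qed

text \<open>The factors 2 in the bracket relations are written as repeated sums, so that identities
  such as \<open>casimir_commute\<close> are settled in the abelian group without scalars.\<close>

locale sl2_action = complex_space scale
  for scale :: "complex \<Rightarrow> 'b::ab_group_add \<Rightarrow> 'b" +
  fixes X Y H :: "'b \<Rightarrow> 'b"
  assumes linear_X: "Vector_Spaces.linear scale scale X"
    and linear_Y: "Vector_Spaces.linear scale scale Y"
    and linear_H: "Vector_Spaces.linear scale scale H"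
    and H_X: "H (X w) = X (H w) + X w + X w"
    and H_Y: "H (Y w) = Y (H w) - Y w - Y w"
    and X_Y: "X (Y w) = Y (X w) + H w"
begin

sublocale X: Vector_Spaces.linear scale scale X by (rule linear_X)
sublocale Y: Vector_Spaces.linear scale scale Y by (rule linear_Y)
sublocale H: Vector_Spaces.linear scale scale H by (rule linear_H)

lemmas hom_simps =
  X.add Y.add H.add X.diff Y.diff H.diff X.neg Y.neg H.neg X.scale Y.scale H.scale
  X.zero Y.zero H.zero

definition casimir :: "'b \<Rightarrow> 'b" where
  "casimir w = H (H w) - (H w + H w) + (X (Y w) + X (Y w) + (X (Y w) + X (Y w)))"

lemma casimir_commute:
  "casimir (X w) = X (casimir w)" "casimir (Y w) = Y (casimir w)" "casimir (H w) = H (casimir w)"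
  by (simp_all add: casimir_def hom_simps H_X H_Y X_Y algebra_simps)

lemma casimir_linear: "casimir (u + w) = casimir u + casimir w" "casimir (scale c w) = scale c (casimir w)"
  by (simp_all add: casimir_def hom_simps algebra_simps)

lemma casimir_weight:
  assumes "H w = scale r w"
  shows "casimir w = scale ((r - 1)\<^sup>2 - 1) w + scale 4 (X (Y w))"
proof -
  have "scale 4 (X (Y w)) = X (Y w) + X (Y w) + (X (Y w) + X (Y w))"
    using scale_left_distrib[of 2 2 "X (Y w)"] scale_left_distrib[of 1 1 "X (Y w)"] by simp
  moreover have "H (H w) - (H w + H w) = scale ((r - 1)\<^sup>2 - 1) w"
    by (simp add: assms hom_simps power2_eq_square flip: scale_left_distrib scale_left_diff_distrib)
      (simp add: algebra_simps)
  ultimately show ?thesis by (simp add: casimir_def)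
qed

end

section \<open>The module generated by a weight vector\<close>

locale sl2_cyclic = sl2_action scale X Y H
  for scale :: "complex \<Rightarrow> 'b::ab_group_add \<Rightarrow> 'b" and X Y H +
  fixes k :: int and v :: 'b
  assumes H_v: "H v = scale (of_int k) v"
begin

text \<open>The Casimir element is shifted so that \<open>D\<close> acts as \<open>- X Y\<close> on weight \<open>k\<close>, that is, as the Laplacian
  on the lift of a form of weight \<open>k\<close>.\<close>

definition D :: "'b \<Rightarrow> 'b" where
  "D w = scale (1 / 4) (scale ((of_int k - 1)\<^sup>2 - 1) w - casimir w)"

lemma linear_D: "Vector_Spaces.linear scale scale D"
  by unfold_locales (simp_all add: D_def casimir_linear algebra_simps)

sublocale D: Vector_Spaces.linear scale scale D by (rule linear_D)

lemma D_commute: "D (X w) = X (D w)" "D (Y w) = Y (D w)" "D (H w) = H (D w)"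
  by (simp_all add: D_def casimir_commute hom_simps)

text \<open>The scalar part of X Y on weight k + 2 j: a quarter of the difference between the
  Casimir shifts at weights k and k + 2 j.\<close>

definition b :: "int \<Rightarrow> complex" where
  "b j = of_int (- (j * (k - 1 + j)))"

lemma b_eq_0_iff: "b j = 0 \<longleftrightarrow> j = 0 \<or> j = 1 - k"
  unfolding b_def of_int_eq_0_iff by auto

lemma b_weight: "(of_int k - 1)\<^sup>2 - (of_int (k + 2 * j) - 1)\<^sup>2 = 4 * b j"
  by (simp add: b_def power2_eq_square algebra_simps)

lemma X_Y_weight:
  assumes "H w = scale (of_int (k + 2 * j)) w"
  shows "X (Y w) = scale (b j) w - D w"
proof -
  have "scale 4 (D w) = scale ((of_int k - 1)\<^sup>2 - 1) w - casimir w" by (simp add: D_def)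
  also have "\<dots> = scale ((of_int k - 1)\<^sup>2 - (of_int (k + 2 * j) - 1)\<^sup>2) w - scale 4 (X (Y w))"
    unfolding casimir_weight[OF assms] by (simp add: algebra_simps)
  also have "\<dots> = scale 4 (scale (b j) w - X (Y w))"
    unfolding b_weight by (simp add: scale_right_diff_distrib)
  finally have "D w = scale (b j) w - X (Y w)" by (simp only: scale_cancel_left) simp
  then show ?thesis by simp
qed

text \<open>The constant belongs to the edge between j and j + 1, not to a vertex: going up and back
  from j meets the same scalar as going down and back from j + 1.\<close>

lemma Y_X_weight:
  assumes "H w = scale (of_int (k + 2 * j)) w"
  shows "Y (X w) = scale (b (j + 1)) w - D w"
proof -
  have "Y (X w) = X (Y w) - H w" by (simp add: X_Y)
  also have "\<dots> = scale (b j - of_int (k + 2 * j)) w - D w"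
    unfolding X_Y_weight[OF assms] assms by (simp only: scale_left_diff_distrib) simp
  also have "b j - of_int (k + 2 * j) = b (j + 1)" by (simp add: b_def algebra_simps)
  finally show ?thesis .
qed

text \<open>The index j counts steps away from v and i counts powers of D. A step away from j = 0
  shifts j; a step back towards it costs the factor b - D.\<close>

definition e :: "int \<Rightarrow> nat \<Rightarrow> 'b" where
  "e j i = (if j \<ge> 0 then (X ^^ nat j) ((D ^^ i) v) else (Y ^^ nat (- j)) ((D ^^ i) v))"

lemma e_0_0: "e 0 0 = v" and e_0: "e 0 i = (D ^^ i) v"
  by (simp_all add: e_def)

lemma X_e: "j \<ge> 0 \<Longrightarrow> X (e j i) = e (j + 1) i"
  by (simp add: e_def nat_add_distrib)

lemma Y_e:
  assumes "j \<le> 0" shows "Y (e j i) = e (j - 1) i"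
proof -
  have "nat (1 - j) = Suc (nat (- j))" using assms by simp
  then show ?thesis using assms by (cases "j = 0") (simp_all add: e_def)
qed

lemma e_induct [case_names zero up down]:
  assumes "P 0" "\<And>j. j \<ge> 0 \<Longrightarrow> P j \<Longrightarrow> P (j + 1)" "\<And>j. j \<le> 0 \<Longrightarrow> P j \<Longrightarrow> P (j - 1)"
  shows "P (j::int)"
  using assms by (induction j rule: int_induct[where k = 0]) auto

lemma D_e: "D (e j i) = e j (Suc i)"
proof (induction j rule: e_induct)
  case (up j)
  then show ?case by (simp add: D_commute flip: X_e)
next
  case (down j)
  then show ?case by (simp add: D_commute flip: Y_e)
qed (simp add: e_def)

lemma D_power_e: "(D ^^ n) (e j i) = e j (n + i)"
  by (induction n) (simp_all add: D_e)

lemma H_e: "H (e j i) = scale (of_int (k + 2 * j)) (e j i)"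
proof (induction j rule: e_induct)
  case zero
  show ?case by (induction i) (simp_all add: e_0 H_v D.scale flip: D_commute)
next
  case (up j)
  have "H (e (j + 1) i) = X (H (e j i)) + X (e j i) + X (e j i)" using H_X by (simp add: up.hyps flip: X_e)
  also have "\<dots> = scale (of_int (k + 2 * j) + 1 + 1) (X (e j i))"
    unfolding up.IH by (simp only: scale_left_distrib X.scale scale_one)
  finally show ?case using up.hyps by (simp add: X_e)
next
  case (down j)
  have "H (e (j - 1) i) = Y (H (e j i)) - Y (e j i) - Y (e j i)" using H_Y by (simp add: down.hyps flip: Y_e)
  also have "\<dots> = scale (of_int (k + 2 * j) - 1 - 1) (Y (e j i))"
    unfolding down.IH by (simp only: scale_left_diff_distrib Y.scale scale_one)
  finally show ?case using down.hyps by (simp add: Y_e)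
qed

lemma X_e_neg: "j < 0 \<Longrightarrow> X (e j i) = scale (b (j + 1)) (e (j + 1) i) - e (j + 1) (Suc i)"
  using X_Y_weight[OF H_e, of "j + 1" i] Y_e[of "j + 1" i] by (simp add: D_e)

lemma Y_e_pos: "j > 0 \<Longrightarrow> Y (e j i) = scale (b j) (e (j - 1) i) - e (j - 1) (Suc i)"
  using Y_X_weight[OF H_e, of "j - 1" i] X_e[of "j - 1" i] by (simp add: D_e)

definition E :: "int \<Rightarrow> 'b set" where
  "E j = span (range (e j))"

definition M :: "'b set" where
  "M = span (\<Union>j. range (e j))"

lemma e_in_E [simp]: "e j i \<in> E j" and e_in_M [simp]: "e j i \<in> M"
  by (auto simp: E_def M_def intro: span_base)

lemma subspace_E [simp]: "subspace (E j)" and subspace_M [simp]: "subspace M"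
  by (simp_all add: E_def M_def)

lemma E_subset_M: "E j \<subseteq> M"
  unfolding E_def M_def by (rule span_mono) auto

lemma M_induct [consumes 1, case_names base scale add zero]:
  assumes "w \<in> M" "\<And>j i. P (e j i)" "\<And>c w. w \<in> M \<Longrightarrow> P w \<Longrightarrow> P (scale c w)"
    "\<And>u w. u \<in> M \<Longrightarrow> w \<in> M \<Longrightarrow> P u \<Longrightarrow> P w \<Longrightarrow> P (u + w)" "P 0"
  shows "P w"
proof -
  have "w \<in> M \<and> P w"
    using assms(1) unfolding M_def
  proof (induction rule: span_induct_alt)
    case base
    show ?case using assms(5) by (simp add: span_zero)
  next
    case (step c x y)
    have "x \<in> M" "P x" using step(1) assms(2) by auto
    then have "scale c x \<in> M" "P (scale c x)" using assms(3) subspace_M by (auto intro: subspace_scale)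
    then show ?case using step assms(4) unfolding M_def[symmetric] by (auto intro: subspace_add)
  qed
  then show ?thesis ..
qed

lemma linear_image_span_subset:
  assumes "Vector_Spaces.linear scale scale T" "\<And>x. x \<in> S \<Longrightarrow> T x \<in> U" "subspace U" "w \<in> span S"
  shows "T w \<in> U"
proof -
  interpret T: Vector_Spaces.linear scale scale T by fact
  have "span S \<subseteq> {x. T x \<in> U}"
    using assms(2,3) by (intro span_minimal T.subspace_linear_preimage) auto
  then show ?thesis using assms(4) by blast
qed

lemma linear_image_E:
  assumes "Vector_Spaces.linear scale scale T" "\<And>i. T (e j i) \<in> U" "subspace U" "w \<in> E j"
  shows "T w \<in> U"
proof (rule linear_image_span_subset[OF assms(1) _ assms(3)])
  show "w \<in> span (range (e j))" using assms(4) by (simp add: E_def)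
qed (use assms(2) in auto)

lemma linear_image_M:
  assumes "Vector_Spaces.linear scale scale T" "\<And>j i. T (e j i) \<in> U" "subspace U" "w \<in> M"
  shows "T w \<in> U"
proof (rule linear_image_span_subset[OF assms(1) _ assms(3)])
  show "w \<in> span (\<Union>j. range (e j))" using assms(4) by (simp add: M_def)
qed (use assms(2) in auto)

lemma X_e_in_E: "X (e j i) \<in> E (j + 1)"
  by (cases "j \<ge> 0") (auto simp: X_e X_e_neg intro!: subspace_diff subspace_scale)

lemma Y_e_in_E: "Y (e j i) \<in> E (j - 1)"
  by (cases "j \<le> 0") (auto simp: Y_e Y_e_pos intro!: subspace_diff subspace_scale)

lemma X_E: "w \<in> E j \<Longrightarrow> X w \<in> E (j + 1)"
  by (rule linear_image_E[OF linear_X X_e_in_E]) simp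

lemma Y_E: "w \<in> E j \<Longrightarrow> Y w \<in> E (j - 1)"
  by (rule linear_image_E[OF linear_Y Y_e_in_E]) simp

lemma D_E: "w \<in> E j \<Longrightarrow> D w \<in> E j"
  by (rule linear_image_E[OF linear_D]) (simp_all add: D_e)

lemma H_E: "w \<in> E j \<Longrightarrow> H w = scale (of_int (k + 2 * j)) w"
proof -
  assume "w \<in> E j"
  moreover have "E j \<subseteq> {w. H w = scale (of_int (k + 2 * j)) w}"
    unfolding E_def
    by (rule span_minimal) (auto simp: H_e intro!: subspaceI simp: hom_simps algebra_simps)
  ultimately show ?thesis by blast
qed

lemma M_closed: "w \<in> M \<Longrightarrow> X w \<in> M" "w \<in> M \<Longrightarrow> Y w \<in> M" "w \<in> M \<Longrightarrow> H w \<in> M"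
proof -
  show "w \<in> M \<Longrightarrow> X w \<in> M"
    by (rule linear_image_M[OF linear_X subsetD[OF E_subset_M X_e_in_E] subspace_M])
  show "w \<in> M \<Longrightarrow> Y w \<in> M"
    by (rule linear_image_M[OF linear_Y subsetD[OF E_subset_M Y_e_in_E] subspace_M])
  show "w \<in> M \<Longrightarrow> H w \<in> M"
    by (rule linear_image_M[OF linear_H]) (simp_all only: H_e e_in_M subspace_M subspace_scale)
qed

text \<open>D is a polynomial in X, Y and H, so a subspace stable under these three also contains
  the powers of D on v, and then every \<open>e j i\<close>. This identifies M with the generated
  submodule later.\<close>

lemma M_minimal:
  assumes "subspace U" "v \<in> U" "\<And>w. w \<in> U \<Longrightarrow> X w \<in> U \<and> Y w \<in> U \<and> H w \<in> U"
  shows "M \<subseteq> U"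
proof -
  have D: "D w \<in> U" if "w \<in> U" for w
    using assms(1,3) that unfolding D_def casimir_def
    by (intro subspace_scale subspace_diff subspace_add) auto
  have "e j i \<in> U" for j i
  proof (induction j rule: e_induct)
    case zero
    show ?case by (induction i) (use assms(2) D in \<open>auto simp: e_0\<close>)
  next
    case (up j)
    then show ?case using assms(3)[of "e j i"] X_e[of j i] by simp
  next
    case (down j)
    then show ?case using assms(3)[of "e j i"] Y_e[of j i] by simp
  qed
  then show ?thesis unfolding M_def using assms(1) by (intro span_minimal) auto
qed

lemma weight_space_M: "{w \<in> M. H w = scale (of_int (k + 2 * j)) w} = E j"
proof (intro equalityI subsetI)
  fix w assume "w \<in> E j"
  then show "w \<in> {w \<in> M. H w = scale (of_int (k + 2 * j)) w}" using E_subset_M H_E by auto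
next
  fix w assume "w \<in> {w \<in> M. H w = scale (of_int (k + 2 * j)) w}"
  then have w: "w \<in> span (\<Union>j. range (e j))" "H w = scale (of_int (k + 2 * j)) w" by (auto simp: M_def)
  obtain J u where u: "finite J" "\<And>j. u j \<in> E j" "w = (\<Sum>j\<in>J. u j)"
    using finite_decomposition[OF w(1)] unfolding E_def by blast
  \<comment> \<open>The difference of eigenvalues vanishes only at i = j; subtracting the eigenvalue
    of w leaves a vanishing sum of weight vectors from the other weights.\<close>
  define r where "r i = (of_int (k + 2 * i) - of_int (k + 2 * j) :: complex)" for i
  have "0 = H w - scale (of_int (k + 2 * j)) w" using w(2) by simp
  also have "\<dots> = (\<Sum>i\<in>J. scale (r i) (u i))"
    unfolding u(3) r_def
    by (simp only: H.sum scale_sum_right H_E[OF u(2)] scale_left_diff_distrib sum_subtractf)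
  finally have "(\<Sum>i\<in>J. scale (r i) (u i)) = 0" by simp
  then have "scale (r i) (u i) = 0" if "i \<in> J" for i
    using sum_of_eigenvectors_eq_0[OF linear_H u(1), of "\<lambda>i. of_int (k + 2 * i)" "\<lambda>i. scale (r i) (u i)" i] that
    by (simp add: inj_on_def hom_simps H_E[OF u(2)] mult_ac del: of_int_add of_int_mult)
  then have "u i = 0" if "i \<in> J" "i \<noteq> j" for i
    using that by (auto simp: r_def)
  then have "w = (\<Sum>i\<in>J. if i = j then u j else 0)"
    unfolding u(3) by (intro sum.cong) auto
  also have "\<dots> \<in> E j" using u(1,2) by (auto simp: sum.delta subspace_0)
  finally show "w \<in> E j" .
qed

end

text \<open>Working with an indexed family gives injectivity as well: a coincidence of two members
  would be a relation with coefficients 1 and -1.\<close>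

lemma (in complex_space) independent_family:
  assumes "\<And>F c p. finite F \<Longrightarrow> F \<subseteq> I \<Longrightarrow> (\<Sum>p\<in>F. scale (c p) (f p)) = 0 \<Longrightarrow> p \<in> F \<Longrightarrow> c p = 0"
  shows "inj_on f I" "independent (f ` I)"
proof -
  show inj: "inj_on f I"
  proof (rule inj_onI, rule ccontr)
    fix p q assume pq: "p \<in> I" "q \<in> I" "f p = f q" "p \<noteq> q"
    have "(\<Sum>x\<in>{p, q}. scale (if x = p then 1 else - 1) (f x)) = 0" using pq by simp
    from assms[OF _ _ this, of p] pq show False by simp
  qed
  show "independent (f ` I)"
    unfolding independent_explicit_finite_subsets
  proof (intro allI impI ballI)
    fix S u v assume S: "S \<subseteq> f ` I" "finite S" "(\<Sum>v\<in>S. scale (u v) v) = 0" "v \<in> S"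
    obtain F where F: "F \<subseteq> I" "inj_on f F" "S = f ` F" using S(1) by (auto simp: subset_image_inj)
    have "finite F" using S(2) F finite_image_iff by blast
    moreover have "(\<Sum>p\<in>F. scale (u (f p)) (f p)) = 0" using S(3) F by (simp add: sum.reindex)
    moreover obtain p where "p \<in> F" "v = f p" using S(4) F by auto
    ultimately show "u v = 0" using assms[OF _ F(1), of "\<lambda>p. u (f p)"] by blast
  qed
qed

section \<open>Sizes of the Jordan blocks of \<open>D\<close>\<close>

locale sl2_cyclic_nilpotent = sl2_cyclic scale X Y H k v
  for scale :: "complex \<Rightarrow> 'b::ab_group_add \<Rightarrow> 'b" and X Y H and k :: int and v :: 'b +
  fixes d :: nat
  assumes D_power_v: "(D ^^ Suc d) v = 0" and D_power_v_nonzero: "(D ^^ d) v \<noteq> 0"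
begin

lemma e_vanish_mono: "e j i = 0 \<Longrightarrow> i \<le> i' \<Longrightarrow> e j i' = 0"
proof -
  have "(D ^^ n) 0 = 0" for n by (induction n) (simp_all add: D.zero)
  then show "e j i = 0 \<Longrightarrow> i \<le> i' \<Longrightarrow> e j i' = 0"
    using D_power_e[of "i' - i" j i] by simp
qed

lemma e_vanish_step:
  "j \<ge> 0 \<Longrightarrow> e j i = 0 \<Longrightarrow> e (j + 1) i = 0" "j \<le> 0 \<Longrightarrow> e j i = 0 \<Longrightarrow> e (j - 1) i = 0"
  by (simp_all add: X.zero Y.zero flip: X_e Y_e)

lemma e_large: "e j (Suc d) = 0"
proof (induction j rule: e_induct)
  case zero
  show ?case using D_power_v by (simp only: e_0)
qed (simp_all add: e_vanish_step)

text \<open>The vectors \<open>e j 0\<close>, \<open>e j 1\<close>, ... form one chain under D, so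
  this is the size of the single Jordan block on E j; \<open>dim_E\<close> shows that it is the
  dimension.\<close>

definition m :: "int \<Rightarrow> nat" where
  "m j = (LEAST i. e j i = 0)"

lemma e_eq_0_iff: "e j i = 0 \<longleftrightarrow> m j \<le> i"
proof
  assume "e j i = 0" then show "m j \<le> i" unfolding m_def by (rule Least_le)
next
  assume "m j \<le> i"
  moreover have "e j (m j) = 0" unfolding m_def using e_large by (rule LeastI)
  ultimately show "e j i = 0" using e_vanish_mono by blast
qed

lemma m_le: "m j \<le> Suc d"
  using e_large e_eq_0_iff by blast

lemma m_0: "m 0 = Suc d"
  using D_power_v_nonzero e_eq_0_iff[of 0 d] m_le[of 0] by (simp add: e_0)

lemma m_eqI: "(\<And>i. e j i = 0 \<longleftrightarrow> e j' i = 0) \<Longrightarrow> m j = m j'"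
  by (simp add: m_def)

lemma D_power_linear: "Vector_Spaces.linear scale scale (D ^^ n)"
proof (induction n)
  case 0
  show ?case by unfold_locales simp_all
next
  case (Suc n)
  interpret n: Vector_Spaces.linear scale scale "D ^^ n" by (rule Suc)
  show ?case by unfold_locales (simp_all add: n.add n.scale D.add D.scale)
qed

lemma D_nilpotent: "w \<in> M \<Longrightarrow> (D ^^ Suc d) w = 0"
proof -
  assume w: "w \<in> M"
  have "(D ^^ Suc d) w \<in> {0}"
  proof (rule linear_image_M[OF D_power_linear _ _ w])
    show "(D ^^ Suc d) (e j i) \<in> {0}" for j i
      unfolding D_power_e using e_vanish_mono[OF e_large, of "Suc d + i" j] by simp
  qed simp
  then show ?thesis by simp
qed

text \<open>Iteration gives that a power of c kills w. It is the form in which the injectivity of b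
  - D at a nonzero b is used.\<close>

lemma eigen_nilpotent:
  assumes "w \<in> M" "scale c w = D w" "c \<noteq> 0" shows "w = 0"
proof -
  have "(D ^^ n) w = scale (c ^ n) w" for n
    by (induction n) (simp_all add: D.scale mult_ac flip: assms(2))
  then show ?thesis using D_nilpotent[OF assms(1)] assms(3) by (simp del: funpow.simps)
qed

text \<open>Going back down by Y turns \<open>e (j + 1) i = 0\<close> into b times
  \<open>e j i\<close> equals D of \<open>e j i\<close>. For b nonzero this forces
  \<open>e j i = 0\<close>; for b = 0 it says only that the next chain vector
  \<open>e j (Suc i)\<close> is zero.\<close>

lemma m_up:
  assumes "j \<ge> 0"
  shows "m (j + 1) \<le> m j" "b (j + 1) \<noteq> 0 \<Longrightarrow> m (j + 1) = m j" "b (j + 1) = 0 \<Longrightarrow> m j \<le> Suc (m (j + 1))"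
proof -
  have Y: "scale (b (j + 1)) (e j i) = e j (Suc i)" if "e (j + 1) i = 0" for i
    using Y_e_pos[of "j + 1" i] assms that by (simp add: Y.zero)
  show "m (j + 1) \<le> m j" using e_vanish_step(1)[OF assms] e_eq_0_iff by blast
  show "m (j + 1) = m j" if "b (j + 1) \<noteq> 0"
    using Y eigen_nilpotent[of "e j _", OF _ _ that] e_vanish_step(1)[OF assms]
    by (intro m_eqI) (metis D_e e_in_M)
  show "m j \<le> Suc (m (j + 1))" if "b (j + 1) = 0"
    using Y[of "m (j + 1)"] that e_eq_0_iff[of "j + 1" "m (j + 1)"] e_eq_0_iff[of j "Suc (m (j + 1))"] by simp
qed

text \<open>The mirror image of \<open>m_up\<close>; the constant is b j since the edge between j -
  1 and j carries its upper index.\<close>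

lemma m_down:
  assumes "j \<le> 0"
  shows "m (j - 1) \<le> m j" "b j \<noteq> 0 \<Longrightarrow> m (j - 1) = m j" "b j = 0 \<Longrightarrow> m j \<le> Suc (m (j - 1))"
proof -
  have X: "scale (b j) (e j i) = e j (Suc i)" if "e (j - 1) i = 0" for i
    using X_e_neg[of "j - 1" i] assms that by (simp add: X.zero)
  show "m (j - 1) \<le> m j" using e_vanish_step(2)[OF assms] e_eq_0_iff by blast
  show "m (j - 1) = m j" if "b j \<noteq> 0"
    using X eigen_nilpotent[of "e j _", OF _ _ that] e_vanish_step(2)[OF assms]
    by (intro m_eqI) (metis D_e e_in_M)
  show "m j \<le> Suc (m (j - 1))" if "b j = 0"
    using X[of "m (j - 1)"] that e_eq_0_iff[of "j - 1" "m (j - 1)"] e_eq_0_iff[of j "Suc (m (j - 1))"] by simp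
qed

lemma X_bij:
  assumes "b (j + 1) \<noteq> 0"
  shows "bij_betw X (E j) (E (j + 1))"
proof -
  have "inj_on X (E j)"
  proof (rule inj_onI)
    fix u w assume uw: "u \<in> E j" "w \<in> E j" "X u = X w"
    have E: "u - w \<in> E j" using uw by (simp add: subspace_diff)
    have "Y (X (u - w)) = 0" using uw by (simp add: X.diff Y.zero)
    then have "scale (b (j + 1)) (u - w) = D (u - w)"
      unfolding Y_X_weight[OF H_E[OF E]] by simp
    then have "u - w = 0" using eigen_nilpotent assms E E_subset_M by blast
    then show "u = w" by simp
  qed
  moreover have "u \<in> X ` E j" if "u \<in> E (j + 1)" for u
  proof -
    have sub: "subspace (X ` E j)" by (rule X.subspace_image) simp
    \<comment> \<open>Surjectivity by inverting b - D step by step: b u = X (Y u) + D u, and D u is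
      killed by a smaller power of D.\<close>
    have "u \<in> E (j + 1) \<Longrightarrow> (D ^^ n) u = 0 \<Longrightarrow> u \<in> X ` E j" for n
    proof (induction n arbitrary: u)
      case 0
      then show ?case using sub subspace_0 by auto
    next
      case (Suc n)
      have "D u \<in> X ` E j" using Suc.IH[of "D u"] Suc.prems D_E by (simp add: funpow_swap1)
      moreover have "X (Y u) \<in> X ` E j" using Y_E[OF Suc.prems(1)] by simp
      moreover have "scale (b (j + 1)) u = X (Y u) + D u"
        using X_Y_weight[OF H_E[OF Suc.prems(1)]] by simp
      ultimately have "scale (inverse (b (j + 1))) (scale (b (j + 1)) u) \<in> X ` E j"
        using sub by (metis subspace_add subspace_scale)
      then show ?case using assms by simp
    qed
    then show ?thesis using D_nilpotent that E_subset_M by blast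
  qed
  ultimately show ?thesis using X_E by (auto simp: bij_betw_def)
qed

lemma chain_independent:
  assumes "(\<Sum>i<m j. scale (c i) (e j i)) = 0" "i < m j"
  shows "c i = 0"
proof (rule ccontr)
  assume "c i \<noteq> 0"
  define i0 where "i0 = (LEAST i. c i \<noteq> 0)"
  have i0: "c i0 \<noteq> 0" unfolding i0_def using \<open>c i \<noteq> 0\<close> by (rule LeastI)
  have less: "c i' = 0" if "i' < i0" for i' using not_less_Least that unfolding i0_def by blast
  have "i0 < m j" using Least_le[of "\<lambda>i. c i \<noteq> 0", OF \<open>c i \<noteq> 0\<close>] assms(2) by (simp add: i0_def)
  \<comment> \<open>This power of D moves the lowest term with nonzero coefficient to the last
    nonzero vector of the chain and all later terms beyond its end.\<close>
  define n where "n = m j - 1 - i0"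
  interpret Dn: Vector_Spaces.linear scale scale "D ^^ n" by (rule D_power_linear)
  have "0 = (D ^^ n) (\<Sum>i<m j. scale (c i) (e j i))" using assms(1) Dn.zero by simp
  also have "\<dots> = (\<Sum>i<m j. scale (c i) (e j (n + i)))" by (simp add: Dn.sum Dn.scale D_power_e)
  also have "\<dots> = (\<Sum>i<m j. if i = i0 then scale (c i0) (e j (m j - 1)) else 0)"
  proof (intro sum.cong refl)
    fix i
    show "scale (c i) (e j (n + i)) = (if i = i0 then scale (c i0) (e j (m j - 1)) else 0)"
      using less[of i] e_eq_0_iff[of j "n + i"] \<open>i0 < m j\<close> by (auto simp: n_def)
  qed
  also have "\<dots> = scale (c i0) (e j (m j - 1))" using \<open>i0 < m j\<close> by (simp add: sum.delta)
  finally have "e j (m j - 1) = 0" using i0 by simp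
  then show False using \<open>i0 < m j\<close> e_eq_0_iff[of j "m j - 1"] by simp
qed

definition index :: "(int \<times> nat) set" where
  "index = {(j, i). i < m j}"

lemma e_independent:
  "inj_on (\<lambda>(j, i). e j i) index" "independent ((\<lambda>(j, i). e j i) ` index)"
proof -
  have "c p = 0"
    if F: "finite F" "F \<subseteq> index" "(\<Sum>p\<in>F. scale (c p) (case p of (j, i) \<Rightarrow> e j i)) = 0" "p \<in> F" for F c p
  proof -
    \<comment> \<open>The coefficients are extended by zero to complete chains, so that the sum over
      F can be regrouped by weight; H separates the weights and \<open>chain_independent\<close>
      treats each chain.\<close>
    define c' where "c' j i = (if (j, i) \<in> F then c (j, i) else 0)" for j i
    define w where "w j = (\<Sum>i<m j. scale (c' j i) (e j i))" for j
    define J where "J = fst ` F"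
    have J: "finite J" using F(1) by (simp add: J_def)
    have "0 = (\<Sum>p\<in>F. scale (c p) (case p of (j, i) \<Rightarrow> e j i))" using F(3) by simp
    also have "\<dots> = (\<Sum>p\<in>Sigma J (\<lambda>j. {..<m j}). case p of (j, i) \<Rightarrow> scale (c' j i) (e j i))"
      by (rule sum.mono_neutral_cong_left)
        (use F(2) J in \<open>force simp: J_def index_def c'_def\<close>)+
    also have "\<dots> = (\<Sum>j\<in>J. w j)" unfolding w_def using J by (subst sum.Sigma) auto
    finally have "(\<Sum>j\<in>J. w j) = 0" by simp
    moreover have "w j \<in> E j" for j
      unfolding w_def by (intro subspace_sum subspace_E subspace_scale e_in_E)
    ultimately have "w j = 0" if "j \<in> J" for j
      using sum_of_eigenvectors_eq_0[OF linear_H J, of "\<lambda>j. of_int (k + 2 * j)" w j] that H_E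
      by (auto simp: inj_on_def)
    then have "c' (fst p) (snd p) = 0"
      using chain_independent[of "c' (fst p)" "fst p" "snd p"] F(2,4)
      by (auto simp: w_def J_def index_def)
    then show "c p = 0" using F(4) by (simp add: c'_def)
  qed
  note zero = this
  show "inj_on (\<lambda>(j, i). e j i) index" by (rule independent_family(1)) (fact zero)
  show "independent ((\<lambda>(j, i). e j i) ` index)" by (rule independent_family(2)) (fact zero)
qed

lemma E_eq_span: "E j = span (e j ` {..<m j})"
proof
  have "e j i \<in> span (e j ` {..<m j})" for i
    using e_eq_0_iff[of j i] by (cases "i < m j") (auto intro: span_base span_zero)
  then show "E j \<subseteq> span (e j ` {..<m j})" unfolding E_def by (intro span_minimal) auto
next
  show "span (e j ` {..<m j}) \<subseteq> E j" unfolding E_def by (rule span_mono) auto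
qed

lemma dim_E: "dim (E j) = m j"
proof -
  have eq: "e j ` {..<m j} = (\<lambda>(j, i). e j i) ` ({j} \<times> {..<m j})" by auto
  have sub: "{j} \<times> {..<m j} \<subseteq> index" by (auto simp: index_def)
  have "independent (e j ` {..<m j})"
    unfolding eq by (rule independent_mono[OF e_independent(2) image_mono[OF sub]])
  then have "dim (E j) = card (e j ` {..<m j})"
    unfolding E_eq_span by (rule dim_span_eq_card_independent)
  also have "\<dots> = m j"
    unfolding eq using card_image[OF inj_on_subset[OF e_independent(1) sub]] by simp
  finally show ?thesis .
qed

end

subsection \<open>Quiver representations\<close>

context complex_space
begin

lemma linear_between_linear:
  assumes "Vector_Spaces.linear scale scale T" "\<And>u. u \<in> U \<Longrightarrow> T u \<in> W"
  shows "linear_between U W T"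
proof -
  interpret T: Vector_Spaces.linear scale scale T by fact
  show ?thesis using assms(2) by (simp add: linear_between_def T.add T.scale)
qed

lemma linear_between_cong:
  assumes "linear_between U W T" "subspace U" "\<And>u. u \<in> U \<Longrightarrow> T' u = T u"
  shows "linear_between U W T'"
  using assms unfolding linear_between_def by (simp add: subspace_add subspace_scale)

lemma linear_between_compose:
  "linear_between U W T \<Longrightarrow> linear_between W Z T' \<Longrightarrow> linear_between U Z (T' \<circ> T)"
  unfolding linear_between_def by simp

lemma linear_between_inv_into:
  assumes "linear_between U W T" "bij_betw T U W" "subspace U"
  shows "linear_between W U (inv_into U T)"
proof -
  have inv: "inv_into U T (T u) = u" if "u \<in> U" for u
    using bij_betw_inv_into_left[OF assms(2) that] .
  have "inv_into U T (T u + T w) = u + w" if "u \<in> U" "w \<in> U" for u w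
    using inv[of "u + w"] that assms(1,3) by (simp add: linear_between_def subspace_add)
  moreover have "inv_into U T (scale c (T u)) = scale c u" if "u \<in> U" for c u
    using inv[of "scale c u"] that assms(1,3) by (simp add: linear_between_def subspace_scale)
  moreover have "W = T ` U" using assms(2) by (simp add: bij_betw_def)
  ultimately show ?thesis by (auto simp: linear_between_def inv)
qed

lemma linear_between_0: "linear_between U W T \<Longrightarrow> subspace U \<Longrightarrow> T 0 = 0"
  unfolding linear_between_def by (metis scale_zero_left subspace_0)

text \<open>Both quivers have a vertex \<open>h\<close> that every path visits at least every other step, and a detour from \<open>h\<close>
  back to \<open>h\<close> always acts as the same nilpotent map \<open>T\<close>.\<close>

lemma nilpotent_quiver_maps_hub:
  assumes lin: "\<And>e. linear_between (V (src e)) (V (tgt e)) (F e)"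
    and sub: "\<And>i. subspace (V i)"
    and out: "\<And>a b w. src a = h \<Longrightarrow> tgt a = src b \<Longrightarrow> w \<in> V h \<Longrightarrow> tgt b = h \<and> F b (F a w) = T w"
    and inn: "\<And>a. src a \<noteq> h \<Longrightarrow> tgt a = h"
    and nil: "\<And>w. w \<in> V h \<Longrightarrow> (T ^^ N) w = 0"
  shows "nilpotent_quiver_maps src tgt V F"
proof -
  have zero: "fold F p 0 = 0" for p
    by (induction p) (simp_all add: linear_between_0[OF lin sub])
  have hub: "fold F p w = 0"
    if "w \<in> V h" "(T ^^ n) w = 0" "2 * n \<le> length p" "successively (\<lambda>a b. tgt a = src b) p"
      "p = [] \<or> src (hd p) = h" for n p w
    using that
  proof (induction n arbitrary: p w)
    case 0
    then show ?case by (simp add: zero)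
  next
    case (Suc n)
    then obtain a b q where p: "p = a # b # q"
      by (metis Suc_le_length_iff mult_2 add_Suc_right add_Suc)
    have ab: "src a = h" "tgt a = src b" using Suc.prems by (auto simp: p)
    have Tw: "tgt b = h" "F b (F a w) = T w" using out[OF ab Suc.prems(1)] by auto
    have "T w \<in> V h"
      using lin[of a] lin[of b] Suc.prems(1) ab Tw by (metis linear_between_def)
    moreover have "(T ^^ n) (T w) = 0" using Suc.prems(2) by (simp add: funpow_swap1)
    moreover have "successively (\<lambda>a b. tgt a = src b) q" "q = [] \<or> src (hd q) = h"
      using Suc.prems(4) Tw(1) by (cases q; simp add: p)+
    ultimately have "fold F q (T w) = 0" using Suc.IH Suc.prems(3) by (simp add: p)
    then show ?case by (simp add: p Tw)
  qed
  show ?thesis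
    unfolding nilpotent_quiver_maps_def
  \<comment> \<open>N detours use two arrows each, and one more arrow may be needed to reach the hub
    first.\<close>
  proof (intro exI[of _ "2 * N + 1"] allI impI ballI)
    fix p w assume p: "p \<noteq> [] \<and> 2 * N + 1 \<le> length p \<and> successively (\<lambda>a b. tgt a = src b) p"
      and w: "w \<in> V (src (hd p))"
    show "fold F p w = 0"
    proof (cases "src (hd p) = h")
      case True
      then show ?thesis using hub[of w N p] nil w p by auto
    next
      case False
      obtain a q where q: "p = a # q" using p by (cases p) auto
      have a: "tgt a = h" using False inn q by simp
      have "F a w \<in> V h" using lin[of a] w q a by (auto simp: linear_between_def)
      moreover have "successively (\<lambda>a b. tgt a = src b) q" "q = [] \<or> src (hd q) = h"
        using p a by (cases q; simp add: q)+
      ultimately show ?thesis using hub[of "F a w" N q] nil p by (simp add: q)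
    qed
  qed
qed

lemma quiver_subrep_image:
  assumes "quiver_subrep src tgt V F W" "V (src e) \<subseteq> W (src e)" "F e ` V (src e) = V (tgt e)"
  shows "V (tgt e) \<subseteq> W (tgt e)"
proof -
  have "F e ` W (src e) \<subseteq> W (tgt e)" using assms(1) by (simp add: quiver_subrep_def)
  then show ?thesis using image_mono[OF assms(2), of "F e"] assms(3) by simp
qed

lemma quiver_subrep_eqI:
  assumes "quiver_subrep src tgt V F W" "\<And>i. V i \<subseteq> W i"
  shows "W = V"
proof
  show "W i = V i" for i using assms by (simp add: quiver_subrep_def subset_antisym)
qed

end

section \<open>How the weight spaces are reached from \<open>v\<close>\<close>

context sl2_cyclic_nilpotent
begin

lemma v_nonzero: "v \<noteq> 0"
proof
  assume "v = 0"
  moreover have "(D ^^ n) 0 = 0" for n by (induction n) (simp_all add: D.zero)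
  ultimately show False using D_power_v_nonzero by simp
qed

lemma finite_span_E: "\<exists>B. finite B \<and> span B = E j"
  using E_eq_span by (metis finite_imageI finite_lessThan)

lemma X_power_bij:
  assumes "\<And>i. j < i \<Longrightarrow> i \<le> j + int n \<Longrightarrow> b i \<noteq> 0"
  shows "bij_betw (X ^^ n) (E j) (E (j + int n))"
  using assms
proof (induction n)
  case 0
  then show ?case by (simp add: bij_betw_def)
next
  case (Suc n)
  then have "bij_betw (X ^^ n) (E j) (E (j + int n))" by simp
  moreover have "bij_betw X (E (j + int n)) (E (j + int n + 1))" using Suc.prems by (intro X_bij) simp
  ultimately have "bij_betw (X \<circ> X ^^ n) (E j) (E (j + int n + 1))" by (rule bij_betw_trans)
  then show ?case by (simp add: add_ac o_def)
qed

lemma X_power_E: "w \<in> E j \<Longrightarrow> (X ^^ n) w \<in> E (j + int n)"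
proof (induction n)
  case (Suc n)
  then show ?case using X_E[of "(X ^^ n) w" "j + int n"] by (simp add: add_ac)
qed simp

lemma X_power_linear: "Vector_Spaces.linear scale scale (X ^^ n)"
proof (induction n)
  case 0
  show ?case by unfold_locales simp_all
next
  case (Suc n)
  interpret n: Vector_Spaces.linear scale scale "X ^^ n" by (rule Suc)
  show ?case by unfold_locales (simp_all add: n.add n.scale X.add X.scale)
qed

text \<open>The closure condition is stated for - D since that is how round trips of arrows act; it
  suffices because E 0 is spanned by the powers of D applied to v.\<close>

lemma E_0_subset:
  assumes "subspace U" "v \<in> U" "\<And>w. w \<in> U \<Longrightarrow> w \<in> E 0 \<Longrightarrow> - D w \<in> U"
  shows "E 0 \<subseteq> U"
proof -
  have "(D ^^ i) v \<in> U \<and> (D ^^ i) v \<in> E 0" for i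
  proof (induction i)
    case 0
    show ?case using assms(2) e_in_E[of 0 0] by (simp add: e_0)
  next
    case (Suc i)
    then have "- (- D ((D ^^ i) v)) \<in> U" using subspace_neg[OF assms(1) assms(3)] by blast
    then show ?case using Suc D_E by simp
  qed
  then show ?thesis unfolding E_def using assms(1) by (intro span_minimal) (auto simp: e_0)
qed

lemma neg_D_nilpotent: "w \<in> M \<Longrightarrow> ((\<lambda>w. - D w) ^^ Suc d) w = 0"
proof -
  have "((\<lambda>w. - D w) ^^ n) w = scale ((- 1) ^ n) ((D ^^ n) w)" for n w
    by (induction n) (simp_all add: D.scale)
  then show "w \<in> M \<Longrightarrow> ((\<lambda>w. - D w) ^^ Suc d) w = 0" using D_nilpotent by (simp del: funpow.simps)
qed

text \<open>Pointing away from v, Y carries the spanning chain of one weight onto that of the next,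
  so it is onto even across an edge with b = 0. This and its analogue for X give cyclicity.\<close>

lemma Y_image_E:
  assumes "j \<le> 0" shows "Y ` E j = E (j - 1)"
proof -
  have "Y ` E j = span (Y ` range (e j))" unfolding E_def by (rule Y.span_image[symmetric])
  also have "Y ` range (e j) = range (e (j - 1))" using assms by (simp add: image_image Y_e)
  finally show ?thesis by (simp add: E_def)
qed

lemma X_power_image_E:
  assumes "j \<ge> 0" shows "(X ^^ n) ` E j = E (j + int n)"
proof -
  interpret Xn: Vector_Spaces.linear scale scale "X ^^ n" by (rule X_power_linear)
  have e: "(X ^^ n) (e j i) = e (j + int n) i" for i
    using assms by (induction n) (simp_all add: X_e add_ac)
  have "(X ^^ n) ` E j = span ((X ^^ n) ` range (e j))" unfolding E_def by (rule Xn.span_image[symmetric])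
  also have "(X ^^ n) ` range (e j) = range (e (j + int n))" by (simp add: image_image e)
  finally show ?thesis by (simp add: E_def)
qed

end

section \<open>The Gelfand quiver\<close>

text \<open>Weight \<open>k + 2s\<close> is the weight \<open>1 - l\<close> of the vertex \<open>\<ast>\<close>: \<open>s = 0\<close> if \<open>k < 1\<close> and \<open>s = - l\<close> if \<open>k > 1\<close>.\<close>

locale gelfand_data = sl2_cyclic_nilpotent scale X Y H k v d
  for scale :: "complex \<Rightarrow> 'b::ab_group_add \<Rightarrow> 'b" and X Y H and k :: int and v :: 'b and d :: nat +
  fixes s :: int and l :: nat and FX FY :: "'b \<Rightarrow> 'b"
    and V :: "gelfand_vertex \<Rightarrow> 'b set" and F :: "gelfand_arrow \<Rightarrow> 'b \<Rightarrow> 'b"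
  assumes l_pos: "l \<ge> 1" and b_ends: "b s = 0" "b (s + int l) = 0"
    and FX: "\<And>w. w \<in> M \<Longrightarrow> FX w = X w" and FY: "\<And>w. w \<in> M \<Longrightarrow> FY w = Y w"
    and V: "V Gel_minus = E (s - 1)" "V Gel_star = E s" "V Gel_plus = E (s + int l)"
    and F: "F Gel_a_minus = FX" "F Gel_b_minus = FY" "F Gel_b_plus = FX ^^ l"
      "F Gel_a_plus = inv_into (E s) (FX ^^ (l - 1)) \<circ> FY"
begin

text \<open>s and s + l are distinct because l is positive, so they exhaust the roots of b. This is
  what makes \<open>X ^^ (l - 1)\<close> an isomorphism.\<close>

lemma b_between: "s < i \<Longrightarrow> i \<le> s + int (l - 1) \<Longrightarrow> b i \<noteq> 0"
  using b_ends l_pos unfolding b_eq_0_iff by auto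

lemma FX_power: "w \<in> M \<Longrightarrow> (FX ^^ n) w = (X ^^ n) w \<and> (X ^^ n) w \<in> M"
  by (induction n) (simp_all add: FX M_closed)

definition G :: "'b \<Rightarrow> 'b" where
  "G = inv_into (E s) (X ^^ (l - 1))"

text \<open>\<open>FX\<close> and X agree only on M. That is enough, since \<open>inv_into\<close>
  depends only on the fibres inside E s.\<close>

lemma F_a_plus: "F Gel_a_plus = G \<circ> FY"
proof -
  have "(y \<in> E s \<and> (FX ^^ (l - 1)) y = x) = (y \<in> E s \<and> (X ^^ (l - 1)) y = x)" for x y
    using FX_power[of y "l - 1"] E_subset_M[of s] by auto
  then have "inv_into (E s) (FX ^^ (l - 1)) x = G x" for x
    unfolding G_def inv_into_def by simp
  then show ?thesis by (auto simp: F)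
qed

lemma X_star_bij: "bij_betw (X ^^ (l - 1)) (E s) (E (s + int (l - 1)))"
  by (rule X_power_bij) (rule b_between)

lemma X_star_linear: "linear_between (E s) (E (s + int (l - 1))) (X ^^ (l - 1))"
  by (rule linear_between_linear[OF X_power_linear X_power_E])

lemma G_bij: "bij_betw G (E (s + int (l - 1))) (E s)"
  unfolding G_def by (rule bij_betw_inv_into[OF X_star_bij])

lemma G_X: "w \<in> E s \<Longrightarrow> G ((X ^^ (l - 1)) w) = w"
  unfolding G_def by (rule bij_betw_inv_into_left[OF X_star_bij])

lemma X_G: "w \<in> E (s + int (l - 1)) \<Longrightarrow> (X ^^ (l - 1)) (G w) = w"
  unfolding G_def by (rule bij_betw_inv_into_right[OF X_star_bij])

lemma G_linear: "linear_between (E (s + int (l - 1))) (E s) G"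
  unfolding G_def by (rule linear_between_inv_into[OF X_star_linear X_star_bij]) simp

lemma Y_plus: "w \<in> E (s + int l) \<Longrightarrow> Y w \<in> E (s + int (l - 1))"
  using Y_E[of w "s + int l"] l_pos by (simp add: of_nat_diff algebra_simps)

lemma subspace_V: "subspace (V i)"
  by (cases i) (simp_all add: V)

lemma V_subset_M: "V i \<subseteq> M"
  by (cases i) (simp_all add: V E_subset_M)

lemma F_linear: "linear_between (V (gel_src a)) (V (gel_tgt a)) (F a)"
proof (cases a)
  case Gel_a_minus
  have "linear_between (E (s - 1)) (E s) X"
    using X_E[of _ "s - 1"] by (intro linear_between_linear[OF linear_X]) simp
  then have "linear_between (E (s - 1)) (E s) FX"
    by (rule linear_between_cong) (use FX E_subset_M[of "s - 1"] in auto)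
  then show ?thesis by (simp add: Gel_a_minus V F)
next
  case Gel_b_minus
  have "linear_between (E s) (E (s - 1)) Y" by (rule linear_between_linear[OF linear_Y Y_E])
  then have "linear_between (E s) (E (s - 1)) FY"
    by (rule linear_between_cong) (use FY E_subset_M[of "s"] in auto)
  then show ?thesis by (simp add: Gel_b_minus V F)
next
  case Gel_b_plus
  have "linear_between (E s) (E (s + int l)) (X ^^ l)"
    by (rule linear_between_linear[OF X_power_linear X_power_E])
  then have "linear_between (E s) (E (s + int l)) (FX ^^ l)"
    by (rule linear_between_cong) (use FX_power E_subset_M[of "s"] in auto)
  then show ?thesis by (simp add: Gel_b_plus V F)
next
  case Gel_a_plus
  have "linear_between (E (s + int l)) (E (s + int (l - 1))) Y"
    by (rule linear_between_linear[OF linear_Y Y_plus])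
  then have "linear_between (E (s + int l)) (E (s + int (l - 1))) FY"
    by (rule linear_between_cong) (use FY E_subset_M[of "s + int l"] in auto)
  then show ?thesis
    unfolding Gel_a_plus F_a_plus using G_linear by (simp add: V linear_between_compose)
qed

text \<open>Both detours from the star vertex cross an edge where b vanishes and therefore act as -
  D; together with \<open>a_b_plus\<close> this is the relation of the quiver.\<close>

lemma a_b_minus: "w \<in> E s \<Longrightarrow> F Gel_a_minus (F Gel_b_minus w) = - D w"
  using X_Y_weight[OF H_E, of w s] E_subset_M[of s] M_closed(2)[of w] b_ends(1) by (auto simp: F FX FY)

lemma a_b_plus:
  assumes "w \<in> E s" shows "F Gel_a_plus (F Gel_b_plus w) = - D w"
proof -
  define u where "u = (X ^^ (l - 1)) w"
  have u: "u \<in> E (s + int (l - 1))" using assms by (simp add: u_def X_power_E)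
  have w: "w \<in> M" using assms E_subset_M by blast
  have "(X ^^ l) w = X u" using l_pos by (cases l) (simp_all add: u_def)
  then have "F Gel_b_plus w = X u" using FX_power[OF w, of l] by (simp add: F)
  then have "F Gel_a_plus (F Gel_b_plus w) = G (Y (X u))"
    using FY[OF M_closed(1)[OF subsetD[OF E_subset_M u]]] by (simp add: F_a_plus)
  \<comment> \<open>The top edge of the plus vertex side has b = 0; what remains is to pull - D
    through \<open>X ^^ (l - 1)\<close>, which commutes with it, and cancel against G.\<close>
  also have "Y (X u) = - D u"
    using Y_X_weight[OF H_E[OF u]] b_ends(2) l_pos by (simp add: of_nat_diff)
  also have "\<dots> = (X ^^ (l - 1)) (- D w)"
  proof -
    interpret Xn: Vector_Spaces.linear scale scale "X ^^ (l - 1)" by (rule X_power_linear)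
    have "D ((X ^^ n) w) = (X ^^ n) (D w)" for n by (induction n) (simp_all add: D_commute)
    then show ?thesis using Xn.neg[of "D w"] by (simp add: u_def)
  qed
  also have "G \<dots> = - D w" using assms by (intro G_X subspace_neg[OF subspace_E] D_E)
  finally show ?thesis .
qed

lemma b_a_plus:
  assumes "w \<in> E (s + int l)" shows "F Gel_b_plus (F Gel_a_plus w) = - D w"
proof -
  have w: "w \<in> M" using assms E_subset_M by blast
  have Gs: "G (Y w) \<in> E s" by (rule bspec[OF bij_betwE[OF G_bij] Y_plus[OF assms]])
  have "F Gel_b_plus (F Gel_a_plus w) = (X ^^ l) (G (Y w))"
    using FX_power[OF subsetD[OF E_subset_M Gs], of l] by (simp add: F_a_plus F(3) FY[OF w])
  also have "\<dots> = X ((X ^^ (l - 1)) (G (Y w)))" using l_pos by (cases l) simp_all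
  also have "\<dots> = X (Y w)" using X_G[OF Y_plus[OF assms]] by simp
  also have "\<dots> = - D w" using X_Y_weight[OF H_E[OF assms]] b_ends(2) by simp
  finally show ?thesis .
qed

lemma gelfand_rep: "gelfand_rep V F"
proof -
  have "nilpotent_quiver_maps gel_src gel_tgt V F"
  proof (rule nilpotent_quiver_maps_hub[where h = Gel_star and T = "\<lambda>w. - D w" and N = "Suc d"])
    fix a c :: gelfand_arrow and w
    assume "gel_src a = Gel_star" "gel_tgt a = gel_src c" "w \<in> V Gel_star"
    then show "gel_tgt c = Gel_star \<and> F c (F a w) = - D w"
      using a_b_minus a_b_plus by (cases a; cases c) (simp_all add: V)
  next
    fix a :: gelfand_arrow assume "gel_src a \<noteq> Gel_star"
    then show "gel_tgt a = Gel_star" by (cases a) simp_all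
  next
    fix w assume "w \<in> V Gel_star"
    then show "((\<lambda>w. - D w) ^^ Suc d) w = 0" using neg_D_nilpotent V_subset_M by blast
  qed (rule F_linear subspace_V)+
  moreover have "\<exists>B. finite B \<and> span B = V i" for i
    using finite_span_E by (cases i) (simp_all add: V)
  moreover have "F Gel_a_minus (F Gel_b_minus w) = F Gel_a_plus (F Gel_b_plus w)" if "w \<in> V Gel_star" for w
    using a_b_minus a_b_plus that by (simp add: V)
  ultimately show ?thesis
    by (simp add: gelfand_rep_def quiver_rep_def subspace_V F_linear)
qed

lemma dims: "dim (V Gel_minus) = m (s - 1)" "dim (V Gel_star) = m s" "dim (V Gel_plus) = m (s + int l)"
  by (simp_all add: V dim_E)

lemma FY_image: "FY ` E j = Y ` E j"
  by (rule image_cong) (use FY E_subset_M[of j] in auto)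

text \<open>Here v lies at the star vertex. Detours sweep out E 0, and both arrows leaving the star
  point away from v and are onto.\<close>

lemma cyclic_star:
  assumes "s = 0" shows "cyclic_of_type gel_src gel_tgt V F Gel_star"
  unfolding cyclic_of_type_def
proof (intro conjI bexI allI impI)
  show v: "v \<in> V Gel_star" using e_in_E[of 0 0] by (simp add: V assms e_0_0)
  then show "\<exists>j. V j \<noteq> {0}" using v_nonzero by blast
  fix W assume W: "quiver_subrep gel_src gel_tgt V F W \<and> v \<in> W Gel_star"
  note sub = conjunct1[OF W]
  have arrow: "F a ` W (gel_src a) \<subseteq> W (gel_tgt a)" for a using sub by (simp add: quiver_subrep_def)
  have star: "V Gel_star \<subseteq> W Gel_star"
    unfolding V assms
  proof (rule E_0_subset)
    show "subspace (W Gel_star)" using sub by (simp add: quiver_subrep_def)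
    show "- D w \<in> W Gel_star" if "w \<in> W Gel_star" "w \<in> E 0" for w
      using a_b_minus[of w] arrow[of Gel_a_minus] arrow[of Gel_b_minus] that assms
      by (simp add: image_subset_iff) (metis)
  qed (use W in simp)
  have "F Gel_b_minus ` E 0 = E (- 1)"
    using Y_image_E[of 0] FY_image[of 0] by (simp add: F)
  then have minus: "V Gel_minus \<subseteq> W Gel_minus"
    using quiver_subrep_image[OF sub, of Gel_b_minus] star by (simp add: V assms)
  have "(FX ^^ l) ` E 0 = (X ^^ l) ` E 0" by (rule image_cong) (use FX_power E_subset_M[of 0] in auto)
  then have "F Gel_b_plus ` E 0 = E (int l)" using X_power_image_E[of 0 l] by (simp add: F)
  then have plus: "V Gel_plus \<subseteq> W Gel_plus"
    using quiver_subrep_image[OF sub, of Gel_b_plus] star by (simp add: V assms)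
  show "W = V"
  proof (rule quiver_subrep_eqI[OF sub])
    show "V i \<subseteq> W i" for i using star minus plus by (cases i) auto
  qed
qed

text \<open>Here v lies at the plus vertex and the other two spaces are reached one after the other,
  by \<open>Gel_a_plus\<close> and then \<open>Gel_b_minus\<close>.\<close>

lemma cyclic_plus:
  assumes "s = - int l" shows "cyclic_of_type gel_src gel_tgt V F Gel_plus"
  unfolding cyclic_of_type_def
proof (intro conjI bexI allI impI)
  show v: "v \<in> V Gel_plus" using e_in_E[of 0 0] by (simp add: V assms e_0_0)
  then show "\<exists>j. V j \<noteq> {0}" using v_nonzero by blast
  fix W assume W: "quiver_subrep gel_src gel_tgt V F W \<and> v \<in> W Gel_plus"
  note sub = conjunct1[OF W]
  have arrow: "F a ` W (gel_src a) \<subseteq> W (gel_tgt a)" for a using sub by (simp add: quiver_subrep_def)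
  have "E 0 \<subseteq> W Gel_plus"
  proof (rule E_0_subset)
    show "subspace (W Gel_plus)" using sub by (simp add: quiver_subrep_def)
    show "- D w \<in> W Gel_plus" if "w \<in> W Gel_plus" "w \<in> E 0" for w
      using b_a_plus[of w] arrow[of Gel_a_plus] arrow[of Gel_b_plus] that assms
      by (simp add: image_subset_iff) (metis)
  qed (use W in simp)
  then have plus: "V Gel_plus \<subseteq> W Gel_plus" by (simp add: V assms)
  \<comment> \<open>So Y lands in the domain of the bijection G, which makes
    \<open>Gel_a_plus\<close> onto.\<close>
  have "s + int (l - 1) = - 1" using assms l_pos by (simp add: of_nat_diff)
  then have "G ` E (- 1) = E s" using G_bij by (simp add: bij_betw_def)
  then have "F Gel_a_plus ` E 0 = E s"
    using Y_image_E[of 0] FY_image[of 0] by (simp only: F_a_plus image_comp[symmetric]) simp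
  then have star: "V Gel_star \<subseteq> W Gel_star"
    using quiver_subrep_image[OF sub, of Gel_a_plus] plus assms by (simp add: V)
  then have "F Gel_b_minus ` E s = E (s - 1)" using Y_image_E[of s] assms FY_image[of s] by (simp add: F)
  then have minus: "V Gel_minus \<subseteq> W Gel_minus"
    using quiver_subrep_image[OF sub, of Gel_b_minus] star by (simp add: V)
  show "W = V"
  proof (rule quiver_subrep_eqI[OF sub])
    show "V i \<subseteq> W i" for i using star minus plus by (cases i) auto
  qed
qed

end

section \<open>The two-cyclic quiver\<close>

locale two_cyclic_data = sl2_cyclic_nilpotent scale X Y H k v d
  for scale :: "complex \<Rightarrow> 'b::ab_group_add \<Rightarrow> 'b" and X Y H and k :: int and v :: 'b and d :: nat +
  fixes FX FY :: "'b \<Rightarrow> 'b"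
    and V :: "two_cyclic_vertex \<Rightarrow> 'b set" and F :: "two_cyclic_arrow \<Rightarrow> 'b \<Rightarrow> 'b"
  assumes FX: "\<And>w. w \<in> M \<Longrightarrow> FX w = X w" and FY: "\<And>w. w \<in> M \<Longrightarrow> FY w = Y w"
    and V: "V Cyc_minus = E (- 1)" "V Cyc_plus = E 0"
    and F: "F Cyc_a = FX" "F Cyc_b = FY"
begin

lemma subspace_V: "subspace (V i)"
  by (cases i) (simp_all add: V)

lemma F_linear: "linear_between (V (cyc_src a)) (V (cyc_tgt a)) (F a)"
proof (cases a)
  case Cyc_a
  have "linear_between (E (- 1)) (E 0) X"
    using X_E[of _ "- 1"] by (intro linear_between_linear[OF linear_X]) simp
  then have "linear_between (E (- 1)) (E 0) FX"
    by (rule linear_between_cong) (use FX E_subset_M[of "- 1"] in auto)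
  then show ?thesis by (simp add: Cyc_a V F)
next
  case Cyc_b
  have "linear_between (E 0) (E (- 1)) Y"
    using Y_E[of _ 0] by (intro linear_between_linear[OF linear_Y]) simp
  then have "linear_between (E 0) (E (- 1)) FY"
    by (rule linear_between_cong) (use FY E_subset_M[of 0] in auto)
  then show ?thesis by (simp add: Cyc_b V F)
qed

lemma a_b: "w \<in> E 0 \<Longrightarrow> F Cyc_a (F Cyc_b w) = - D w"
  using X_Y_weight[OF H_E, of w 0] E_subset_M[of 0] M_closed(2)[of w]
  by (auto simp: F FX FY b_def)

lemma two_cyclic_rep: "two_cyclic_rep V F"
proof -
  have "nilpotent_quiver_maps cyc_src cyc_tgt V F"
  proof (rule nilpotent_quiver_maps_hub[where h = Cyc_plus and T = "\<lambda>w. - D w" and N = "Suc d"])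
    fix a c :: two_cyclic_arrow and w
    assume "cyc_src a = Cyc_plus" "cyc_tgt a = cyc_src c" "w \<in> V Cyc_plus"
    then show "cyc_tgt c = Cyc_plus \<and> F c (F a w) = - D w"
      using a_b by (cases a; cases c) (simp_all add: V)
  next
    fix a :: two_cyclic_arrow assume "cyc_src a \<noteq> Cyc_plus"
    then show "cyc_tgt a = Cyc_plus" by (cases a) simp_all
  next
    fix w assume "w \<in> V Cyc_plus"
    then show "((\<lambda>w. - D w) ^^ Suc d) w = 0" using neg_D_nilpotent E_subset_M V by blast
  qed (rule F_linear subspace_V)+
  moreover have "\<exists>B. finite B \<and> span B = V i" for i
    using finite_span_E by (cases i) (simp_all add: V)
  ultimately show ?thesis
    by (simp add: two_cyclic_rep_def quiver_rep_def subspace_V F_linear)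
qed

lemma dims: "dim (V Cyc_minus) = m (- 1)" "dim (V Cyc_plus) = Suc d"
  by (simp_all add: V dim_E m_0)

lemma cyclic_plus: "cyclic_of_type cyc_src cyc_tgt V F Cyc_plus"
  unfolding cyclic_of_type_def
proof (intro conjI bexI allI impI)
  show v: "v \<in> V Cyc_plus" using e_in_E[of 0 0] by (simp add: V e_0_0)
  then show "\<exists>j. V j \<noteq> {0}" using v_nonzero by blast
  fix W assume W: "quiver_subrep cyc_src cyc_tgt V F W \<and> v \<in> W Cyc_plus"
  note sub = conjunct1[OF W]
  have arrow: "F a ` W (cyc_src a) \<subseteq> W (cyc_tgt a)" for a using sub by (simp add: quiver_subrep_def)
  have plus: "V Cyc_plus \<subseteq> W Cyc_plus"
    unfolding V
  proof (rule E_0_subset)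
    show "subspace (W Cyc_plus)" using sub by (simp add: quiver_subrep_def)
    show "- D w \<in> W Cyc_plus" if "w \<in> W Cyc_plus" "w \<in> E 0" for w
      using a_b[of w] arrow[of Cyc_a] arrow[of Cyc_b] that
      by (simp add: image_subset_iff) (metis)
  qed (use W in simp)
  have "FY ` E 0 = Y ` E 0" by (rule image_cong) (use FY E_subset_M[of 0] in auto)
  then have "F Cyc_b ` E 0 = E (- 1)" using Y_image_E[of 0] by (simp add: F)
  then have minus: "V Cyc_minus \<subseteq> W Cyc_minus"
    using quiver_subrep_image[OF sub, of Cyc_b] plus by (simp add: V)
  show "W = V"
  proof (rule quiver_subrep_eqI[OF sub])
    show "V i \<subseteq> W i" for i using minus plus by (cases i) auto
  qed
qed

end

subsection \<open>Isomorphisms of cyclic modules\<close>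

text \<open>The one-sided inequality is what a homomorphism from A to B requires: a vector that
  vanishes in A must vanish in B. Equality lets the locale be used with the roles exchanged.\<close>

locale sl2_cyclic_pair =
  A: sl2_cyclic_nilpotent scale1 X1 Y1 H1 k v1 d1 + B: sl2_cyclic_nilpotent scale2 X2 Y2 H2 k v2 d2
  for scale1 :: "complex \<Rightarrow> 'b::ab_group_add \<Rightarrow> 'b" and X1 Y1 H1 and v1 :: 'b and d1 :: nat
  and scale2 :: "complex \<Rightarrow> 'c::ab_group_add \<Rightarrow> 'c" and X2 Y2 H2 and v2 :: 'c and d2 :: nat
  and k :: int +
  assumes m_le: "B.m j \<le> A.m j"
begin

lemma ex_hom: "\<exists>T. Vector_Spaces.linear scale1 scale2 T \<and> (\<forall>j i. T (A.e j i) = B.e j i)"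
proof -
  interpret P: vector_space_pair scale1 scale2 ..
  \<comment> \<open>On the basis of nonzero vectors \<open>e j i\<close> the index pair can be
    recovered, by injectivity on \<open>index\<close>.\<close>
  define f where "f x = (case inv_into A.index (\<lambda>(j, i). A.e j i) x of (j, i) \<Rightarrow> B.e j i)" for x
  obtain T where T: "Vector_Spaces.linear scale1 scale2 T"
    "\<And>x. x \<in> (\<lambda>(j, i). A.e j i) ` A.index \<Longrightarrow> T x = f x"
    using P.linear_independent_extend[OF A.e_independent(2), of f] by blast
  interpret T: Vector_Spaces.linear scale1 scale2 T by (rule T(1))
  have "T (A.e j i) = B.e j i" for j i
  proof (cases "i < A.m j")
    case True
    then have p: "(j, i) \<in> A.index" by (simp add: A.index_def)
    then have "inv_into A.index (\<lambda>(j, i). A.e j i) (A.e j i) = (j, i)"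
      using inv_into_f_f[OF A.e_independent(1) p] by simp
    moreover have "A.e j i \<in> (\<lambda>(j, i). A.e j i) ` A.index" using p by force
    ultimately show ?thesis using T(2) by (simp add: f_def)
  next
    case False
    then have "A.e j i = 0" "B.e j i = 0" using A.e_eq_0_iff B.e_eq_0_iff m_le[of j] by auto
    then show ?thesis by (simp add: T.zero)
  qed
  then show ?thesis using T(1) by blast
qed

text \<open>The formulas for X, Y and H on the vectors e involve only k, j and i, and hence are the
  same in both modules.\<close>

lemma hom_intertwines:
  assumes T: "Vector_Spaces.linear scale1 scale2 T" and e: "\<And>j i. T (A.e j i) = B.e j i" and w: "w \<in> A.M"
  shows "T w \<in> B.M" "T (X1 w) = X2 (T w)" "T (Y1 w) = Y2 (T w)" "T (H1 w) = H2 (T w)"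
proof -
  interpret T: Vector_Spaces.linear scale1 scale2 T by (rule T)
  note hom = T.add T.scale T.diff T.zero A.hom_simps B.hom_simps
  show "T w \<in> B.M"
    using w by (induction rule: A.M_induct) (simp_all add: hom e B.subspace_M B.subspace_scale B.subspace_add B.subspace_0)
  show "T (X1 w) = X2 (T w)"
    using w
  proof (induction rule: A.M_induct)
    case (base j i)
    show ?case by (cases "j \<ge> 0") (simp_all add: e hom A.X_e B.X_e A.X_e_neg B.X_e_neg)
  qed (simp_all add: hom)
  show "T (Y1 w) = Y2 (T w)"
    using w
  proof (induction rule: A.M_induct)
    case (base j i)
    show ?case by (cases "j \<le> 0") (simp_all add: e hom A.Y_e B.Y_e A.Y_e_pos B.Y_e_pos)
  qed (simp_all add: hom)
  show "T (H1 w) = H2 (T w)"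
    using w
  proof (induction rule: A.M_induct)
    case (base j i)
    show ?case by (simp only: e hom A.H_e B.H_e)
  qed (simp_all add: hom)
qed

lemma ex_iso:
  assumes "\<And>j. A.m j = B.m j"
  shows "\<exists>T. Vector_Spaces.linear scale1 scale2 T \<and> bij_betw T A.M B.M \<and> (\<forall>j i. T (A.e j i) = B.e j i)"
proof -
  interpret swap: sl2_cyclic_pair scale2 X2 Y2 H2 v2 d2 scale1 X1 Y1 H1 v1 d1 k
    by unfold_locales (simp add: assms)
  obtain T where T: "Vector_Spaces.linear scale1 scale2 T" "\<And>j i. T (A.e j i) = B.e j i"
    using ex_hom by blast
  obtain T' where T': "Vector_Spaces.linear scale2 scale1 T'" "\<And>j i. T' (B.e j i) = A.e j i"
    using swap.ex_hom by blast
  interpret T: Vector_Spaces.linear scale1 scale2 T by (rule T)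
  interpret T': Vector_Spaces.linear scale2 scale1 T' by (rule T')
  have "T' (T w) = w" if "w \<in> A.M" for w
    using that by (induction rule: A.M_induct) (simp_all add: T T' T.add T'.add T.scale T'.scale T.zero T'.zero)
  moreover have "T (T' w) = w" if "w \<in> B.M" for w
    using that by (induction rule: B.M_induct) (simp_all add: T T' T.add T'.add T.scale T'.scale T.zero T'.zero)
  ultimately have "bij_betw T A.M B.M"
    using hom_intertwines(1)[OF T] swap.hom_intertwines(1)[OF T']
    by (intro bij_betw_byWitness[where f' = T']) auto
  then show ?thesis using T by blast
qed

end

subsection \<open>Raising and lowering\<close>

lemma smooth_on_scale:
  "smooth_on c UHP \<Longrightarrow> smooth_on f UHP \<Longrightarrow> smooth_on (\<lambda>\<tau>. c \<tau> *s (f \<tau> :: complex^'n)) UHP"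
  by (rule smooth_on_bilinear[OF open_UHP bounded_bilinear_vector_scalar_mult])

lemma smooth_on_Im: "smooth_on (\<lambda>\<tau>. of_real (Im \<tau>) :: complex) UHP"
  by (rule smooth_on_linear) (intro bounded_linear_compose[OF bounded_linear_of_real] bounded_linear_Im)

lemma smooth_on_inverse_Im: "smooth_on (\<lambda>\<tau>. inverse (of_real (Im \<tau>)) :: complex) UHP"
  by (rule smooth_on_inverse[OF open_UHP smooth_on_Im]) (simp add: UHP_def)

text \<open>Rewritten as sums and products of derivatives and powers of y, the form to which the
  rules for smoothness and differentiation apply.\<close>

lemma raise_op_eq:
  fixes f :: "complex \<Rightarrow> complex^'n"
  shows
  "raise_op k f = (\<lambda>\<tau>. (\<i> *s frechet_derivative f (at \<tau>) 1 + frechet_derivative f (at \<tau>) \<i>)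
    + inverse (of_real (Im \<tau>)) *s (of_int k *s f \<tau>))"
proof
  fix \<tau>
  have 1: "(of_int k / of_real (Im \<tau>)) *s f \<tau> = inverse (of_real (Im \<tau>)) *s (of_int k *s f \<tau>)"
    by (simp only: divide_inverse vector_smult_assoc mult.commute)
  have 2: "(2 * \<i>) *s ((1 / 2) *s (a - \<i> *s b)) = \<i> *s a + b" for a b :: "complex^'n"
    by (simp add: vec_eq_iff algebra_simps)
  show "raise_op k f \<tau> = (\<i> *s frechet_derivative f (at \<tau>) 1 + frechet_derivative f (at \<tau>) \<i>)
    + inverse (of_real (Im \<tau>)) *s (of_int k *s f \<tau>)"
    unfolding raise_op_def d_tau_def 1 2 ..
qed

lemma lower_op_eq:
  fixes f :: "complex \<Rightarrow> complex^'n"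
  shows
  "lower_op k f = (\<lambda>\<tau>. of_real (Im \<tau>) *s (of_real (Im \<tau>) *s
    (frechet_derivative f (at \<tau>) \<i> + (- \<i>) *s frechet_derivative f (at \<tau>) 1)))"
proof
  fix \<tau>
  have "(- 2 * \<i> * y\<^sup>2) *s ((1 / 2) *s (a + \<i> *s b)) = y *s (y *s (b + (- \<i>) *s a))" for y and a b :: "complex^'n"
    by (simp add: vec_eq_iff algebra_simps power2_eq_square)
  then show "lower_op k f \<tau> = of_real (Im \<tau>) *s (of_real (Im \<tau>) *s
    (frechet_derivative f (at \<tau>) \<i> + (- \<i>) *s frechet_derivative f (at \<tau>) 1))"
    unfolding lower_op_def d_tau_bar_def of_real_power by blast
qed

lemma smooth_on_raise_op:
  assumes "smooth_on f UHP" shows "smooth_on (raise_op k f) UHP"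
  unfolding raise_op_eq
  by (intro smooth_on_add[OF open_UHP] smooth_on_scale smooth_on_frechet_derivative smooth_on_const
      smooth_on_inverse_Im assms)

lemma smooth_on_lower_op:
  assumes "smooth_on f UHP" shows "smooth_on (lower_op k f) UHP"
  unfolding lower_op_eq
  by (intro smooth_on_add[OF open_UHP] smooth_on_scale smooth_on_frechet_derivative smooth_on_const
      smooth_on_Im assms)

lemma lower_raise_commutator:
  fixes f :: "complex \<Rightarrow> complex^'n"
  assumes f: "smooth_on f UHP" and z: "z \<in> UHP"
  shows "lower_op (k + 2) (raise_op k f) z + of_int k *s f z = raise_op (k - 2) (lower_op k f) z"
proof -
  define fx fy where "fx \<tau> = frechet_derivative f (at \<tau>) 1" and "fy \<tau> = frechet_derivative f (at \<tau>) \<i>" for \<tau>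
  have sx: "smooth_on fx UHP" and sy: "smooth_on fy UHP"
    unfolding fx_def fy_def by (rule smooth_on_frechet_derivative[OF f])+
  note d = smooth_on_differentiable[OF open_UHP _ z]
  define Df Dx Dy where "Df = frechet_derivative f (at z)" and "Dx = frechet_derivative fx (at z)"
    and "Dy = frechet_derivative fy (at z)"
  note df = d[OF f, folded Df_def] and dx = d[OF sx, folded Dx_def] and dy = d[OF sy, folded Dy_def]
  have y: "Im z \<noteq> 0" using z by (simp add: UHP_def)
  note scale = bounded_bilinear.FDERIV[OF bounded_bilinear_vector_scalar_mult]
  have dIm: "((\<lambda>\<tau>. complex_of_real (Im \<tau>)) has_derivative (\<lambda>v. of_real (Im v))) (at z)"
    by (intro bounded_linear_imp_has_derivative bounded_linear_compose[OF bounded_linear_of_real] bounded_linear_Im)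
  have dinv: "((\<lambda>\<tau>. inverse (complex_of_real (Im \<tau>))) has_derivative
      (\<lambda>v. - (inverse (of_real (Im z)) * of_real (Im v) * inverse (of_real (Im z))))) (at z)"
    by (rule Deriv.has_derivative_inverse[OF _ dIm]) (use y in simp)
  have eqs: "raise_op k f = (\<lambda>\<tau>. (\<i> *s fx \<tau> + fy \<tau>) + inverse (of_real (Im \<tau>)) *s (of_int k *s f \<tau>))"
    "lower_op k f = (\<lambda>\<tau>. of_real (Im \<tau>) *s (of_real (Im \<tau>) *s (fy \<tau> + (- \<i>) *s fx \<tau>)))"
    unfolding raise_op_eq lower_op_eq fx_def fy_def by simp_all
  have R: "frechet_derivative (raise_op k f) (at z) = (\<lambda>v. (\<i> *s Dx v + 0 *s fx z + Dy v)
     + (inverse (of_real (Im z)) *s (of_int k *s Df v + 0 *s f z)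
        + (- (inverse (of_real (Im z)) * of_real (Im v) * inverse (of_real (Im z)))) *s (of_int k *s f z)))"
    unfolding eqs
    by (rule frechet_derivative_at[symmetric])
      (intro has_derivative_add scale[OF has_derivative_const] scale[OF dinv] df dx dy)
  have L: "frechet_derivative (lower_op k f) (at z) = (\<lambda>v. of_real (Im z) *s
      (of_real (Im z) *s (Dy v + ((- \<i>) *s Dx v + 0 *s fx z)) + of_real (Im v) *s (fy z + (- \<i>) *s fx z))
      + of_real (Im v) *s (of_real (Im z) *s (fy z + (- \<i>) *s fx z)))"
    unfolding eqs
    by (rule frechet_derivative_at[symmetric])
      (intro has_derivative_add scale[OF has_derivative_const] scale[OF dIm] df dx dy)
  have sym: "Dx \<i> = Dy 1"
    unfolding Dx_def Dy_def fx_def fy_def by (rule smooth_on_second_derivative_symmetric[OF open_UHP f z])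
  have Df: "Df 1 = fx z" "Df \<i> = fy z" by (simp_all add: Df_def fx_def fy_def)
  \<comment> \<open>The two sides as pure algebra, with w = 1 / y, K = k, c = f, first partials a
    and b in x and y, and second partials r, p, q for xx, xy, yy. The explicit 0 and 1 are
    derivatives of constants and the imaginary parts of the directions 1 and \<i>.\<close>
  have "y *s (y *s ((\<i> *s p + 0 *s a + q + (w *s (K *s b + 0 *s c) + (- (w * 1 * w)) *s (K *s c)))
      + (- \<i>) *s (\<i> *s r + 0 *s a + p + (w *s (K *s a + 0 *s c) + (- (w * 0 * w)) *s (K *s c))))) + K *s c
    = (\<i> *s (y *s (y *s (p + ((- \<i>) *s r + 0 *s a)) + 0 *s (b + (- \<i>) *s a)) + 0 *s (y *s (b + (- \<i>) *s a)))
      + (y *s (y *s (q + ((- \<i>) *s p + 0 *s a)) + 1 *s (b + (- \<i>) *s a)) + 1 *s (y *s (b + (- \<i>) *s a))))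
      + w *s ((K - 2) *s (y *s (y *s (b + (- \<i>) *s a))))"
    if "w * y = 1" for y w K and a b c p q r :: "complex^'n"
  proof -
    have wy: "w * (y * x) = x" for x using that by (simp flip: mult.assoc)
    show ?thesis by (simp add: vec_eq_iff algebra_simps wy)
  qed
  from this[of "inverse (of_real (Im z))" "of_real (Im z)" "Dx \<i>" "fx z" "Dy \<i>" "of_int k" "fy z" "f z" "Dx 1"]
  show ?thesis
    unfolding lower_op_eq[of "k + 2"] raise_op_eq[of "k - 2"] R L
    unfolding eqs Df using sym y by simp
qed

subsection \<open>The space spanned by lifts\<close>

lemma maass_lift_linear:
  "maass_lift k f + maass_lift k g = maass_lift k (\<lambda>\<tau>. f \<tau> + g \<tau>)"
  "fun_scale c (maass_lift k f) = maass_lift k (\<lambda>\<tau>. c *s f \<tau>)"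
  by (simp_all add: fun_eq_iff maass_lift_def slash_def fun_scale_def vec_eq_iff algebra_simps)

lemma maass_lift_cong:
  "(\<And>\<tau>. \<tau> \<in> UHP \<Longrightarrow> f \<tau> = g \<tau>) \<Longrightarrow> maass_lift k f = maass_lift k g"
  by (auto simp: fun_eq_iff maass_lift_def SL2R_carrier slash_def moebius_i_UHP)

definition lift_span :: "(real^2^2 \<Rightarrow> complex^'n) set" where
  "lift_span = fun_vs.span {maass_lift k f | k f. smooth_on f UHP}"

lemma subspace_lift_span: "fun_vs.subspace lift_span"
  by (simp add: lift_span_def)

lemma maass_lift_in_lift_span: "smooth_on f UHP \<Longrightarrow> maass_lift k f \<in> lift_span"
  unfolding lift_span_def by (rule fun_vs.span_base) blast

lemma lift_span_induct [consumes 1, case_names lift scale add zero]: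
  assumes "\<phi> \<in> lift_span" "\<And>k f. smooth_on f UHP \<Longrightarrow> P (maass_lift k f)"
    "\<And>c \<phi>. \<phi> \<in> lift_span \<Longrightarrow> P \<phi> \<Longrightarrow> P (fun_scale c \<phi>)"
    "\<And>\<phi> \<psi>. \<phi> \<in> lift_span \<Longrightarrow> \<psi> \<in> lift_span \<Longrightarrow> P \<phi> \<Longrightarrow> P \<psi> \<Longrightarrow> P (\<phi> + \<psi>)" "P 0"
  shows "P \<phi>"
proof -
  have "\<phi> \<in> lift_span \<and> P \<phi>"
    using assms(1) unfolding lift_span_def
  proof (induction rule: fun_vs.span_induct_alt)
    case base
    show ?case using assms(5) fun_vs.span_zero by blast
  next
    case (step c x y)
    then have x: "x \<in> lift_span" "P x" using assms(2) maass_lift_in_lift_span by blast+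
    have y: "y \<in> lift_span" "P y" using step(2) by (simp_all add: lift_span_def)
    have cx: "fun_scale c x \<in> lift_span" "P (fun_scale c x)"
      using assms(3) x fun_vs.subspace_scale[OF subspace_lift_span] by blast+
    show ?case
      unfolding lift_span_def[symmetric]
      using fun_vs.subspace_add[OF subspace_lift_span cx(1) y(1)] assms(4)[OF cx(1) y(1) cx(2) y(2)] by blast
  qed
  then show ?thesis ..
qed

lemma right_derivative_add:
  assumes "lift_differentiable \<phi>" "lift_differentiable \<psi>" "trace A = 0"
  shows "right_derivative A (\<phi> + \<psi>) = right_derivative A \<phi> + right_derivative A \<psi>"
  using assms unfolding lift_differentiable_def
  by (simp add: fun_eq_iff right_derivative_def vector_derivative_add_at)

lemma right_derivative_scale:
  assumes "lift_differentiable \<phi>" "trace A = 0"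
  shows "right_derivative A (fun_scale c \<phi>) = fun_scale c (right_derivative A \<phi>)"
proof
  fix g
  have "((\<lambda>t. \<phi> (g ** matrix_exp (t *\<^sub>R A))) has_vector_derivative right_derivative A \<phi> g) (at 0)"
    using assms unfolding lift_differentiable_def right_derivative_def vector_derivative_works by blast
  then have "((\<lambda>t. c *s \<phi> (g ** matrix_exp (t *\<^sub>R A))) has_vector_derivative c *s right_derivative A \<phi> g) (at 0)"
    by (rule bounded_linear.has_vector_derivative
        [OF bounded_bilinear.bounded_linear_right[OF bounded_bilinear_vector_scalar_mult]])
  then show "right_derivative A (fun_scale c \<phi>) g = fun_scale c (right_derivative A \<phi>) g"
    unfolding right_derivative_def fun_scale_def by (rule vector_derivative_at)
qed

lemma lift_differentiable_lift_span:
  assumes "\<phi> \<in> lift_span" shows "lift_differentiable \<phi>"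
  using assms
proof (induction rule: lift_span_induct)
  case (lift k f)
  then show ?case by (rule lift_differentiable_maass_lift)
next
  case (scale c \<phi>)
  show ?case
    unfolding lift_differentiable_def
  proof (intro allI impI)
    fix A g assume "trace (A :: real^2^2) = 0"
    then have "(\<lambda>t. \<phi> (g ** matrix_exp (t *\<^sub>R A))) differentiable at 0"
      using scale by (simp add: lift_differentiable_def)
    then obtain D where "((\<lambda>t. \<phi> (g ** matrix_exp (t *\<^sub>R A))) has_derivative D) (at 0)"
      by (auto simp: differentiable_def)
    from bounded_linear.has_derivative[OF bounded_bilinear.bounded_linear_right
        [OF bounded_bilinear_vector_scalar_mult] this]
    show "(\<lambda>t. fun_scale c \<phi> (g ** matrix_exp (t *\<^sub>R A))) differentiable at 0"
      unfolding fun_scale_def by (rule differentiableI)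
  qed
next
  case (add \<phi> \<psi>)
  then show ?case by (simp add: lift_differentiable_def)
next
  case zero
  show ?case by (simp add: lift_differentiable_def)
qed

lemma lie_act_linear:
  assumes "Z \<in> sl2C" "\<phi> \<in> lift_span"
  shows "\<psi> \<in> lift_span \<Longrightarrow> lie_act Z (\<phi> + \<psi>) = lie_act Z \<phi> + lie_act Z \<psi>"
    and "lie_act Z (fun_scale c \<phi>) = fun_scale c (lie_act Z \<phi>)"
  using assms trace_real_imaginary_parts[OF assms(1)]
  by (simp_all add: lie_act_def right_derivative_add right_derivative_scale lift_differentiable_lift_span
      fun_vs.scale_right_distrib mult_ac)

lemma linear_lift_derivative_sl2:
  fixes f :: "complex \<Rightarrow> complex^'n"
  assumes "smooth_on f UHP" "det g = 1" "trace A = 0"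
  shows "lift_derivative k f A g =
    of_real (2 * A $ 1 $ 1) *s lift_derivative k f (vector [vector [1 / 2, 0], vector [0, - 1 / 2]]) g
    + (of_real (A $ 1 $ 2 + A $ 2 $ 1) *s lift_derivative k f (vector [vector [0, 1 / 2], vector [1 / 2, 0]]) g
    + of_real ((A $ 2 $ 1 - A $ 1 $ 2) / 2) *s lift_derivative k f (vector [vector [0, - 1], vector [1, 0]]) g)"
proof -
  define P Q J :: "real^2^2" where "P = vector [vector [1 / 2, 0], vector [0, - 1 / 2]]"
    and "Q = vector [vector [0, 1 / 2], vector [1 / 2, 0]]" and "J = vector [vector [0, - 1], vector [1, 0]]"
  \<comment> \<open>The factor 1 gives the sum the shape of a linear combination of two terms, so
    that \<open>linear_lift_derivative\<close> applies twice.\<close>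
  have "A = (2 * A $ 1 $ 1) *\<^sub>R P + 1 *\<^sub>R ((A $ 1 $ 2 + A $ 2 $ 1) *\<^sub>R Q + ((A $ 2 $ 1 - A $ 1 $ 2) / 2) *\<^sub>R J)"
    using assms(3) by (simp add: vec_eq_iff forall_2 P_def Q_def J_def trace_def sum_2 field_simps)
  then have "lift_derivative k f A g = lift_derivative k f ((2 * A $ 1 $ 1) *\<^sub>R P
      + 1 *\<^sub>R ((A $ 1 $ 2 + A $ 2 $ 1) *\<^sub>R Q + ((A $ 2 $ 1 - A $ 1 $ 2) / 2) *\<^sub>R J)) g"
    by simp
  also have "\<dots> = of_real (2 * A $ 1 $ 1) *s lift_derivative k f P g
    + (of_real (A $ 1 $ 2 + A $ 2 $ 1) *s lift_derivative k f Q g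
    + of_real ((A $ 2 $ 1 - A $ 1 $ 2) / 2) *s lift_derivative k f J g)"
    unfolding linear_lift_derivative[OF assms(1,2)] by simp
  finally show ?thesis unfolding P_def Q_def J_def .
qed

text \<open>The coefficients are the coordinates of Z in the basis H, X, Y. It reduces stability and
  equivariance for the whole Lie algebra to these three operators.\<close>

lemma lie_act_decompose:
  fixes \<phi> :: "real^2^2 \<Rightarrow> complex^'n"
  assumes Z: "Z \<in> sl2C" and "\<phi> \<in> lift_span"
  shows "lie_act Z \<phi> = fun_scale (- \<i> * (Z $ 2 $ 1 - Z $ 1 $ 2) / 2) (lie_act sl2_H \<phi>)
    + fun_scale (Z $ 1 $ 1 - \<i> * (Z $ 1 $ 2 + Z $ 2 $ 1) / 2) (lie_act sl2_X \<phi>)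
    + fun_scale (Z $ 1 $ 1 + \<i> * (Z $ 1 $ 2 + Z $ 2 $ 1) / 2) (lie_act sl2_Y \<phi>)"
  using assms(2)
proof (induction rule: lift_span_induct)
  case (lift k f)
  show ?case
  proof
    fix g
    show "lie_act Z (maass_lift k f) g = (fun_scale (- \<i> * (Z $ 2 $ 1 - Z $ 1 $ 2) / 2) (lie_act sl2_H (maass_lift k f))
      + fun_scale (Z $ 1 $ 1 - \<i> * (Z $ 1 $ 2 + Z $ 2 $ 1) / 2) (lie_act sl2_X (maass_lift k f))
      + fun_scale (Z $ 1 $ 1 + \<i> * (Z $ 1 $ 2 + Z $ 2 $ 1) / 2) (lie_act sl2_Y (maass_lift k f))) g"
    proof (cases "det g = 1")
      case True
      define P Q J where "P = lift_derivative k f (vector [vector [1 / 2, 0], vector [0, - 1 / 2]]) g"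
        and "Q = lift_derivative k f (vector [vector [0, 1 / 2], vector [1 / 2, 0]]) g"
        and "J = lift_derivative k f (vector [vector [0, - 1], vector [1, 0]]) g"
      have L: "lift_derivative k f A g = of_real (2 * A $ 1 $ 1) *s P
          + (of_real (A $ 1 $ 2 + A $ 2 $ 1) *s Q + of_real ((A $ 2 $ 1 - A $ 1 $ 2) / 2) *s J)"
        if "trace A = 0" for A
        unfolding P_def Q_def J_def by (rule linear_lift_derivative_sl2[OF lift True that])
      \<comment> \<open>Real and imaginary parts of W combine into a formula that is complex linear
        in W, so comparing coefficients finishes the case of a lift.\<close>
      have act: "lie_act W (maass_lift k f) g = (2 * W $ 1 $ 1) *s P
          + ((W $ 1 $ 2 + W $ 2 $ 1) *s Q + ((W $ 2 $ 1 - W $ 1 $ 2) / 2) *s J)" if W: "W \<in> sl2C" for W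
        unfolding lie_act_maass_lift[OF lift W] L[OF trace_real_imaginary_parts(1)[OF W]]
          L[OF trace_real_imaginary_parts(2)[OF W]]
        using True by (simp add: vec_eq_iff complex_eq_iff algebra_simps add_divide_distrib diff_divide_distrib)
      show ?thesis
        unfolding plus_fun_def fun_scale_def act[OF Z] act[OF sl2_in_sl2C(1)] act[OF sl2_in_sl2C(2)]
          act[OF sl2_in_sl2C(3)]
        by (simp add: sl2_H_def sl2_X_def sl2_Y_def vec_eq_iff field_simps)
    next
      case False
      then show ?thesis using lift Z by (simp add: lie_act_maass_lift fun_scale_def)
    qed
  qed
next
  case (scale c \<phi>)
  show ?case
    unfolding lie_act_linear(2)[OF Z scale(1)] lie_act_linear(2)[OF sl2_in_sl2C(1) scale(1)]
      lie_act_linear(2)[OF sl2_in_sl2C(2) scale(1)] lie_act_linear(2)[OF sl2_in_sl2C(3) scale(1)] scale(2)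
    by (simp only: fun_vs.scale_right_distrib fun_vs.scale_scale mult.commute)
next
  case (add \<phi> \<psi>)
  show ?case
    unfolding lie_act_linear(1)[OF Z add(1,2)] lie_act_linear(1)[OF sl2_in_sl2C(1) add(1,2)]
      lie_act_linear(1)[OF sl2_in_sl2C(2) add(1,2)] lie_act_linear(1)[OF sl2_in_sl2C(3) add(1,2)] add(3,4)
    by (simp only: fun_vs.scale_right_distrib add_ac)
next
  case zero
  have "lie_act W (0 :: real^2^2 \<Rightarrow> complex^'n) = 0" if "W \<in> sl2C" for W
    using lie_act_linear(2)[OF that fun_vs.subspace_0[OF subspace_lift_span], of 0] by simp
  note zero = this
  show ?case
    by (simp only: zero[OF Z] zero[OF sl2_in_sl2C(1)] zero[OF sl2_in_sl2C(2)] zero[OF sl2_in_sl2C(3)]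
        fun_vs.scale_zero_right add_0)
qed

text \<open>A rotation is multiplication by a complex number on rows, so it fixes the point g \<i>
  and changes the lift by a character.\<close>

lemma SO2_row_eval:
  assumes "h \<in> SO2" shows "row_eval (g ** h) i = row_eval g i * row_eval h 2" "det h = 1"
proof -
  have o: "transpose h ** h = mat 1" and d: "det h = 1"
    using assms by (auto simp: SO2_def rotation_matrix_def orthogonal_matrix_def)
  have n: "h$1$1 * h$1$1 + h$2$1 * h$2$1 = 1" "h$1$2 * h$1$2 + h$2$2 * h$2$2 = 1"
    using o by (simp_all add: vec_eq_iff forall_2 matrix_matrix_mult_2 transpose_def mat_def)
  \<comment> \<open>The left side is the sum of the squared column lengths minus twice the
    determinant, that is 1 + 1 - 2.\<close>
  have "(h$1$1 - h$2$2)\<^sup>2 + (h$1$2 + h$2$1)\<^sup>2 = 0"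
    using n d unfolding det_2 by (simp add: power2_eq_square algebra_simps)
  then have "h$1$1 = h$2$2" "h$1$2 = - h$2$1" by (auto simp: sum_power2_eq_zero_iff)
  then show "row_eval (g ** h) i = row_eval g i * row_eval h 2"
    by (simp add: row_eval_def complex_eq_iff matrix_matrix_mult_2 algebra_simps)
  show "det h = 1" by (rule d)
qed

lemma right_translate_maass_lift:
  assumes "h \<in> SO2"
  shows "right_translate h (maass_lift k f) = fun_scale (row_eval h 2 powi (- k)) (maass_lift k f)"
proof
  fix g
  have q: "row_eval h 2 \<noteq> 0" using row_eval_nonzero SO2_row_eval(2)[OF assms] by blast
  show "right_translate h (maass_lift k f) g = fun_scale (row_eval h 2 powi (- k)) (maass_lift k f) g"
    using q by (cases "det g = 1")
      (simp_all add: right_translate_def fun_scale_def maass_lift_apply maass_lift_outside det_mul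
        SO2_row_eval[OF assms] moebius_i power_int_mult_distrib vec_eq_iff)
qed

section \<open>Linear extension of the action to all functions\<close>

text \<open>The operators \<^term>\<open>lie_act Z\<close> are linear only on functions that are differentiable along the
  one-parameter groups. Precomposing with a linear projection onto the span of the lifts makes them
  linear on the whole function space, so that \<^locale>\<open>sl2_action\<close> applies.\<close>

definition lift_projection :: "(real^2^2 \<Rightarrow> complex^'n) \<Rightarrow> real^2^2 \<Rightarrow> complex^'n" where
  "lift_projection = (SOME \<pi>. Vector_Spaces.linear fun_scale fun_scale \<pi> \<and> range \<pi> \<subseteq> lift_span \<and>
     (\<forall>\<phi>\<in>lift_span. \<pi> \<phi> = \<phi>))"

lemma lift_projection:
  "Vector_Spaces.linear fun_scale fun_scale (lift_projection :: (real^2^2 \<Rightarrow> complex^'n) \<Rightarrow> _)"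
  "lift_projection \<phi> \<in> (lift_span :: (real^2^2 \<Rightarrow> complex^'n) set)"
  "\<phi> \<in> lift_span \<Longrightarrow> lift_projection \<phi> = (\<phi> :: real^2^2 \<Rightarrow> complex^'n)"
proof -
  interpret P: vector_space_pair "fun_scale :: complex \<Rightarrow> (real^2^2 \<Rightarrow> complex^'n) \<Rightarrow> _"
    "fun_scale :: complex \<Rightarrow> (real^2^2 \<Rightarrow> complex^'n) \<Rightarrow> _" ..
  \<comment> \<open>A projection onto a subspace is a left inverse of the identity on that
    subspace.\<close>
  have "Vector_Spaces.linear fun_scale fun_scale (id :: (real^2^2 \<Rightarrow> complex^'n) \<Rightarrow> _)"
    by unfold_locales simp_all
  from P.linear_exists_left_inverse_on[OF this subspace_lift_span]
  have "\<exists>\<pi> :: (real^2^2 \<Rightarrow> complex^'n) \<Rightarrow> _. Vector_Spaces.linear fun_scale fun_scale \<pi> \<and>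
      range \<pi> \<subseteq> lift_span \<and> (\<forall>\<phi>\<in>lift_span. \<pi> \<phi> = \<phi>)"
    by auto
  note someI_ex[OF this, folded lift_projection_def]
  then show "Vector_Spaces.linear fun_scale fun_scale (lift_projection :: (real^2^2 \<Rightarrow> complex^'n) \<Rightarrow> _)"
    and "lift_projection \<phi> \<in> (lift_span :: (real^2^2 \<Rightarrow> complex^'n) set)"
    and "\<phi> \<in> lift_span \<Longrightarrow> lift_projection \<phi> = (\<phi> :: real^2^2 \<Rightarrow> complex^'n)"
    by auto
qed

definition lift_act :: "complex^2^2 \<Rightarrow> (real^2^2 \<Rightarrow> complex^'n) \<Rightarrow> real^2^2 \<Rightarrow> complex^'n" where
  "lift_act Z \<phi> = lie_act Z (lift_projection \<phi>)"

lemma lift_act_eq: "\<phi> \<in> lift_span \<Longrightarrow> lift_act Z \<phi> = lie_act Z \<phi>"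
  by (simp add: lift_act_def lift_projection)

text \<open>With this, identities proved on \<open>lift_span\<close> extend to arbitrary
  functions.\<close>

lemma lift_act_projection: "lift_act Z (lift_projection \<phi>) = lift_act Z \<phi>"
  by (simp add: lift_act_def lift_projection)

lemma linear_lift_act:
  assumes "Z \<in> sl2C"
  shows "Vector_Spaces.linear fun_scale fun_scale (lift_act Z :: (real^2^2 \<Rightarrow> complex^'n) \<Rightarrow> _)"
proof -
  interpret \<pi>: Vector_Spaces.linear fun_scale fun_scale "lift_projection :: (real^2^2 \<Rightarrow> complex^'n) \<Rightarrow> _"
    by (rule lift_projection)
  show ?thesis
    by unfold_locales
      (simp_all only: lift_act_def \<pi>.add \<pi>.scale lie_act_linear[OF assms lift_projection(2)] lift_projection(2))
qed

lemma lift_act_maass_lift: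
  assumes "smooth_on f UHP"
  shows "lift_act sl2_H (maass_lift k f) = fun_scale (of_int k) (maass_lift k f)"
    "lift_act sl2_X (maass_lift k f) = maass_lift (k + 2) (raise_op k f)"
    "lift_act sl2_Y (maass_lift k f) = maass_lift (k - 2) (lower_op k f)"
  using assms
  by (simp_all add: lift_act_eq maass_lift_in_lift_span lie_act_H_maass_lift lie_act_X_maass_lift
      lie_act_Y_maass_lift)

lemma lift_act_in_lift_span:
  fixes \<phi> :: "real^2^2 \<Rightarrow> complex^'n"
  shows
  "lift_act sl2_H \<phi> \<in> lift_span" "lift_act sl2_X \<phi> \<in> lift_span" "lift_act sl2_Y \<phi> \<in> lift_span"
proof -
  have closed: "lift_act Z \<phi> \<in> lift_span"
    if Z: "Z \<in> sl2C" and Z_lift: "\<And>k (f :: complex \<Rightarrow> complex^'n). smooth_on f UHP \<Longrightarrow> lift_act Z (maass_lift k f) \<in> lift_span" for Z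
  proof -
    interpret Z: Vector_Spaces.linear fun_scale fun_scale "lift_act Z :: (real^2^2 \<Rightarrow> complex^'n) \<Rightarrow> _"
      by (rule linear_lift_act[OF Z])
    have "lift_act Z \<psi> \<in> lift_span" if "\<psi> \<in> lift_span" for \<psi> :: "real^2^2 \<Rightarrow> complex^'n"
      using that
    proof (induction rule: lift_span_induct)
      case (lift k f)
      then show ?case by (rule Z_lift)
    next
      case (scale c \<psi>)
      show ?case unfolding Z.scale by (rule fun_vs.subspace_scale[OF subspace_lift_span scale(2)])
    next
      case (add \<phi> \<psi>)
      show ?case unfolding Z.add by (rule fun_vs.subspace_add[OF subspace_lift_span add(3,4)])
    next
      case zero
      show ?case unfolding Z.zero by (rule fun_vs.subspace_0[OF subspace_lift_span])
    qed
    from this[OF lift_projection(2)] show ?thesis by (simp only: lift_act_projection)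
  qed
  show "lift_act sl2_H \<phi> \<in> lift_span"
    by (rule closed[OF sl2_in_sl2C(1)])
      (simp only: lift_act_maass_lift fun_vs.subspace_scale[OF subspace_lift_span] maass_lift_in_lift_span)
  show "lift_act sl2_X \<phi> \<in> lift_span"
    by (rule closed[OF sl2_in_sl2C(2)])
      (simp only: lift_act_maass_lift maass_lift_in_lift_span smooth_on_raise_op)
  show "lift_act sl2_Y \<phi> \<in> lift_span"
    by (rule closed[OF sl2_in_sl2C(3)])
      (simp only: lift_act_maass_lift maass_lift_in_lift_span smooth_on_lower_op)
qed

global_interpretation lift: sl2_action
  "fun_scale :: complex \<Rightarrow> (real^2^2 \<Rightarrow> complex^'n) \<Rightarrow> real^2^2 \<Rightarrow> complex^'n"
  "lift_act sl2_X" "lift_act sl2_Y" "lift_act sl2_H"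
proof -
  note lin = linear_lift_act[OF sl2_in_sl2C(1)] linear_lift_act[OF sl2_in_sl2C(2)] linear_lift_act[OF sl2_in_sl2C(3)]
  interpret H: Vector_Spaces.linear fun_scale fun_scale "lift_act sl2_H :: (real^2^2 \<Rightarrow> complex^'n) \<Rightarrow> _" by (rule lin)
  interpret X: Vector_Spaces.linear fun_scale fun_scale "lift_act sl2_X :: (real^2^2 \<Rightarrow> complex^'n) \<Rightarrow> _" by (rule lin)
  interpret Y: Vector_Spaces.linear fun_scale fun_scale "lift_act sl2_Y :: (real^2^2 \<Rightarrow> complex^'n) \<Rightarrow> _" by (rule lin)
  note hom = H.add X.add Y.add H.scale X.scale Y.scale H.zero X.zero Y.zero
  note smooth = lift_act_maass_lift smooth_on_raise_op smooth_on_lower_op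
  have HX: "lift_act sl2_H (lift_act sl2_X w) = lift_act sl2_X (lift_act sl2_H w) + lift_act sl2_X w + lift_act sl2_X w"
    if "w \<in> lift_span" for w :: "real^2^2 \<Rightarrow> complex^'n"
    using that
  proof (induction rule: lift_span_induct)
    case (lift k f)
    have "fun_scale (of_int (k + 2)) \<phi> = fun_scale (of_int k) \<phi> + \<phi> + \<phi>" for \<phi> :: "real^2^2 \<Rightarrow> complex^'n"
      by (simp add: fun_eq_iff fun_scale_def vec_eq_iff algebra_simps)
    then show ?case using lift by (simp only: smooth hom)
  next
    case (scale c w)
    show ?case by (simp only: hom scale(2) fun_vs.scale_right_distrib)
  next
    case (add u w)
    show ?case by (simp only: hom add(3,4) add_ac)
  next
    case zero
    show ?case by (simp only: hom add_0)
  qed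
  have HY: "lift_act sl2_H (lift_act sl2_Y w) = lift_act sl2_Y (lift_act sl2_H w) - lift_act sl2_Y w - lift_act sl2_Y w"
    if "w \<in> lift_span" for w :: "real^2^2 \<Rightarrow> complex^'n"
    using that
  proof (induction rule: lift_span_induct)
    case (lift k f)
    have "fun_scale (of_int (k - 2)) \<phi> = fun_scale (of_int k) \<phi> - \<phi> - \<phi>" for \<phi> :: "real^2^2 \<Rightarrow> complex^'n"
      by (simp add: fun_eq_iff fun_scale_def vec_eq_iff algebra_simps)
    then show ?case using lift by (simp only: smooth hom)
  next
    case (scale c w)
    show ?case by (simp only: hom scale(2) fun_vs.scale_right_diff_distrib)
  next
    case (add u w)
    show ?case by (simp only: hom add(3,4)) (simp only: algebra_simps)
  next
    case zero
    show ?case by (simp only: hom diff_zero)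
  qed
  have XY: "lift_act sl2_X (lift_act sl2_Y w) = lift_act sl2_Y (lift_act sl2_X w) + lift_act sl2_H w"
    if "w \<in> lift_span" for w :: "real^2^2 \<Rightarrow> complex^'n"
    using that
  proof (induction rule: lift_span_induct)
    case (lift k f)
    \<comment> \<open>The commutator of the operators on the upper half plane becomes the bracket of
      X and Y; the term k f is the action of H.\<close>
    have "maass_lift k (raise_op (k - 2) (lower_op k f))
        = maass_lift k (\<lambda>\<tau>. lower_op (k + 2) (raise_op k f) \<tau> + of_int k *s f \<tau>)"
      by (rule maass_lift_cong) (rule lower_raise_commutator[OF lift, symmetric])
    also have "\<dots> = maass_lift k (lower_op (k + 2) (raise_op k f)) + fun_scale (of_int k) (maass_lift k f)"
      by (simp only: maass_lift_linear)
    finally show ?case using lift by (simp only: smooth) simp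
  next
    case (scale c w)
    show ?case by (simp only: hom scale(2) fun_vs.scale_right_distrib)
  next
    case (add u w)
    show ?case by (simp only: hom add(3,4) add_ac)
  next
    case zero
    show ?case by (simp only: hom add_0)
  qed
  show "sl2_action (fun_scale :: complex \<Rightarrow> (real^2^2 \<Rightarrow> complex^'n) \<Rightarrow> real^2^2 \<Rightarrow> complex^'n)
    (lift_act sl2_X) (lift_act sl2_Y) (lift_act sl2_H)"
  proof (intro sl2_action.intro sl2_action_axioms.intro fun_vs.complex_space_axioms lin)
    fix w :: "real^2^2 \<Rightarrow> complex^'n"
    show "lift_act sl2_H (lift_act sl2_X w) = lift_act sl2_X (lift_act sl2_H w) + lift_act sl2_X w + lift_act sl2_X w"
      using HX[OF lift_projection(2), of w] by (simp only: lift_act_projection)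
    show "lift_act sl2_H (lift_act sl2_Y w) = lift_act sl2_Y (lift_act sl2_H w) - lift_act sl2_Y w - lift_act sl2_Y w"
      using HY[OF lift_projection(2), of w] by (simp only: lift_act_projection)
    show "lift_act sl2_X (lift_act sl2_Y w) = lift_act sl2_Y (lift_act sl2_X w) + lift_act sl2_H w"
      using XY[OF lift_projection(2), of w] by (simp only: lift_act_projection)
  qed
qed

subsection \<open>Multiplicities of the module of a form\<close>

context sl2_cyclic_nilpotent
begin

lemma m_nonneg:
  assumes "j \<ge> 0" "\<And>i. 0 < i \<Longrightarrow> i \<le> j \<Longrightarrow> b i \<noteq> 0"
  shows "m j = Suc d"
  using assms
proof (induction j rule: e_induct)
  case (up j)
  then show ?case using m_up(2)[of j] by simp
qed (simp_all add: m_0)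

lemma m_neg:
  assumes "j < 0" "\<And>i. j < i \<Longrightarrow> i < 0 \<Longrightarrow> b i \<noteq> 0"
  shows "m j = m (- 1)"
  using assms
proof (induction j rule: e_induct)
  case (down j)
  then show ?case using m_down(2)[of j] by (cases "j = 0") simp_all
qed simp_all

lemma m_minus_1: "m (- 1) = d \<or> m (- 1) = Suc d"
  using m_down[of 0] m_0 b_eq_0_iff[of 0] by auto

text \<open>No root of b lies strictly between 0 and 1 - k, so the block keeps its full size up to j
  = - k and a single critical edge follows.\<close>

lemma m_below_1: "k < 1 \<Longrightarrow> m (1 - k) = d \<or> m (1 - k) = Suc d"
  using m_up[of "- k"] m_nonneg[of "- k"] b_eq_0_iff[of "1 - k"] b_eq_0_iff by auto

lemma m_star_above_1: "k > 1 \<Longrightarrow> m (1 - k) = m (- 1)"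
  using m_neg[of "1 - k"] b_eq_0_iff by auto

text \<open>This is the second critical edge below v, so the possible loss is relative to the size
  left after the first one.\<close>

lemma m_above_1: "k > 1 \<Longrightarrow> m (- k) = m (- 1) \<or> Suc (m (- k)) = m (- 1)"
  using m_down[of "1 - k"] m_star_above_1 b_eq_0_iff[of "1 - k"] by auto

end

text \<open>Going outward from \<open>m_0\<close>, block sizes are constant across every edge with b
  nonzero; the hypotheses prescribe them just beyond the critical edges.\<close>

lemma (in sl2_cyclic_nilpotent) m_determined:
  assumes "sl2_cyclic_nilpotent scale' X' Y' H' k v' d"
    and "m (- 1) = sl2_cyclic_nilpotent.m scale' X' Y' H' k v' (- 1)"
    and "k < 1 \<Longrightarrow> m (1 - k) = sl2_cyclic_nilpotent.m scale' X' Y' H' k v' (1 - k)"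
    and "k > 1 \<Longrightarrow> m (- k) = sl2_cyclic_nilpotent.m scale' X' Y' H' k v' (- k)"
  shows "m j = sl2_cyclic_nilpotent.m scale' X' Y' H' k v' j"
proof -
  interpret B: sl2_cyclic_nilpotent scale' X' Y' H' k v' d by fact
  show ?thesis
  proof (induction j rule: e_induct)
    case zero
    show ?case by (simp add: m_0 B.m_0)
  next
    case (up j)
    show ?case
    proof (cases "b (j + 1) = 0")
      case True
      \<comment> \<open>The root 0 is excluded because j + 1 is positive: upward there is a critical
        edge only if k < 1.\<close>
      then have "j + 1 = 1 - k" "k < 1" using up(1) by (auto simp: b_eq_0_iff)
      then show ?thesis using assms(3) by simp
    next
      case False
      then show ?thesis using up m_up(2) B.m_up(2) by simp
    qed
  next
    case (down j)
    show ?case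
    proof (cases "b j = 0")
      case True
      then consider "j = 0" | "j = 1 - k" "k > 1" using down(1) by (force simp: b_eq_0_iff)
      then show ?thesis using assms(2,4) by cases simp_all
    next
      case False
      then show ?thesis using down m_down(2) B.m_down(2) by simp
    qed
  qed
qed

section \<open>The module of a polyharmonic form\<close>

locale maass_lift_data =
  fixes k :: int and d :: nat and f :: "complex \<Rightarrow> complex^'n"
  assumes smooth: "smooth_on f UHP"
    and depth: "zero_on_UHP (laplace_iter k (Suc d) f)"
    and exact: "\<not> zero_on_UHP (laplace_iter k d f)"
begin

sublocale sl2_cyclic
  "fun_scale :: complex \<Rightarrow> (real^2^2 \<Rightarrow> complex^'n) \<Rightarrow> real^2^2 \<Rightarrow> complex^'n"
  "lift_act sl2_X" "lift_act sl2_Y" "lift_act sl2_H" k "maass_lift k f"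
  by unfold_locales (rule lift_act_maass_lift(1)[OF smooth])

lemma smooth_raise_iter: "smooth_on g UHP \<Longrightarrow> smooth_on (raise_iter n j g) UHP"
  by (induction j) (simp_all add: smooth_on_raise_op)

lemma smooth_lower_iter: "smooth_on g UHP \<Longrightarrow> smooth_on (lower_iter n j g) UHP"
  by (induction j) (simp_all add: smooth_on_lower_op)

lemma laplace_op_eq: "laplace_op n g = (\<lambda>\<tau>. (- 1) *s raise_op (n - 2) (lower_op n g) \<tau>)"
  by (simp add: laplace_op_def fun_eq_iff vec_eq_iff)

lemma smooth_laplace_op: "smooth_on (g :: complex \<Rightarrow> complex^'n) UHP \<Longrightarrow> smooth_on (laplace_op n g) UHP"
  unfolding laplace_op_eq
  by (intro smooth_on_scale smooth_on_const smooth_on_raise_op smooth_on_lower_op)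

lemma smooth_laplace_iter: "smooth_on (laplace_iter k i f) UHP"
  by (induction i) (simp_all add: smooth smooth_laplace_op)

lemma D_maass_lift:
  assumes "smooth_on g UHP" shows "D (maass_lift k g) = maass_lift k (laplace_op k g)"
proof -
  have "lift_act sl2_H (maass_lift k g) = fun_scale (of_int (k + 2 * 0)) (maass_lift k g)"
    using lift_act_maass_lift(1)[OF assms] by simp
  from X_Y_weight[OF this]
  have "D (maass_lift k g) = fun_scale (- 1) (lift_act sl2_X (lift_act sl2_Y (maass_lift k g)))"
    by (simp add: b_def)
  also have "\<dots> = maass_lift k (laplace_op k g)"
    by (simp add: lift_act_maass_lift assms smooth_on_lower_op maass_lift_linear laplace_op_eq
        del: fun_vs.scale_minus_left)
  finally show ?thesis .
qed

lemma D_power_maass_lift: "(D ^^ i) (maass_lift k f) = maass_lift k (laplace_iter k i f)"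
  by (induction i) (simp_all add: D_maass_lift smooth_laplace_iter)

sublocale sl2_cyclic_nilpotent
  "fun_scale :: complex \<Rightarrow> (real^2^2 \<Rightarrow> complex^'n) \<Rightarrow> real^2^2 \<Rightarrow> complex^'n"
  "lift_act sl2_X" "lift_act sl2_Y" "lift_act sl2_H" k "maass_lift k f" d
  by unfold_locales (simp_all only: D_power_maass_lift maass_lift_eq_0_iff depth exact not_False_eq_True)

lemma X_power_maass_lift:
  assumes "smooth_on g UHP"
  shows "(lift_act sl2_X ^^ n) (maass_lift k g) = maass_lift (k + 2 * int n) (raise_iter k n g)"
  by (induction n) (simp_all add: lift_act_maass_lift smooth_raise_iter assms algebra_simps)

lemma Y_power_maass_lift:
  assumes "smooth_on g UHP"
  shows "(lift_act sl2_Y ^^ n) (maass_lift k g) = maass_lift (k - 2 * int n) (lower_iter k n g)"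
  by (induction n) (simp_all add: lift_act_maass_lift smooth_lower_iter assms algebra_simps)

lemma e_nonneg: "e (int n) i = maass_lift (k + 2 * int n) (raise_iter k n (laplace_iter k i f))"
  by (simp add: e_def D_power_maass_lift X_power_maass_lift smooth_laplace_iter)

lemma e_nonpos: "e (- int n) i = maass_lift (k - 2 * int n) (lower_iter k n (laplace_iter k i f))"
  by (cases "n = 0") (simp_all add: e_def D_power_maass_lift Y_power_maass_lift smooth_laplace_iter)

text \<open>With its companion \<open>m_lower\<close> it turns the vanishing conditions of the cases
  into inequalities for block sizes.\<close>

lemma m_raise: "j \<ge> 0 \<Longrightarrow> m j \<le> i \<longleftrightarrow> zero_on_UHP (raise_iter k (nat j) (laplace_iter k i f))"
  using e_nonneg[of "nat j" i] by (simp add: maass_lift_eq_0_iff flip: e_eq_0_iff)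

lemma m_lower: "j \<ge> 0 \<Longrightarrow> m (- j) \<le> i \<longleftrightarrow> zero_on_UHP (lower_iter k (nat j) (laplace_iter k i f))"
  using e_nonpos[of "nat j" i] by (simp add: maass_lift_eq_0_iff flip: e_eq_0_iff)

lemma m_lower_1: "m (- 1) \<le> i \<longleftrightarrow> zero_on_UHP (lower_op k (laplace_iter k i f))"
  using m_lower[of 1 i] by simp

lemma e_is_lift: "\<exists>g. smooth_on g UHP \<and> e j i = maass_lift (k + 2 * j) g"
proof (cases "j \<ge> 0")
  case True
  then show ?thesis
    using e_nonneg[of "nat j" i] smooth_raise_iter[OF smooth_laplace_iter] by force
next
  case False
  then show ?thesis
    using e_nonpos[of "nat (- j)" i] smooth_lower_iter[OF smooth_laplace_iter] by force
qed

lemma M_subset_lift_span: "M \<subseteq> lift_span"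
  by (rule M_minimal)
    (simp_all add: subspace_lift_span maass_lift_in_lift_span smooth lift_act_in_lift_span)

lemma lie_act_M: "\<phi> \<in> M \<Longrightarrow> lift_act Z \<phi> = lie_act Z \<phi>"
  using M_subset_lift_span by (intro lift_act_eq) blast

lemma right_translate_e:
  assumes "h \<in> SO2" shows "right_translate h (e j i) = fun_scale (row_eval h 2 powi (- (k + 2 * j))) (e j i)"
proof -
  obtain g where "e j i = maass_lift (k + 2 * j) g" using e_is_lift by blast
  then show ?thesis by (simp only: right_translate_maass_lift[OF assms])
qed

lemma right_translate_linear:
  "right_translate h (\<phi> + \<psi>) = right_translate h \<phi> + right_translate h (\<psi> :: real^2^2 \<Rightarrow> complex^'n)"
  "right_translate h (fun_scale c \<phi>) = fun_scale c (right_translate h \<phi>)"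
  "right_translate h 0 = (0 :: real^2^2 \<Rightarrow> complex^'n)"
  by (simp_all add: fun_eq_iff right_translate_def fun_scale_def)

lemma gK_stable_M: "gK_stable M"
  unfolding gK_stable_def
proof (intro conjI ballI)
  show "fun_vs.subspace M" by (rule subspace_M)
next
  fix h \<phi> assume h: "h \<in> SO2" and "\<phi> \<in> M"
  from this(2) show "right_translate h \<phi> \<in> M"
  proof (induction rule: M_induct)
    case (base j i)
    then show ?case unfolding right_translate_e[OF h] by (rule fun_vs.subspace_scale[OF subspace_M e_in_M])
  next
    case (scale c w)
    then show ?case by (simp only: right_translate_linear fun_vs.subspace_scale[OF subspace_M])
  next
    case (add u w)
    then show ?case by (simp only: right_translate_linear fun_vs.subspace_add[OF subspace_M])
  next
    case zero
    then show ?case by (simp only: right_translate_linear fun_vs.subspace_0[OF subspace_M])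
  qed
next
  fix Z and \<phi> :: "real^2^2 \<Rightarrow> complex^'n" assume "Z \<in> sl2C" and \<phi>: "\<phi> \<in> M"
  then have "\<phi> \<in> lift_span" using M_subset_lift_span by blast
  note lie_act_decompose[OF \<open>Z \<in> sl2C\<close> this, folded lie_act_M[OF \<phi>]]
  then show "lie_act Z \<phi> \<in> M"
    using M_closed[OF \<phi>] by (simp only: fun_vs.subspace_add[OF subspace_M] fun_vs.subspace_scale[OF subspace_M] lie_act_M[OF \<phi>])
qed

lemma maass_module_eq: "maass_module k f = M"
  unfolding maass_module_def gK_generated_def
proof (rule hull_unique)
  show "{maass_lift k f} \<subseteq> M" using e_in_M[of 0 0] by (simp add: e_0_0)
  show "gK_stable M" by (rule gK_stable_M)
  fix N :: "(real^2^2 \<Rightarrow> complex^'n) set" assume N: "{maass_lift k f} \<subseteq> N" "gK_stable N"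
  \<comment> \<open>Minimality of M refers to \<open>lift_act\<close>, which agrees with the true
    action only on \<open>lift_span\<close>; hence the intersection.\<close>
  have "M \<subseteq> N \<inter> lift_span"
  proof (rule M_minimal)
    show "fun_vs.subspace (N \<inter> lift_span)"
      using N(2) subspace_lift_span by (auto simp: gK_stable_def intro: fun_vs.subspace_inter)
    show "maass_lift k f \<in> N \<inter> lift_span" using N(1) smooth by (simp add: maass_lift_in_lift_span)
    show "lift_act sl2_X w \<in> N \<inter> lift_span \<and> lift_act sl2_Y w \<in> N \<inter> lift_span \<and> lift_act sl2_H w \<in> N \<inter> lift_span"
      if "w \<in> N \<inter> lift_span" for w
      using that N(2) by (simp add: lift_act_in_lift_span) (simp add: lift_act_eq gK_stable_def)
  qed
  then show "M \<subseteq> N" by blast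
qed

lemma weight_space_eq: "weight_space (maass_module k f) (k + 2 * j) = E j"
proof -
  have "weight_space (maass_module k f) (k + 2 * j) = {\<phi> \<in> M. lift_act sl2_H \<phi> = fun_scale (of_int (k + 2 * j)) \<phi>}"
    unfolding weight_space_def maass_module_eq using lie_act_M by auto
  then show ?thesis by (simp only: weight_space_M)
qed

end

section \<open>Dimension vectors and the ten cases\<close>

context maass_lift_data
begin

lemma gelfand_data:
  assumes "maass_l k \<ge> 1" "s = 0 \<or> s = 1 - k" "s + int (maass_l k) = 0 \<or> s + int (maass_l k) = 1 - k"
    and "k + 2 * s = 1 - int (maass_l k)"
  shows "gelfand_data fun_scale (lift_act sl2_X) (lift_act sl2_Y) (lift_act sl2_H) k (maass_lift k f) d
    s (maass_l k) (lie_act sl2_X) (lie_act sl2_Y)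
    (gelfand_space (maass_l k) (maass_module k f)) (gelfand_map (maass_l k) (maass_module k f))"
proof
  have W: "weight_space (maass_module k f) n = E j" if "n = k + 2 * j" for n j
    using weight_space_eq that by simp
  show "1 \<le> maass_l k" by fact
  show "b s = 0" "b (s + int (maass_l k)) = 0" using assms(2,3) b_eq_0_iff by blast+
  show "\<And>w. w \<in> M \<Longrightarrow> lie_act sl2_X w = lift_act sl2_X w" "\<And>w. w \<in> M \<Longrightarrow> lie_act sl2_Y w = lift_act sl2_Y w"
    using lie_act_M by simp_all
  have minus: "weight_space (maass_module k f) (- int (maass_l k) - 1) = E (s - 1)"
    by (rule W) (use assms(4) in \<open>simp add: algebra_simps\<close>)
  have star: "weight_space (maass_module k f) (- int (maass_l k) + 1) = E s"
    by (rule W) (use assms(4) in \<open>simp add: algebra_simps\<close>)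
  have plus: "weight_space (maass_module k f) (int (maass_l k) + 1) = E (s + int (maass_l k))"
    by (rule W) (use assms(4) in \<open>simp add: algebra_simps\<close>)
  show "gelfand_space (maass_l k) (maass_module k f) Gel_minus = E (s - 1)"
    "gelfand_space (maass_l k) (maass_module k f) Gel_star = E s"
    "gelfand_space (maass_l k) (maass_module k f) Gel_plus = E (s + int (maass_l k))"
    by (simp_all only: gelfand_space_def gelfand_vertex.case minus star plus)
  show "gelfand_map (maass_l k) (maass_module k f) Gel_a_minus = lie_act sl2_X"
    "gelfand_map (maass_l k) (maass_module k f) Gel_b_minus = lie_act sl2_Y"
    "gelfand_map (maass_l k) (maass_module k f) Gel_b_plus = lie_act sl2_X ^^ maass_l k"
    "gelfand_map (maass_l k) (maass_module k f) Gel_a_plus =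
      inv_into (E s) (lie_act sl2_X ^^ (maass_l k - 1)) \<circ> lie_act sl2_Y"
    by (simp_all only: gelfand_map_def gelfand_arrow.case star)
qed

lemma gelfand_below_1:
  assumes "k < 1"
  shows "gelfand_cyclic_with_dims k f Gel_star (m (- 1), Suc d, m (1 - k))"
proof -
  have l: "int (maass_l k) = 1 - k" using assms by (simp add: maass_l_def)
  interpret Q: gelfand_data fun_scale "lift_act sl2_X" "lift_act sl2_Y" "lift_act sl2_H" k "maass_lift k f" d
    0 "maass_l k" "lie_act sl2_X" "lie_act sl2_Y"
    "gelfand_space (maass_l k) (maass_module k f)" "gelfand_map (maass_l k) (maass_module k f)"
    by (rule gelfand_data) (use l assms in auto)
  show ?thesis
    unfolding gelfand_cyclic_with_dims_def Let_def
    using Q.gelfand_rep Q.cyclic_star Q.dims by (simp add: l m_0)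
qed

lemma gelfand_above_1:
  assumes "k > 1"
  shows "gelfand_cyclic_with_dims k f Gel_plus (m (- k), m (1 - k), Suc d)"
proof -
  have l: "int (maass_l k) = k - 1" using assms by (simp add: maass_l_def)
  interpret Q: gelfand_data fun_scale "lift_act sl2_X" "lift_act sl2_Y" "lift_act sl2_H" k "maass_lift k f" d
    "1 - k" "maass_l k" "lie_act sl2_X" "lie_act sl2_Y"
    "gelfand_space (maass_l k) (maass_module k f)" "gelfand_map (maass_l k) (maass_module k f)"
    by (rule gelfand_data) (use l assms in auto)
  show ?thesis
    unfolding gelfand_cyclic_with_dims_def Let_def
    using Q.gelfand_rep Q.cyclic_plus Q.dims by (simp add: l m_0)
qed

lemma two_cyclic_1:
  assumes "k = 1"
  shows "two_cyclic_cyclic_with_dims k f Cyc_plus (m (- 1), Suc d)"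
proof -
  have W: "weight_space (maass_module k f) n = E j" if "n = k + 2 * j" for n j
    using weight_space_eq that by simp
  interpret Q: two_cyclic_data fun_scale "lift_act sl2_X" "lift_act sl2_Y" "lift_act sl2_H" k "maass_lift k f" d
    "lie_act sl2_X" "lie_act sl2_Y" "two_cyclic_space (maass_module k f)" two_cyclic_map
  proof
    show "\<And>w. w \<in> M \<Longrightarrow> lie_act sl2_X w = lift_act sl2_X w" "\<And>w. w \<in> M \<Longrightarrow> lie_act sl2_Y w = lift_act sl2_Y w"
      using lie_act_M by simp_all
    have minus: "weight_space (maass_module k f) (- 1) = E (- 1)"
      by (rule W) (use assms in simp)
    have plus: "weight_space (maass_module k f) 1 = E 0"
      by (rule W) (use assms in simp)
    show "two_cyclic_space (maass_module k f) Cyc_minus = E (- 1)"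
      "two_cyclic_space (maass_module k f) Cyc_plus = E 0"
      by (simp_all only: two_cyclic_space_def two_cyclic_vertex.case minus plus)
    show "two_cyclic_map Cyc_a = lie_act sl2_X" "two_cyclic_map Cyc_b = lie_act sl2_Y"
      by (simp_all only: two_cyclic_map_def two_cyclic_arrow.case)
  qed
  show ?thesis
    unfolding two_cyclic_cyclic_with_dims_def Let_def
    using Q.two_cyclic_rep Q.cyclic_plus Q.dims by simp
qed

text \<open>Each critical edge admits only two sizes, so one inequality decides between them. In
  IIId the bound \<open>m (- k) \<le> d - 1\<close> forces a loss at both edges, and
  \<open>Suc (m (- k)) = d\<close> already contains d \<ge> 1.\<close>

lemma in_case_m:
  shows "in_case Case_Ia k d f \<longleftrightarrow> k < 1 \<and> m (- 1) = d \<and> m (1 - k) = d"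
    and "in_case Case_Ib k d f \<longleftrightarrow> k < 1 \<and> m (- 1) = d \<and> m (1 - k) = Suc d"
    and "in_case Case_Ic k d f \<longleftrightarrow> k < 1 \<and> m (- 1) = Suc d \<and> m (1 - k) = d"
    and "in_case Case_Id k d f \<longleftrightarrow> k < 1 \<and> m (- 1) = Suc d \<and> m (1 - k) = Suc d"
    and "in_case Case_IIa k d f \<longleftrightarrow> k = 1 \<and> m (- 1) = d"
    and "in_case Case_IIb k d f \<longleftrightarrow> k = 1 \<and> m (- 1) = Suc d"
    and "in_case Case_IIIa k d f \<longleftrightarrow> k > 1 \<and> m (- 1) = d \<and> m (- k) = d"
    and "in_case Case_IIIb k d f \<longleftrightarrow> k > 1 \<and> m (- 1) = Suc d \<and> m (- k) = d"
    and "in_case Case_IIIc k d f \<longleftrightarrow> k > 1 \<and> m (- 1) = Suc d \<and> m (- k) = Suc d"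
    and "in_case Case_IIId k d f \<longleftrightarrow> k > 1 \<and> m (- 1) = d \<and> Suc (m (- k)) = d"
proof -
  note defs = in_case.simps m_lower_1[symmetric]
  have R: "zero_on_UHP (raise_iter k (nat (1 - k)) (laplace_iter k i f)) \<longleftrightarrow> m (1 - k) \<le> i" if "k < 1" for i
    using m_raise[of "1 - k"] that by simp
  have L: "zero_on_UHP (lower_iter k (nat k) (laplace_iter k i f)) \<longleftrightarrow> m (- k) \<le> i" if "k > 1" for i
    using m_lower[of k] that by simp
  note below = m_below_1 m_minus_1 and above = m_above_1 m_minus_1
  show "in_case Case_Ia k d f \<longleftrightarrow> k < 1 \<and> m (- 1) = d \<and> m (1 - k) = d"
    "in_case Case_Ib k d f \<longleftrightarrow> k < 1 \<and> m (- 1) = d \<and> m (1 - k) = Suc d"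
    "in_case Case_Ic k d f \<longleftrightarrow> k < 1 \<and> m (- 1) = Suc d \<and> m (1 - k) = d"
    "in_case Case_Id k d f \<longleftrightarrow> k < 1 \<and> m (- 1) = Suc d \<and> m (1 - k) = Suc d"
    using below unfolding defs by (auto simp: R)
  show "in_case Case_IIa k d f \<longleftrightarrow> k = 1 \<and> m (- 1) = d"
    "in_case Case_IIb k d f \<longleftrightarrow> k = 1 \<and> m (- 1) = Suc d"
    using m_minus_1 unfolding defs by auto
  show "in_case Case_IIIa k d f \<longleftrightarrow> k > 1 \<and> m (- 1) = d \<and> m (- k) = d"
    "in_case Case_IIIb k d f \<longleftrightarrow> k > 1 \<and> m (- 1) = Suc d \<and> m (- k) = d"
    "in_case Case_IIIc k d f \<longleftrightarrow> k > 1 \<and> m (- 1) = Suc d \<and> m (- k) = Suc d"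
    "in_case Case_IIId k d f \<longleftrightarrow> k > 1 \<and> m (- 1) = d \<and> Suc (m (- k)) = d"
    using above unfolding defs by (auto simp: L)
qed

lemma ex1_case: "\<exists>!c. in_case c k d f"
proof -
  consider "k < 1" | "k = 1" | "k > 1" by linarith
  then have "\<exists>c. in_case c k d f"
  proof cases
    case 1
    then have "in_case Case_Ia k d f \<or> in_case Case_Ib k d f \<or> in_case Case_Ic k d f \<or> in_case Case_Id k d f"
      using m_below_1 m_minus_1 unfolding in_case_m by blast
    then show ?thesis by blast
  next
    case 2
    then have "in_case Case_IIa k d f \<or> in_case Case_IIb k d f"
      using m_minus_1 unfolding in_case_m by blast
    then show ?thesis by blast
  next
    case 3
    then have "in_case Case_IIIa k d f \<or> in_case Case_IIIb k d f \<or> in_case Case_IIIc k d f \<or> in_case Case_IIId k d f"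
      using m_above_1 m_minus_1 unfolding in_case_m by auto
    then show ?thesis by blast
  qed
  moreover have "c = c'" if "in_case c k d f" "in_case c' k d f" for c c'
    using that by (cases c; cases c'; hypsubst; unfold in_case_m; simp)
  ultimately show ?thesis by blast
qed

end

section \<open>Comparison of two forms in the same case\<close>

lemma maass_module_isomorphic:
  fixes f :: "complex \<Rightarrow> complex^'n" and f' :: "complex \<Rightarrow> complex^'m"
  assumes "maass_lift_data k d f" "maass_lift_data k d f'" "in_case c k d f" "in_case c k d f'"
  shows "gK_isomorphic (maass_module k f) (maass_module k f')"
proof -
  interpret A: maass_lift_data k d f by fact
  interpret B: maass_lift_data k d f' by fact
  have m: "A.m j = B.m j" for j
  proof (rule A.m_determined[OF B.sl2_cyclic_nilpotent_axioms])
    show "A.m (- 1) = B.m (- 1)" "k < 1 \<Longrightarrow> A.m (1 - k) = B.m (1 - k)" "k > 1 \<Longrightarrow> A.m (- k) = B.m (- k)"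
      using assms(3,4) by (cases c; hypsubst; unfold A.in_case_m B.in_case_m; simp)+
  qed
  interpret P: sl2_cyclic_pair fun_scale "lift_act sl2_X" "lift_act sl2_Y" "lift_act sl2_H" "maass_lift k f" d
    fun_scale "lift_act sl2_X" "lift_act sl2_Y" "lift_act sl2_H" "maass_lift k f'" d k
    by unfold_locales (simp add: m)
  obtain T where T: "Vector_Spaces.linear fun_scale fun_scale T" "bij_betw T A.M B.M"
    "\<And>j i. T (A.e j i) = B.e j i"
    using P.ex_iso m by blast
  interpret T: Vector_Spaces.linear fun_scale fun_scale T by (rule T)
  note hom = P.hom_intertwines[OF T(1,3)]
  have "T (right_translate h \<phi>) = right_translate h (T \<phi>)" if h: "h \<in> SO2" and "\<phi> \<in> A.M" for h \<phi>
    using that(2)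
  proof (induction rule: A.M_induct)
    case (base j i)
    show ?case by (simp only: A.right_translate_e[OF h] B.right_translate_e[OF h] T.scale T(3))
  qed (simp_all only: A.right_translate_linear B.right_translate_linear T.add T.scale T.zero)
  moreover have "T (lie_act Z \<phi>) = lie_act Z (T \<phi>)" if Z: "Z \<in> sl2C" and \<phi>: "\<phi> \<in> A.M" for Z \<phi>
  proof -
    \<comment> \<open>Both sides can now be decomposed with the same coordinates of Z, which leaves
      the three intertwining relations.\<close>
    have "\<phi> \<in> lift_span" "T \<phi> \<in> lift_span"
      using A.M_subset_lift_span B.M_subset_lift_span \<phi> hom(1) by blast+
    note d = this[THEN lie_act_decompose[OF Z]]
    show ?thesis
      unfolding d
      by (simp only: T.add T.scale flip: A.lie_act_M[OF \<phi>] B.lie_act_M[OF hom(1)[OF \<phi>]])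
        (simp only: hom[OF \<phi>])
  qed
  ultimately show ?thesis
    unfolding gK_isomorphic_def A.maass_module_eq B.maass_module_eq
    using T(2) T.add T.scale by blast
qed

lemma exact_depth_imp_maass_lift_data:
  assumes "exact_depth_maass_form \<Gamma> \<rho> k d f"
  shows "maass_lift_data k d f"
proof
  show "smooth_on f UHP" "zero_on_UHP (laplace_iter k (Suc d) f)" "\<not> zero_on_UHP (laplace_iter k d f)"
    using assms by (auto simp: exact_depth_maass_form_def polyharmonic_weak_maass_form_def)
qed

theorem mainTheorem1:
  fixes \<Gamma> :: "(real^2^2) set"
    and \<rho> :: "real^2^2 \<Rightarrow> complex^'n^'n"
    and k :: int and d :: nat
    and f :: "complex \<Rightarrow> complex^'n"
  assumes "finite_index_rep \<Gamma> \<rho>"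
    and "exact_depth_maass_form \<Gamma> \<rho> k d f"
  shows "(\<exists>!c. in_case c k d f) \<and>
    (in_case Case_Ia k d f \<longrightarrow> gelfand_cyclic_with_dims k f Gel_star (d, d + 1, d)) \<and>
    (in_case Case_Ib k d f \<longrightarrow> gelfand_cyclic_with_dims k f Gel_star (d, d + 1, d + 1)) \<and>
    (in_case Case_Ic k d f \<longrightarrow> gelfand_cyclic_with_dims k f Gel_star (d + 1, d + 1, d)) \<and>
    (in_case Case_Id k d f \<longrightarrow> gelfand_cyclic_with_dims k f Gel_star (d + 1, d + 1, d + 1)) \<and>
    (in_case Case_IIa k d f \<longrightarrow> two_cyclic_cyclic_with_dims k f Cyc_plus (d, d + 1)) \<and>
    (in_case Case_IIb k d f \<longrightarrow> two_cyclic_cyclic_with_dims k f Cyc_plus (d + 1, d + 1)) \<and>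
    (in_case Case_IIIa k d f \<longrightarrow> gelfand_cyclic_with_dims k f Gel_plus (d, d, d + 1)) \<and>
    (in_case Case_IIIb k d f \<longrightarrow> gelfand_cyclic_with_dims k f Gel_plus (d, d + 1, d + 1)) \<and>
    (in_case Case_IIIc k d f \<longrightarrow> gelfand_cyclic_with_dims k f Gel_plus (d + 1, d + 1, d + 1)) \<and>
    (in_case Case_IIId k d f \<longrightarrow> gelfand_cyclic_with_dims k f Gel_plus (d - 1, d, d + 1)) \<and>
    (\<forall>c \<Gamma>' (\<rho>' :: real^2^2 \<Rightarrow> complex^'m^'m) f'.
       finite_index_rep \<Gamma>' \<rho>' \<and> exact_depth_maass_form \<Gamma>' \<rho>' k d f' \<and>
       in_case c k d f \<and> in_case c k d f' \<longrightarrow>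
       gK_isomorphic (maass_module k f) (maass_module k f'))"
proof -
  interpret maass_lift_data k d f
    by (rule exact_depth_imp_maass_lift_data[OF assms(2)])
  show ?thesis
  proof (intro conjI impI allI)
    show "\<exists>!c. in_case c k d f" by (rule ex1_case)
  next
    assume "in_case Case_IIId k d f"
    \<comment> \<open>The natural number subtraction is exact, since the case gives
      \<open>Suc (m (- k)) = d\<close>.\<close>
    then have "k > 1" "m (- 1) = d" "m (- k) = d - 1" unfolding in_case_m by auto
    then show "gelfand_cyclic_with_dims k f Gel_plus (d - 1, d, d + 1)"
      using gelfand_above_1 m_star_above_1 by simp
  next
    fix c \<Gamma>' f' and \<rho>' :: "real^2^2 \<Rightarrow> complex^'m^'m"
    assume "finite_index_rep \<Gamma>' \<rho>' \<and> exact_depth_maass_form \<Gamma>' \<rho>' k d f' \<and>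
       in_case c k d f \<and> in_case c k d f'"
    then show "gK_isomorphic (maass_module k f) (maass_module k f')"
      using maass_module_isomorphic[OF maass_lift_data_axioms exact_depth_imp_maass_lift_data] by blast
  qed (unfold in_case_m, use gelfand_below_1 two_cyclic_1 gelfand_above_1 m_star_above_1 in auto)
qed

end
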